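(* Let $X$ be a Stein manifold of dimension $n\geq 2$ which admits an $\mathbb{R}_+$-complete holomorphic vector field $V$ with a unique equilibrium point that is globally asymptotically stable on $X$. Then $X$ admits a holomorphic Stein and Runge embedding in $\mathbb{C}^n$.
   Context: A complex manifold $M$ admits an $\mathbb{R}_+$-complete holomorphic vector field $V$ with a unique equilibrium point $p$ which is globally asymptotically stable on $M$ if: (1) the initial value problem $\frac{\partial\theta}{\partial t}(t,z)=V(\theta(t,z))$, $t\geq 0$, $\theta(0,z)=z$, has a solution in $M$ for all $t\in[0,\infty)$ and all $z\in M$; (2) $\lim_{t\to\infty}\theta(t,z)=p$ for each $z\in M$; (3) for any neighborhood $V_p$ of $p$ in $M$ there exists a neighborhood $U_p$ of $p$ such that $\theta(t,z)\in V_p$ for all $t\geq 0$ and all $z\in U_p$. A holomorphic Stein and Runge embedding of an $n$-dimensional complex manifold $X$ in $\mathbb{C}^n$ is an injective holomorphic map $\Phi:X\to\mathbb{C}^n$ such that $\Phi(X)$ is Stein and Runge in $\mathbb{C}^n$, i.e. every holomorphic function on $\Phi(X)$ can be approximated, locally uniformly on $\Phi(X)$, by restrictions of entire functions. *)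

theory Defs
  imports "HOL-Analysis.Analysis"
begin

section \<open>Holomorphic functions of several complex variables\<close>

text \<open>Both notions are only used on open sets \<open>S\<close>; there the derivative at \<open>z\<close> does not depend
  on values outside \<open>S\<close>.\<close>

definition holo_fun :: "(complex^'n \<Rightarrow> complex) \<Rightarrow> (complex^'n) set \<Rightarrow> bool" where
  "holo_fun f S \<longleftrightarrow>
     (\<forall>z\<in>S. \<exists>D. (f has_derivative D) (at z) \<and> (\<forall>c v. D (c *s v) = c * D v))"

definition holo_map :: "(complex^'n \<Rightarrow> complex^'m) \<Rightarrow> (complex^'n) set \<Rightarrow> bool" where
  "holo_map F S \<longleftrightarrow> (\<forall>i. holo_fun (\<lambda>z. F z $ i) S)"


section \<open>Complex manifolds\<close>

text \<open>A chart is a pair \<open>(U, \<phi>)\<close>; values of \<open>\<phi>\<close> outside its domain \<open>U\<close> are irrelevant. The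
  dimension \<open>n\<close> of a manifold is \<open>CARD('n)\<close>. No connectedness is required.\<close>

type_synonym ('a, 'n) chart = "'a set \<times> ('a \<Rightarrow> complex^'n)"

definition chart_on :: "'a topology \<Rightarrow> ('a, 'n::finite) chart \<Rightarrow> bool" where
  "chart_on X = (\<lambda>(U, \<phi>). openin X U \<and> open (\<phi> ` U) \<and>
     homeomorphic_map (subtopology X U) (top_of_set (\<phi> ` U)) \<phi>)"

definition transition ::
    "('a, 'n::finite) chart \<Rightarrow> ('a, 'n) chart \<Rightarrow> complex^'n \<Rightarrow> complex^'n" where
  "transition = (\<lambda>(U, \<phi>) (W, \<psi>). \<psi> \<circ> inv_into U \<phi>)"

text \<open>The condition is imposed on all ordered pairs of charts, hence transition maps are
  biholomorphic.\<close>

definition complex_manifold :: "'a topology \<Rightarrow> ('a, 'n::finite) chart set \<Rightarrow> bool" where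
  "complex_manifold X A \<longleftrightarrow>
     Hausdorff_space X \<and> second_countable X \<and>
     (\<forall>c\<in>A. chart_on X c) \<and> (\<Union>(U, \<phi>)\<in>A. U) = topspace X \<and>
     (\<forall>(U, \<phi>)\<in>A. \<forall>(W, \<psi>)\<in>A. holo_map (transition (U, \<phi>) (W, \<psi>)) (\<phi> ` (U \<inter> W)))"

definition manifold_holo_fun :: "('a, 'n::finite) chart set \<Rightarrow> ('a \<Rightarrow> complex) \<Rightarrow> bool" where
  "manifold_holo_fun A f \<longleftrightarrow> (\<forall>(U, \<phi>)\<in>A. holo_fun (f \<circ> inv_into U \<phi>) (\<phi> ` U))"

definition manifold_holo_map :: "('a, 'n::finite) chart set \<Rightarrow> ('a \<Rightarrow> complex^'m) \<Rightarrow> bool" where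
  "manifold_holo_map A F \<longleftrightarrow> (\<forall>i. manifold_holo_fun A (\<lambda>x. F x $ i))"


section \<open>Stein manifolds\<close>

definition holo_hull :: "'a topology \<Rightarrow> ('a, 'n::finite) chart set \<Rightarrow> 'a set \<Rightarrow> 'a set" where
  "holo_hull X A K =
     {x \<in> topspace X. \<forall>f. manifold_holo_fun A f \<longrightarrow> cmod (f x) \<le> (SUP y\<in>K. cmod (f y))}"

text \<open>The empty set (whose hull is empty) is excluded because \<open>Sup {}\<close> is unspecified on the
  reals.\<close>

definition holomorphically_convex :: "'a topology \<Rightarrow> ('a, 'n::finite) chart set \<Rightarrow> bool" where
  "holomorphically_convex X A \<longleftrightarrow>
     (\<forall>K. compactin X K \<and> K \<noteq> {} \<longrightarrow> compactin X (holo_hull X A K))"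

definition holomorphically_separable :: "'a topology \<Rightarrow> ('a, 'n::finite) chart set \<Rightarrow> bool" where
  "holomorphically_separable X A \<longleftrightarrow>
     (\<forall>x\<in>topspace X. \<forall>y\<in>topspace X. x \<noteq> y \<longrightarrow> (\<exists>f. manifold_holo_fun A f \<and> f x \<noteq> f y))"

text \<open>Around every point, \<open>n\<close> global holomorphic functions form a coordinate system: the chart
  \<open>(W, F)\<close> is compatible with the atlas.\<close>

definition has_global_coordinates :: "'a topology \<Rightarrow> ('a, 'n::finite) chart set \<Rightarrow> bool" where
  "has_global_coordinates X A \<longleftrightarrow>
     (\<forall>x\<in>topspace X. \<exists>W F. x \<in> W \<and> manifold_holo_map A F \<and>
        complex_manifold X (insert (W, F) A))"

definition stein_manifold :: "'a topology \<Rightarrow> ('a, 'n::finite) chart set \<Rightarrow> bool" where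
  "stein_manifold X A \<longleftrightarrow> complex_manifold X A \<and> holomorphically_convex X A \<and>
     holomorphically_separable X A \<and> has_global_coordinates X A"


section \<open>Holomorphic vector fields\<close>

text \<open>A vector field is given by its principal parts: \<open>V (U, \<phi>) x\<close> is the coordinate vector in the
  chart \<open>(U, \<phi>)\<close> of the tangent vector at \<open>x\<close>, and the representations in different charts
  are related by the derivative of the transition map.\<close>

type_synonym ('a, 'n) vfield = "('a, 'n) chart \<Rightarrow> 'a \<Rightarrow> complex^'n"

definition holomorphic_vector_field ::
    "('a, 'n::finite) chart set \<Rightarrow> ('a, 'n) vfield \<Rightarrow> bool" where
  "holomorphic_vector_field A V \<longleftrightarrow>
     (\<forall>(U, \<phi>)\<in>A. holo_map (V (U, \<phi>) \<circ> inv_into U \<phi>) (\<phi> ` U)) \<and>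
     (\<forall>(U, \<phi>)\<in>A. \<forall>(W, \<psi>)\<in>A. \<forall>x\<in>U \<inter> W.
        V (W, \<psi>) x =
          frechet_derivative (transition (U, \<phi>) (W, \<psi>)) (at (\<phi> x)) (V (U, \<phi>) x))"

definition equilibrium_point ::
    "'a topology \<Rightarrow> ('a, 'n::finite) chart set \<Rightarrow> ('a, 'n) vfield \<Rightarrow> 'a \<Rightarrow> bool" where
  "equilibrium_point X A V p \<longleftrightarrow>
     p \<in> topspace X \<and> (\<forall>(U, \<phi>)\<in>A. p \<in> U \<longrightarrow> V (U, \<phi>) p = 0)"

text \<open>Continuity keeps \<open>\<gamma> s\<close> in the chart domain for \<open>s\<close> near \<open>t\<close>, so that the derivative in
  the chart is meaningful; at \<open>t = 0\<close> it is one-sided.\<close>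

definition integral_curve ::
    "'a topology \<Rightarrow> ('a, 'n::finite) chart set \<Rightarrow> ('a, 'n) vfield \<Rightarrow> (real \<Rightarrow> 'a) \<Rightarrow> bool" where
  "integral_curve X A V \<gamma> \<longleftrightarrow>
     continuous_map (top_of_set {0..}) X \<gamma> \<and>
     (\<forall>t\<ge>0. \<forall>(U, \<phi>)\<in>A. \<gamma> t \<in> U \<longrightarrow>
        ((\<lambda>s. \<phi> (\<gamma> s)) has_vector_derivative V (U, \<phi>) (\<gamma> t)) (at t within {0..}))"

definition forward_flow ::
    "'a topology \<Rightarrow> ('a, 'n::finite) chart set \<Rightarrow> ('a, 'n) vfield \<Rightarrow> (real \<Rightarrow> 'a \<Rightarrow> 'a) \<Rightarrow> bool" where
  "forward_flow X A V \<theta> \<longleftrightarrow>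
     (\<forall>z\<in>topspace X. \<theta> 0 z = z \<and> integral_curve X A V (\<lambda>t. \<theta> t z))"

definition globally_asymptotically_stable ::
    "'a topology \<Rightarrow> (real \<Rightarrow> 'a \<Rightarrow> 'a) \<Rightarrow> 'a \<Rightarrow> bool" where
  "globally_asymptotically_stable X \<theta> p \<longleftrightarrow>
     (\<forall>z\<in>topspace X. limitin X (\<lambda>t. \<theta> t z) p at_top) \<and>
     (\<forall>W. openin X W \<and> p \<in> W \<longrightarrow>
        (\<exists>U. openin X U \<and> p \<in> U \<and> (\<forall>t\<ge>0. \<forall>z\<in>U. \<theta> t z \<in> W)))"

text \<open>The forward flow of a holomorphic vector field, when it exists, is unique for \<open>t \<ge> 0\<close>,
  so quantifying over it existentially is harmless.\<close>

definition complete_gas_vector_field ::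
    "'a topology \<Rightarrow> ('a, 'n::finite) chart set \<Rightarrow> ('a, 'n) vfield \<Rightarrow> bool" where
  "complete_gas_vector_field X A V \<longleftrightarrow>
     holomorphic_vector_field A V \<and>
     (\<exists>p \<theta>. (\<forall>q. equilibrium_point X A V q \<longleftrightarrow> q = p) \<and>
        forward_flow X A V \<theta> \<and> globally_asymptotically_stable X \<theta> p)"


section \<open>Stein and Runge embeddings\<close>

text \<open>A set \<open>D\<close> in \<open>n\<close>-space is viewed as a manifold with the single chart \<open>(D, id)\<close>; being a
  chart forces \<open>D\<close> to be open.\<close>

definition stein_domain :: "(complex^'n::finite) set \<Rightarrow> bool" where
  "stein_domain D \<longleftrightarrow> stein_manifold (top_of_set D) {(D, id)}"

definition runge :: "(complex^'n::finite) set \<Rightarrow> bool" where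
  "runge D \<longleftrightarrow>
     (\<forall>f. holo_fun f D \<longrightarrow>
        (\<forall>K \<epsilon>. compact K \<and> K \<subseteq> D \<and> 0 < \<epsilon> \<longrightarrow>
           (\<exists>g. holo_fun g UNIV \<and> (\<forall>z\<in>K. cmod (f z - g z) < \<epsilon>))))"

definition stein_runge_embedding ::
    "'a topology \<Rightarrow> ('a, 'n::finite) chart set \<Rightarrow> ('a \<Rightarrow> complex^'n) \<Rightarrow> bool" where
  "stein_runge_embedding X A \<Phi> \<longleftrightarrow>
     manifold_holo_map A \<Phi> \<and> inj_on \<Phi> (topspace X) \<and>
     stein_domain (\<Phi> ` topspace X) \<and> runge (\<Phi> ` topspace X)"

end

theory Submission
  imports Defs "HOL-Complex_Analysis.Complex_Analysis"
begin

text \<open>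
  For large \<open>T\<close> the flow map \<open>\<theta> T\<close> is a contraction \<open>F\<close> near the equilibrium \<open>p\<close>. Since \<open>n \<ge> 2\<close>, shears and
  overshears generate all jets, so that some automorphism \<open>G\<close> of \<open>n\<close>-space agrees with \<open>F\<close> at \<open>p\<close> to an
  order so high that \<open>G\<^sup>-\<^sup>k \<circ> F\<^sup>k\<close> converges near \<open>p\<close>. The limit conjugates \<open>F\<close> to \<open>G\<close> and extends to \<open>X\<close>
  along the flow as the injective map \<open>\<Phi> = G\<^sup>-\<^sup>k \<circ> \<Psi> \<circ> \<theta> (kT)\<close>. Unlike in the theorem of Rosay and Rudin, \<open>G\<close>
  need not be attracting globally.

  No solution theory for differential equations is needed: since the flow is given, its holomorphy
  and its extension to complex times follow from the Lie series \<open>\<Sum> t\<^sup>k (V\<^sup>k f)(z) / k!\<close>, which converges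
  by nested Cauchy estimates. In particular \<open>f \<circ> \<theta> t\<close> is analytic in \<open>t\<close>. It is approximable by entire
  functions in the coordinates \<open>\<Phi>\<close> for large \<open>t\<close>, and hence also for \<open>t = 0\<close>, which is the Runge property.
\<close>

text \<open>The flow is complete only forwards, so \<open>\<theta> t\<close> is injective but in
  general not onto, and no global inverse is available. Local inverses replace it: near a point
  \<open>\<theta> \<tau>\<close> is undone by the Lie series at time \<open>- \<tau>\<close>, and
  along an orbit this is recorded as a statement about germs, namely that every germ at
  \<open>x\<close> is the pullback of a germ at \<open>\<theta> t x\<close>. Germs are used because
  an orbit need not stay in one chart.

  In one variable the automorphisms of the plane are affine and cannot match a higher jet. In
  dimension at least 2 every linear form has a nontrivial kernel, and moving points along that
  kernel produces nonlinear automorphisms.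

  That \<open>G\<close> need not attract globally is harmless for two reasons. Injectivity of
  \<open>\<Phi>\<close> uses only that \<open>G\<close>, \<open>\<theta> t\<close> and the local
  conjugacy are injective. In the approximation argument the iterates of \<open>G\<close> are merely
  composed with entire functions; it is the flow, not \<open>G\<close>, that brings compact sets
  near the equilibrium.\<close>

no_notation fps_nth (infixl "$" 75)

section \<open>Holomorphic functions of several variables\<close>

lemma norm_smult: "norm (c *s v) = cmod c * norm (v :: complex^'n)"
  by (simp add: norm_vec_def norm_mult L2_set_right_distrib)

lemma smult_of_real: "(of_real t :: complex) *s v = t *\<^sub>R (v :: complex^'n)"
  by (simp add: vec_eq_iff scaleR_conv_of_real[where 'a = complex])

lemma bounded_linear_smult_left: "bounded_linear (\<lambda>\<zeta>::complex. \<zeta> *s (v :: complex^'n))"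
  by (rule bounded_linear_intro[where K = "norm v"])
     (auto simp: vec_eq_iff algebra_simps norm_smult)

lemma bounded_linear_smult_right: "bounded_linear (\<lambda>v :: complex^'n. (c::complex) *s v)"
  by (rule bounded_linear_intro[where K = "cmod c"])
     (auto simp: vec_eq_iff algebra_simps norm_smult)

lemmas has_derivative_smult_left = bounded_linear.has_derivative[OF bounded_linear_smult_left]
lemmas has_derivative_smult_right = bounded_linear.has_derivative[OF bounded_linear_smult_right]

lemma continuous_on_smult [continuous_intros]:
  fixes f :: "'a::topological_space \<Rightarrow> complex" and g :: "'a \<Rightarrow> complex^'n"
  assumes "continuous_on S f" "continuous_on S g"
  shows "continuous_on S (\<lambda>x. f x *s g x)"
proof -
  have "(\<lambda>x. f x *s g x) = (\<lambda>x. \<chi> i. f x * g x $ i)" by (simp add: fun_eq_iff vec_eq_iff)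
  moreover have "continuous_on S (\<lambda>x. \<chi> i. f x * g x $ i)"
    by (intro continuous_intros assms)
  ultimately show ?thesis by metis
qed

lemma holo_fun_line_deriv:
  fixes f :: "complex^'n \<Rightarrow> complex"
  assumes "(f has_derivative D) (at (z + \<zeta> *s v))" "\<And>c w. D (c *s w) = c * D w"
  shows "((\<lambda>\<zeta>. f (z + \<zeta> *s v)) has_field_derivative D v) (at \<zeta>)"
proof -
  have "((\<lambda>\<zeta>. z + \<zeta> *s v) has_derivative (\<lambda>h. h *s v)) (at \<zeta>)"
    using has_derivative_add[OF has_derivative_const has_derivative_smult_left[OF has_derivative_ident, of v]]
    by fastforce
  then have "((\<lambda>\<zeta>. f (z + \<zeta> *s v)) has_derivative (\<lambda>h. D (h *s v))) (at \<zeta>)"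
    by (rule has_derivative_compose) (use assms in auto)
  then show ?thesis
    by (simp add: assms(2) has_field_derivative_def mult.commute[of _ "D v"])
qed

lemma holo_fun_line:
  assumes "holo_fun f S"
  shows "(\<lambda>\<zeta>. f (z + \<zeta> *s v)) holomorphic_on {\<zeta>. z + \<zeta> *s v \<in> S}"
  unfolding holomorphic_on_def
proof
  fix \<zeta> assume "\<zeta> \<in> {\<zeta>. z + \<zeta> *s v \<in> S}"
  then obtain D where "(f has_derivative D) (at (z + \<zeta> *s v))" "\<And>c w. D (c *s w) = c * D w"
    using assms by (auto simp: holo_fun_def)
  then show "(\<lambda>\<zeta>. f (z + \<zeta> *s v)) field_differentiable at \<zeta> within {\<zeta>. z + \<zeta> *s v \<in> S}"
    using holo_fun_line_deriv field_differentiable_def field_differentiable_at_within by blast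
qed

lemma holo_fun_continuous_on: "holo_fun f S \<Longrightarrow> continuous_on S f"
  by (meson continuous_at_imp_continuous_on has_derivative_continuous holo_fun_def)

lemma holo_fun_subset: "holo_fun f S \<Longrightarrow> T \<subseteq> S \<Longrightarrow> holo_fun f T"
  by (auto simp: holo_fun_def)

lemma holo_fun_cong:
  assumes "open S" "\<And>z. z \<in> S \<Longrightarrow> f z = g z"
  shows "holo_fun f S \<longleftrightarrow> holo_fun g S"
proof -
  have "(f has_derivative D) (at z) \<longleftrightarrow> (g has_derivative D) (at z)" if "z \<in> S" for z D
    by (rule iffI; erule has_derivative_transform_within_open[OF _ assms(1) that])
       (auto simp: assms(2))
  then show ?thesis by (simp add: holo_fun_def)
qed

lemma holo_fun_locally:
  assumes "\<And>z. z \<in> S \<Longrightarrow> \<exists>T. z \<in> T \<and> holo_fun f T"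
  shows "holo_fun f S"
  unfolding holo_fun_def
proof
  fix z assume "z \<in> S"
  then obtain T where "z \<in> T" "holo_fun f T" using assms by blast
  then show "\<exists>D. (f has_derivative D) (at z) \<and> (\<forall>c v. D (c *s v) = c * D v)"
    by (simp add: holo_fun_def)
qed

section \<open>Taylor estimates in one variable\<close>

lemma taylor_coeff_bound:
  assumes "g holomorphic_on cball 0 R" "0 < R" "\<And>\<zeta>. norm \<zeta> \<le> R \<Longrightarrow> norm (g \<zeta>) \<le> M"
  shows "norm ((deriv ^^ j) g 0 / fact j) \<le> M / R ^ j"
proof -
  have "norm ((deriv ^^ j) g 0) \<le> fact j * M / R ^ j"
    by (rule Cauchy_inequality)
       (use assms in \<open>auto intro: holomorphic_on_subset[OF assms(1)] holomorphic_on_imp_continuous_on\<close>)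
  then show ?thesis
    by (simp add: norm_divide field_simps)
qed

text \<open>By Cauchy's inequality the term of index \<open>j\<close> is at most
  \<open>M * q ^ j\<close>, so the tail is dominated by a geometric series.\<close>

lemma taylor_tail_geometric:
  assumes g: "g holomorphic_on cball 0 R" and R: "0 < R"
    and M: "\<And>\<zeta>. norm \<zeta> \<le> R \<Longrightarrow> norm (g \<zeta>) \<le> M" and z: "norm \<zeta> \<le> q * R" and q: "0 \<le> q" "q < 1"
  shows "norm (g \<zeta> - (\<Sum>j<k. (deriv ^^ j) g 0 / fact j * \<zeta> ^ j)) \<le> M * q ^ k / (1 - q)"
proof -
  define a where "a = (\<lambda>j. (deriv ^^ j) g 0 / fact j * \<zeta> ^ j)"
  have "norm (g 0) \<le> M" using M[of 0] R by simp
  then have M0: "0 \<le> M" using norm_ge_zero order_trans by blast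
  have a: "norm (a j) \<le> M * q ^ j" for j
  proof -
    have "norm (a j) \<le> M / R ^ j * (q * R) ^ j"
      unfolding a_def norm_mult norm_power
      by (rule mult_mono[OF taylor_coeff_bound[OF g R M] power_mono]) (use z M0 R in auto)
    then show ?thesis using R by (simp add: power_mult_distrib)
  qed
  have "q * R < R" using q R by simp
  then have "norm \<zeta> < R" using z by simp
  then have "a sums g \<zeta>"
    using holomorphic_power_series[of g 0 R \<zeta>] z R holomorphic_on_subset[OF g ball_subset_cball]
    by (auto simp: a_def)
  then have "(\<lambda>j. a (j + k)) sums (g \<zeta> - (\<Sum>j<k. a j))" by (rule sums_split_initial_segment)
  then have e: "g \<zeta> - (\<Sum>j<k. a j) = (\<Sum>j. a (j + k))" by (rule sums_unique)
  have s: "(\<lambda>j. M * q ^ (j + k)) sums (M * q ^ k * (1 / (1 - q)))"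
    using sums_mult[OF geometric_sums[of q], of "M * q ^ k"] q by (simp add: power_add mult_ac)
  have "norm (\<Sum>j. a (j + k)) \<le> (\<Sum>j. M * q ^ (j + k))"
    using s a by (intro norm_suminf_le) (auto simp: sums_iff)
  also have "\<dots> = M * q ^ k * (1 / (1 - q))" using s by (simp add: sums_iff)
  finally show ?thesis using e by (simp add: a_def mult_ac)
qed

text \<open>The case \<open>q = norm \<zeta> / R \<le> 1/2\<close>, where \<open>1 / (1 - q)\<close>
  is at most 2. In this form the bound displays the order \<open>k\<close> in
  \<open>\<zeta>\<close>.\<close>

lemma taylor_tail:
  assumes g: "g holomorphic_on cball 0 R" and R: "0 < R"
    and M: "\<And>\<zeta>. norm \<zeta> \<le> R \<Longrightarrow> norm (g \<zeta>) \<le> M" and z: "norm \<zeta> \<le> R / 2"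
  shows "norm (g \<zeta> - (\<Sum>j<k. (deriv ^^ j) g 0 / fact j * \<zeta> ^ j)) \<le> 2 * M * (norm \<zeta> / R) ^ k"
proof -
  define q where "q = norm \<zeta> / R"
  have "norm (g 0) \<le> M" using M[of 0] R by simp
  then have M0: "0 \<le> M" using norm_ge_zero order_trans by blast
  have q: "0 \<le> q" "q \<le> 1/2" "norm \<zeta> \<le> q * R" using z R by (auto simp: q_def field_simps)
  have "norm (g \<zeta> - (\<Sum>j<k. (deriv ^^ j) g 0 / fact j * \<zeta> ^ j)) \<le> M * q ^ k * (1 / (1 - q))"
    using taylor_tail_geometric[OF g R M, of \<zeta> q k] q by simp
  also have "\<dots> \<le> M * q ^ k * 2"
    using q M0 by (intro mult_left_mono) (auto simp: field_simps)
  finally show ?thesis by (simp add: q_def mult_ac)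
qed

text \<open>Additivity of the Gateaux derivative comes from comparing \<open>f (z + 2tv)\<close>, \<open>f (z + 2tw)\<close> and
  their midpoint \<open>f (z + t(v + w))\<close>, which costs only a second order error.\<close>

lemma holo_fun_Gateaux:
  fixes f :: "complex^'n::finite \<Rightarrow> complex"
  assumes S: "open S" and cont: "continuous_on S f"
    and hol: "\<And>z v. (\<lambda>\<zeta>. f (z + \<zeta> *s v)) holomorphic_on {\<zeta>. z + \<zeta> *s v \<in> S}"
  shows "holo_fun f S"
  unfolding holo_fun_def
proof
  fix z assume "z \<in> S"
  then obtain r where r: "0 < r" "cball z r \<subseteq> S" using S open_contains_cball by blast
  have "compact (f ` cball z r)"
    using compact_continuous_image[OF continuous_on_subset[OF cont r(2)] compact_cball] .
  then obtain M where M: "\<And>w. w \<in> cball z r \<Longrightarrow> norm (f w) \<le> M"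
    by (meson bounded_iff compact_imp_bounded imageI)
  have "norm (f z) \<le> M" using M[of z] r by simp
  then have M0: "0 \<le> M" using norm_ge_zero order_trans by blast
  define D where "D v = deriv (\<lambda>\<zeta>. f (z + \<zeta> *s v)) 0" for v
  have hol': "(\<lambda>\<zeta>. f (u + \<zeta> *s v)) holomorphic_on cball 0 R"
      and bd: "\<And>\<zeta>. norm \<zeta> \<le> R \<Longrightarrow> norm (f (u + \<zeta> *s v)) \<le> M"
    if "dist z u + R * norm v \<le> r" for u v R
  proof -
    have *: "u + \<zeta> *s v \<in> cball z r" if "norm \<zeta> \<le> R" for \<zeta>
    proof -
      have "dist z (u + \<zeta> *s v) \<le> dist z u + norm (\<zeta> *s v)"
        using dist_triangle[of z "u + \<zeta> *s v" u] by (simp add: dist_norm)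
      also have "norm (\<zeta> *s v) \<le> R * norm v"
        using that by (simp add: norm_smult mult_right_mono)
      finally show ?thesis using \<open>dist z u + R * norm v \<le> r\<close> by simp
    qed
    show "(\<lambda>\<zeta>. f (u + \<zeta> *s v)) holomorphic_on cball 0 R"
      by (rule holomorphic_on_subset[OF hol]) (use * r in auto)
    show "\<And>\<zeta>. norm \<zeta> \<le> R \<Longrightarrow> norm (f (u + \<zeta> *s v)) \<le> M" using * M by blast
  qed
  \<comment> \<open>Taylor's formula of second order on the line through \<open>z\<close> and
    \<open>z + v\<close>, evaluated at parameter 1. The disc of radius \<open>R = r / norm v\<close>
    is the largest one that this line keeps inside \<open>cball z r\<close>.\<close>
  have lin: "norm (f (z + v) - f z - D v) \<le> 2 * M / r\<^sup>2 * (norm v)\<^sup>2" if "norm v \<le> r / 2" for v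
  proof (cases "v = 0")
    case True
    then show ?thesis by (simp add: D_def)
  next
    case False
    define R where "R = r / norm v"
    have R: "0 < R" "1 \<le> R / 2" "R * norm v = r" using that False r by (auto simp: R_def field_simps)
    have dz: "dist z z + R * norm v \<le> r" using R by simp
    show ?thesis
      using taylor_tail[where g = "\<lambda>\<zeta>. f (z + \<zeta> *s v)" and k = 2 and \<zeta> = 1, OF hol'[OF dz] R(1) bd[OF dz]] R(2)
      by (simp add: numeral_2_eq_2 D_def[symmetric] diff_diff_eq) (simp add: R_def power2_eq_square)
  qed
  have D_smult: "D (c *s v) = c * D v" for c v
  proof -
    define g where "g = (\<lambda>\<zeta>. f (z + \<zeta> *s v))"
    have "g field_differentiable at (c * 0)"
    proof -
      have "open {\<zeta>. z + \<zeta> *s v \<in> S}"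
        using open_vimage[OF S, of "\<lambda>\<zeta>. z + \<zeta> *s v"] by (simp add: vimage_def continuous_intros)
      then show ?thesis using hol[of z v] \<open>z \<in> S\<close>
        by (simp add: g_def holomorphic_on_imp_differentiable_at)
    qed
    then have "(g has_field_derivative D v) (at (c * 0))"
      by (simp add: D_def g_def field_differentiable_derivI)
    then have "((\<lambda>\<zeta>. g (c * \<zeta>)) has_field_derivative D v * c) (at 0)"
      by (rule DERIV_chain2) (auto intro!: derivative_eq_intros)
    then show ?thesis
      by (simp add: D_def g_def DERIV_imp_deriv mult.commute)
  qed
  have six: "norm (a + b - c - d - e - h) \<le> 6 * k"
    if "norm a \<le> k" "norm b \<le> k" "norm c \<le> k" "norm d \<le> k" "norm e \<le> k" "norm h \<le> k"
    for a b c d e h :: complex and k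
    using that norm_triangle_ineq[of a b] norm_triangle_ineq4[of "a + b" c]
      norm_triangle_ineq4[of "a + b - c" d] norm_triangle_ineq4[of "a + b - c - d" e]
      norm_triangle_ineq4[of "a + b - c - d - e" h] by linarith
  have D_add: "D (v + w) = D v + D w" for v w
  proof -
    define B where "B = norm v + norm w + 1"
    define C where "C = 2 * M / r\<^sup>2 * (2 * B)\<^sup>2"
    have C0: "0 \<le> C" using M0 by (simp add: C_def)
    have B0: "0 < B" by (simp add: B_def add_nonneg_pos)
    have "norm (D (v + w) - D v - D w) \<le> e" if e: "e > 0" for e :: real
    proof -
      \<comment> \<open>The bound by \<open>r / (8 * B)\<close> keeps every point used below inside
        \<open>cball z r\<close>; the bound by \<open>e / (4 * C + 1)\<close> makes the second order
        error, divided by \<open>t\<close>, at most \<open>e\<close>.\<close>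
      define t where "t = min (r / (8 * B)) (e / (4 * C + 1))"
      have t: "0 < t" "t * B \<le> r / 8" "t * (4 * C) \<le> e"
      proof -
        show "0 < t" using B0 r e C0 by (auto simp: t_def)
        have "t * B \<le> (r / (8 * B)) * B" using B0 by (intro mult_right_mono) (auto simp: t_def)
        then show "t * B \<le> r / 8" using B0 by simp
        have "t * (4 * C) \<le> (e / (4 * C + 1)) * (4 * C + 1)"
          using C0 \<open>0 < t\<close> e by (intro mult_mono) (auto simp: t_def)
        then show "t * (4 * C) \<le> e" using C0 by simp
      qed
      define T :: complex where "T = of_real t"
      have nT: "norm T = t" using t by (simp add: T_def)
      have le: "norm (f (z + x) - f z - D x) \<le> C * t\<^sup>2" if "norm x \<le> 2 * t * B" for x
      proof -
        have "norm (f (z + x) - f z - D x) \<le> 2 * M / r\<^sup>2 * (norm x)\<^sup>2"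
          using lin[of x] that t r by simp
        also have "\<dots> \<le> 2 * M / r\<^sup>2 * (2 * t * B)\<^sup>2"
          using that M0 by (intro mult_left_mono power_mono) auto
        finally show ?thesis by (simp add: C_def power_mult_distrib mult_ac)
      qed
      have e1: "norm (f (z + (2*T) *s v) - f z - 2*T * D v) \<le> C * t\<^sup>2"
        using le[of "(2*T) *s v"] t B0
        by (simp add: D_smult norm_smult norm_mult nT B_def mult_left_mono)
      have e2: "norm (f (z + (2*T) *s w) - f z - 2*T * D w) \<le> C * t\<^sup>2"
        using le[of "(2*T) *s w"] t B0
        by (simp add: D_smult norm_smult norm_mult nT B_def mult_left_mono)
      have vw: "norm (v + w) \<le> B" "norm (v - w) \<le> B"
        using norm_triangle_ineq[of v w] norm_triangle_ineq4[of v w] by (auto simp: B_def)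
      have e3: "norm (f (z + T *s (v + w)) - f z - T * D (v + w)) \<le> C * t\<^sup>2"
      proof -
        have "norm (T *s (v + w)) = t * norm (v + w)" by (simp only: norm_smult nT)
        also have "\<dots> \<le> t * B" using vw(1) t(1) by (intro mult_left_mono) auto
        also have "\<dots> \<le> 2 * t * B" using t B0 by simp
        finally show ?thesis using le[of "T *s (v + w)"] unfolding D_smult by blast
      qed
      define u where "u = z + T *s (v + w)"
      define g where "g = (\<lambda>\<zeta>. f (u + \<zeta> *s (v - w)))"
      \<comment> \<open>The line through the midpoint \<open>u\<close> in direction
        \<open>v - w\<close> meets the two outer points at the parameters \<open>T\<close> and
        \<open>- T\<close>. Up to radius \<open>R\<close> it stays in \<open>cball z r\<close>,
        because \<open>t * B + R * B \<le> r\<close>.\<close>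
      define R where "R = r / (2 * B)"
      have R: "0 < R" "t \<le> R / 2" using r B0 t by (auto simp: R_def field_simps)
      have "dist z u = norm (T *s (v + w))" unfolding u_def by (metis dist_norm norm_minus_commute add_diff_cancel_left')
      also have "\<dots> = t * norm (v + w)" by (simp only: norm_smult nT)
      finally have "dist z u \<le> t * B" using vw(1) t(1) by (simp add: mult_left_mono)
      then have du: "dist z u + R * norm (v - w) \<le> r"
      proof -
        have "R * norm (v - w) \<le> R * B" using vw R by (intro mult_left_mono) auto
        also have "R * B = r / 2" using B0 by (simp add: R_def)
        finally show ?thesis using \<open>dist z u \<le> t * B\<close> t r by linarith
      qed
      have g2: "norm (g \<zeta> - g 0 - deriv g 0 * \<zeta>) \<le> C * t\<^sup>2" if "norm \<zeta> = t" for \<zeta>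
      proof -
        have "norm (g \<zeta> - g 0 - deriv g 0 * \<zeta>) \<le> 2 * M * (t / R)\<^sup>2"
          using taylor_tail[where g = g and k = 2 and \<zeta> = \<zeta> and M = M and R = R] that R
            hol'[OF du] bd[OF du]
          by (simp add: numeral_2_eq_2 g_def diff_diff_eq)
        also have "\<dots> = C * t\<^sup>2" by (simp add: R_def C_def field_simps power2_eq_square)
        finally show ?thesis .
      qed
      have gT: "g T = f (z + (2*T) *s v)" "g (-T) = f (z + (2*T) *s w)"
      proof -
        have "u + T *s (v - w) = z + (2*T) *s v" "u + (-T) *s (v - w) = z + (2*T) *s w"
          by (simp_all add: u_def vec_eq_iff algebra_simps)
        then show "g T = f (z + (2*T) *s v)" "g (-T) = f (z + (2*T) *s w)"
          by (simp_all add: g_def)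
      qed
      have g0: "g 0 = f (z + T *s (v + w))" by (simp add: g_def u_def)
      have e45: "norm (g T - g 0 - deriv g 0 * T) \<le> C * t\<^sup>2"
                "norm (g (-T) - g 0 - deriv g 0 * (-T)) \<le> C * t\<^sup>2"
        using g2[of T] g2[of "-T"] nT by (simp_all only: norm_minus_cancel)
      \<comment> \<open>All values of \<open>f\<close> cancel, and so do the two terms with
        \<open>deriv g 0\<close>, whose arguments are opposite.\<close>
      have "2 * T * (D (v + w) - D v - D w) =
          (f (z + (2*T) *s v) - f z - 2*T * D v) + (f (z + (2*T) *s w) - f z - 2*T * D w)
          - (f (z + T *s (v + w)) - f z - T * D (v + w)) - (f (z + T *s (v + w)) - f z - T * D (v + w))
          - (g T - g 0 - deriv g 0 * T) - (g (-T) - g 0 - deriv g 0 * (-T))"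
        unfolding gT g0 by (simp add: algebra_simps)
      also have "norm \<dots> \<le> 6 * (C * t\<^sup>2)" by (rule six) (fact e1 e2 e3 e45)+
      finally have "2 * t * norm (D (v + w) - D v - D w) \<le> 6 * C * t\<^sup>2"
        by (simp add: norm_mult nT)
      then have "t * norm (D (v + w) - D v - D w) \<le> t * (3 * C * t)"
        by (simp add: power2_eq_square mult_ac)
      then have "norm (D (v + w) - D v - D w) \<le> 3 * C * t"
        using t(1) by simp
      also have "\<dots> \<le> t * (4 * C)" using t C0 by simp
      finally show ?thesis using t by linarith
    qed
    then have "norm (D (v + w) - D v - D w) = 0"
      using field_le_epsilon[of "norm (D (v + w) - D v - D w)" 0] by auto
    then show ?thesis by (simp add: diff_diff_eq)
  qed
  have "linear D"
    by (rule linearI) (simp_all add: D_add D_smult flip: smult_of_real, simp add: scaleR_conv_of_real[where 'a = complex])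
  then have bl: "bounded_linear D" by (simp add: linear_conv_bounded_linear)
  have "((\<lambda>h. norm (f (z + h) - f z - D h) / norm h) \<longlongrightarrow> 0) (at 0)"
  proof (rule Lim_null_comparison)
    have "eventually (\<lambda>h::complex^'n. norm h < r / 2) (at 0)"
      using r by (auto simp: eventually_at intro!: exI[of _ "r/2"])
    then show "eventually (\<lambda>h. norm (norm (f (z + h) - f z - D h) / norm h) \<le> 2 * M / r\<^sup>2 * norm h) (at 0)"
    proof eventually_elim
      case (elim h)
      show ?case
      proof (cases "h = 0")
        case False
        then show ?thesis using lin[of h] elim r by (simp add: field_simps power2_eq_square)
      qed simp
    qed
    show "((\<lambda>h. 2 * M / r\<^sup>2 * norm h) \<longlongrightarrow> 0) (at (0::complex^'n))"
      by (intro tendsto_mult_right_zero tendsto_norm_zero tendsto_ident_at)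
  qed
  then have "(f has_derivative D) (at z)" by (simp add: has_derivative_at bl)
  then show "\<exists>D. (f has_derivative D) (at z) \<and> (\<forall>c v. D (c *s v) = c * D v)"
    using D_smult by blast
qed


section \<open>Closure properties of holomorphic functions and maps\<close>

text \<open>The working criterion: continuity and one-variable holomorphy on complex lines pass to
  sums, products, exponentials and uniform limits without computing a derivative.\<close>

lemma holo_fun_iff:
  fixes f :: "complex^'n::finite \<Rightarrow> complex"
  assumes "open S"
  shows "holo_fun f S \<longleftrightarrow> continuous_on S f \<and>
    (\<forall>z v. (\<lambda>\<zeta>. f (z + \<zeta> *s v)) holomorphic_on {\<zeta>. z + \<zeta> *s v \<in> S})"
  using holo_fun_Gateaux[OF assms, of f] holo_fun_line[of f S] holo_fun_continuous_on[of f S] by auto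

lemma holo_fun_const: "holo_fun (\<lambda>z. c) S"
  unfolding holo_fun_def by (auto intro!: exI[of _ "\<lambda>_. 0"])

lemma holo_fun_nth: "holo_fun (\<lambda>z::complex^'n::finite. z $ i) S"
  unfolding holo_fun_def
  by (auto intro!: exI[of _ "\<lambda>v. v $ i"] bounded_linear_imp_has_derivative bounded_linear_vec_nth)

context
  fixes S :: "(complex^'n::finite) set"
  assumes S: "open S"
begin

lemma holo_fun_add: "holo_fun f S \<Longrightarrow> holo_fun g S \<Longrightarrow> holo_fun (\<lambda>z. f z + g z) S"
  by (simp add: holo_fun_iff[OF S] continuous_on_add holomorphic_on_add)

lemma holo_fun_diff: "holo_fun f S \<Longrightarrow> holo_fun g S \<Longrightarrow> holo_fun (\<lambda>z. f z - g z) S"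
  by (simp add: holo_fun_iff[OF S] continuous_on_diff holomorphic_on_diff)

lemma holo_fun_mult: "holo_fun f S \<Longrightarrow> holo_fun g S \<Longrightarrow> holo_fun (\<lambda>z. f z * g z) S"
  by (simp add: holo_fun_iff[OF S] continuous_on_mult holomorphic_on_mult)

lemma holo_fun_cmult: "holo_fun f S \<Longrightarrow> holo_fun (\<lambda>z. c * f z) S"
  by (intro holo_fun_mult holo_fun_const)

lemma holo_fun_sum: "(\<And>i. i \<in> I \<Longrightarrow> holo_fun (f i) S) \<Longrightarrow> holo_fun (\<lambda>z. \<Sum>i\<in>I. f i z) S"
  by (simp add: holo_fun_iff[OF S] continuous_on_sum holomorphic_on_sum)

lemma holo_fun_power: "holo_fun f S \<Longrightarrow> holo_fun (\<lambda>z. f z ^ k) S"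
  by (simp add: holo_fun_iff[OF S] continuous_on_power holomorphic_on_power)

lemma holo_fun_exp: "holo_fun f S \<Longrightarrow> holo_fun (\<lambda>z. exp (f z)) S"
  by (simp add: holo_fun_iff[OF S] continuous_on_exp holomorphic_on_exp')

text \<open>Weierstrass' theorem, obtained line by line from its one-variable version. The
  formulation with one approximant for each \<open>e\<close>, instead of a sequence, is the one that
  the lemmas on Taylor families below ask of a class of functions.\<close>

lemma holo_fun_uniform_approx:
  assumes "\<And>e. 0 < e \<Longrightarrow> \<exists>g. holo_fun g S \<and> (\<forall>z\<in>S. norm (g z - f z) \<le> e)"
  shows "holo_fun f S"
proof -
  have "\<forall>n. \<exists>g. holo_fun g S \<and> (\<forall>z\<in>S. norm (g z - f z) \<le> inverse (real (Suc n)))"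
    using assms by simp
  then obtain g where g: "\<And>n. holo_fun (g n) S"
    and lim: "\<And>n z. z \<in> S \<Longrightarrow> norm (g n z - f z) \<le> inverse (real (Suc n))" by metis
  have ul: "uniform_limit S g f sequentially"
  proof (rule uniform_limitI)
    fix e :: real assume "0 < e"
    then obtain N where N: "inverse (real (Suc N)) < e" using reals_Archimedean by blast
    show "\<forall>\<^sub>F n in sequentially. \<forall>x\<in>S. dist (g n x) (f x) < e"
      unfolding eventually_sequentially
    proof (intro exI allI impI ballI)
      fix n x assume "N \<le> n" "x \<in> S"
      then have "norm (g n x - f x) \<le> inverse (real (Suc N))"
        using lim[OF \<open>x \<in> S\<close>, of n] le_imp_inverse_le[of "real (Suc N)" "real (Suc n)"] by linarith
      then show "dist (g n x) (f x) < e" using N by (simp add: dist_norm)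
    qed
  qed
  have "continuous_on S f"
    by (rule uniform_limit_theorem[OF _ ul])
       (use g holo_fun_continuous_on in \<open>auto intro!: always_eventually\<close>)
  moreover have "(\<lambda>\<zeta>. f (z + \<zeta> *s v)) holomorphic_on {\<zeta>. z + \<zeta> *s v \<in> S}" (is "_ holomorphic_on ?T") for z v
  proof (rule holomorphic_uniform_sequence[where f = "\<lambda>n \<zeta>. g n (z + \<zeta> *s v)"])
    show op: "open ?T"
      using open_vimage[OF S, of "\<lambda>\<zeta>. z + \<zeta> *s v"] by (simp add: vimage_def continuous_intros)
    show "(\<lambda>\<zeta>. g n (z + \<zeta> *s v)) holomorphic_on ?T" for n by (rule holo_fun_line[OF g])
    fix x assume "x \<in> ?T"
    then obtain d where d: "0 < d" "cball x d \<subseteq> ?T" using op open_contains_cball by blast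
    have "uniform_limit (cball x d) (\<lambda>n \<zeta>. g n (z + \<zeta> *s v)) (\<lambda>\<zeta>. f (z + \<zeta> *s v)) sequentially"
    proof (rule uniform_limitI)
      fix e :: real assume "0 < e"
      from uniform_limitD[OF ul this]
      show "\<forall>\<^sub>F n in sequentially. \<forall>\<zeta>\<in>cball x d. dist (g n (z + \<zeta> *s v)) (f (z + \<zeta> *s v)) < e"
        by eventually_elim (use d in auto)
    qed
    then show "\<exists>d>0. cball x d \<subseteq> ?T \<and>
        uniform_limit (cball x d) (\<lambda>n \<zeta>. g n (z + \<zeta> *s v)) (\<lambda>\<zeta>. f (z + \<zeta> *s v)) sequentially"
      using d by blast
  qed
  ultimately show ?thesis by (simp add: holo_fun_iff[OF S])
qed

end

lemma has_derivative_vec: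
  fixes F :: "'a::real_normed_vector \<Rightarrow> 'b::euclidean_space^'m::finite"
  assumes "\<And>i. ((\<lambda>z. F z $ i) has_derivative (\<lambda>v. D v $ i)) (at z)"
  shows "(F has_derivative D) (at z)"
  unfolding has_derivative_componentwise_within[of F]
  by (auto simp: Basis_vec_def inner_axis intro: bounded_linear.has_derivative[OF bounded_linear_inner_left assms])

text \<open>Closure properties are checked on components, while the chain rule and inverse maps need
  a single total derivative; this converts between the two.\<close>

lemma holo_map_iff:
  fixes F :: "complex^'n::finite \<Rightarrow> complex^'m::finite"
  shows "holo_map F S \<longleftrightarrow>
    (\<forall>z\<in>S. \<exists>D. (F has_derivative D) (at z) \<and> (\<forall>c v. D (c *s v) = c *s D v))"
proof
  assume F: "holo_map F S"
  show "\<forall>z\<in>S. \<exists>D. (F has_derivative D) (at z) \<and> (\<forall>c v. D (c *s v) = c *s D v)"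
  proof
    fix z assume "z \<in> S"
    then have "\<forall>i. \<exists>D. ((\<lambda>z. F z $ i) has_derivative D) (at z) \<and> (\<forall>c v. D (c *s v) = c * D v)"
      using F by (simp add: holo_map_def holo_fun_def)
    then obtain D where D: "\<And>i. ((\<lambda>z. F z $ i) has_derivative D i) (at z)"
      and lin: "\<And>i c v. D i (c *s v) = c * D i v" by metis
    have "(F has_derivative (\<lambda>v. \<chi> i. D i v)) (at z)"
      by (rule has_derivative_vec) (simp add: D)
    moreover have "(\<chi> i. D i (c *s v)) = c *s (\<chi> i. D i v)" for c v
      by (simp add: vec_eq_iff lin)
    ultimately show "\<exists>D. (F has_derivative D) (at z) \<and> (\<forall>c v. D (c *s v) = c *s D v)" by blast
  qed
next
  assume F: "\<forall>z\<in>S. \<exists>D. (F has_derivative D) (at z) \<and> (\<forall>c v. D (c *s v) = c *s D v)"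
  show "holo_map F S"
    unfolding holo_map_def holo_fun_def
  proof (intro allI ballI)
    fix i z assume "z \<in> S"
    then obtain D where D: "(F has_derivative D) (at z)" "\<And>c v. D (c *s v) = c *s D v"
      using F by blast
    from bounded_linear.has_derivative[OF bounded_linear_vec_nth D(1)]
    show "\<exists>D. ((\<lambda>z. F z $ i) has_derivative D) (at z) \<and> (\<forall>c v. D (c *s v) = c * D v)"
      by (intro exI[of _ "\<lambda>v. D v $ i"]) (simp add: D(2))
  qed
qed

lemma holo_fun_compose:
  fixes F :: "complex^'n::finite \<Rightarrow> complex^'m::finite"
  assumes "holo_map F S" "holo_fun g T" "\<And>z. z \<in> S \<Longrightarrow> F z \<in> T"
  shows "holo_fun (\<lambda>z. g (F z)) S"
  unfolding holo_fun_def
proof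
  fix z assume z: "z \<in> S"
  obtain D where D: "(F has_derivative D) (at z)" "\<And>c v. D (c *s v) = c *s D v"
    using assms(1) z unfolding holo_map_iff by blast
  obtain E where E: "(g has_derivative E) (at (F z))" "\<And>c v. E (c *s v) = c * E v"
    using assms(2,3) z unfolding holo_fun_def by blast
  show "\<exists>D. ((\<lambda>z. g (F z)) has_derivative D) (at z) \<and> (\<forall>c v. D (c *s v) = c * D v)"
    using has_derivative_compose[OF D(1) E(1)] D(2) E(2) by (intro exI[of _ "\<lambda>v. E (D v)"]) simp
qed

lemma holo_map_compose:
  fixes F :: "complex^'n::finite \<Rightarrow> complex^'m::finite" and G :: "complex^'m \<Rightarrow> complex^'k::finite"
  assumes "holo_map F S" "holo_map G T" "\<And>z. z \<in> S \<Longrightarrow> F z \<in> T"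
  shows "holo_map (\<lambda>z. G (F z)) S"
  unfolding holo_map_def
proof
  fix i
  show "holo_fun (\<lambda>z. G (F z) $ i) S"
    by (rule holo_fun_compose[where g = "\<lambda>w. G w $ i", OF assms(1) _ assms(3)])
       (use assms(2) in \<open>auto simp: holo_map_def\<close>)
qed

lemma holo_map_continuous_on:
  fixes F :: "complex^'n::finite \<Rightarrow> complex^'m::finite"
  assumes "holo_map F S"
  shows "continuous_on S F"
  using assms unfolding holo_map_iff
  by (meson continuous_at_imp_continuous_on has_derivative_continuous)

lemma holo_map_subset: "holo_map F S \<Longrightarrow> T \<subseteq> S \<Longrightarrow> holo_map F T"
  by (auto simp: holo_map_def intro: holo_fun_subset)

lemma holo_map_cong:
  assumes "open S" "\<And>z. z \<in> S \<Longrightarrow> F z = G z"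
  shows "holo_map F S \<longleftrightarrow> holo_map G S"
  unfolding holo_map_def using assms holo_fun_cong[of S "\<lambda>z. F z $ _" "\<lambda>z. G z $ _"] by metis

lemma holo_map_id: "holo_map (\<lambda>z::complex^'n::finite. z) S"
  by (simp add: holo_map_def holo_fun_nth)

text \<open>Functions of \<open>y\<close> that depend holomorphically on a parameter \<open>\<zeta>\<close> stay in a closed linear class
  as soon as they lie in it for small positive \<open>\<zeta>\<close>: the Taylor coefficients in \<open>\<zeta>\<close> are uniform limits
  of difference quotients.\<close>

lemma
  fixes P :: "('y \<Rightarrow> complex) \<Rightarrow> bool" and h :: "'y \<Rightarrow> complex \<Rightarrow> complex"
  assumes add: "\<And>f g. P f \<Longrightarrow> P g \<Longrightarrow> P (\<lambda>y. f y + g y)"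
    and cmult: "\<And>c f. P f \<Longrightarrow> P (\<lambda>y. c * f y)"
    and lim: "\<And>f. (\<And>e. 0 < e \<Longrightarrow> \<exists>g. P g \<and> (\<forall>y\<in>K. norm (g y - f y) \<le> e)) \<Longrightarrow> P f"
    and R: "0 < R" and hol: "\<And>y. y \<in> K \<Longrightarrow> h y holomorphic_on cball 0 R"
    and bd: "\<And>y \<zeta>. y \<in> K \<Longrightarrow> norm \<zeta> \<le> R \<Longrightarrow> norm (h y \<zeta>) \<le> M"
    and e0: "0 < e0" and P: "\<And>e. 0 < e \<Longrightarrow> e < e0 \<Longrightarrow> P (\<lambda>y. h y (of_real e))"
  shows taylor_family_coeff: "P (\<lambda>y. (deriv ^^ k) (h y) 0 / fact k)"
    and taylor_family_value: "norm \<tau> < R \<Longrightarrow> P (\<lambda>y. h y \<tau>)"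
proof -
  define a where "a = (\<lambda>k y. (deriv ^^ k) (h y) 0 / fact k)"
  have zero: "P (\<lambda>y. 0)" using cmult[OF P[of "e0 / 2"], of 0] e0 by simp
  have sum: "P (\<lambda>y. \<Sum>j<n. a j y * c j)" if "\<And>j. j < n \<Longrightarrow> P (a j)" for n c
    using that
  proof (induction n)
    case (Suc n)
    have "P (\<lambda>y. (\<Sum>j<n. a j y * c j) + c n * a n y)" by (intro add cmult Suc) auto
    then show ?case by (simp add: mult.commute)
  qed (simp add: zero)
  have coeff: "P (a k)" for k
  proof (induction k rule: less_induct)
    case (less k)
    show ?case
    proof (rule lim)
      fix e :: real assume e: "0 < e"
      \<comment> \<open>\<open>K\<close> may be empty, and then \<open>M\<close> may be negative;
        \<open>M'\<close> is a positive substitute by which one can divide.\<close>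
      define M' where "M' = 2 * \<bar>M\<bar> + 1"
      \<comment> \<open>Three demands: \<open>P\<close> must be known at parameter \<open>x\<close>,
        \<open>taylor_tail\<close> must apply, and the Taylor remainder divided by
        \<open>x ^ k\<close>, which is \<open>x * M' / R ^ Suc k\<close>, must be at most
        \<open>e\<close>.\<close>
      define x where "x = min (e0 / 2) (min (R / 2) (e * R ^ Suc k / M'))"
      have xle: "x \<le> e0 / 2" "x \<le> R / 2" "x \<le> e * R ^ Suc k / M'" unfolding x_def by linarith+
      have x: "0 < x" "x < e0" "x \<le> R / 2" "x * M' \<le> e * R ^ Suc k"
      proof -
        have M': "0 < M'" by (simp add: M'_def)
        show "0 < x" using e0 R e M' by (auto simp: x_def)
        show "x < e0" "x \<le> R / 2" using e0 xle by linarith+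
        have "x * M' \<le> e * R ^ Suc k / M' * M'" using M' xle by (intro mult_right_mono) auto
        then show "x * M' \<le> e * R ^ Suc k" using M' by simp
      qed
      define g where "g = (\<lambda>y. inverse (of_real x ^ k) * (h y (of_real x) + (-1) * (\<Sum>j<k. a j y * of_real x ^ j)))"
      have "P g" unfolding g_def by (intro cmult add P sum less x)
      moreover have "norm (g y - a k y) \<le> e" if y: "y \<in> K" for y
      proof -
        have "norm (h y (of_real x) - (\<Sum>j<Suc k. a j y * of_real x ^ j)) \<le> 2 * M * (x / R) ^ Suc k"
          using taylor_tail[OF hol[OF y] R bd[OF y], of "of_real x" "Suc k"] x by (simp add: a_def)
        also have "\<dots> \<le> M' * (x / R) ^ Suc k"
          using x R by (intro mult_right_mono) (auto simp: M'_def)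
        finally have *: "norm (h y (of_real x) - (\<Sum>j<Suc k. a j y * of_real x ^ j)) \<le> M' * (x / R) ^ Suc k" .
        have "g y - a k y = inverse (of_real x ^ k) * (h y (of_real x) - (\<Sum>j<Suc k. a j y * of_real x ^ j))"
          using x by (simp add: g_def field_simps)
        then have "norm (g y - a k y) \<le> inverse (x ^ k) * (M' * (x / R) ^ Suc k)"
          using mult_left_mono[OF *, of "inverse (x ^ k)"] x by (simp add: norm_mult norm_inverse norm_power)
        also have "\<dots> = x * M' / R ^ Suc k" using x R by (simp add: field_simps power_divide)
        also have "\<dots> \<le> e" using x R by (simp add: pos_divide_le_eq)
        finally show ?thesis .
      qed
      ultimately show "\<exists>g. P g \<and> (\<forall>y\<in>K. norm (g y - a k y) \<le> e)" by blast
    qed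
  qed
  then show "P (\<lambda>y. (deriv ^^ k) (h y) 0 / fact k)" by (simp add: a_def)
  show "P (\<lambda>y. h y \<tau>)" if \<tau>: "norm \<tau> < R"
  proof (rule lim)
    fix e :: real assume e: "0 < e"
    define q where "q = norm \<tau> / R"
    have q: "0 \<le> q" "q < 1" "norm \<tau> \<le> q * R" using \<tau> R by (auto simp: q_def)
    have "(\<lambda>k. M * q ^ k / (1 - q)) \<longlonglongrightarrow> M * 0 / (1 - q)"
      using q by (intro tendsto_intros LIMSEQ_realpow_zero) auto
    then have "eventually (\<lambda>k. M * q ^ k / (1 - q) < e) sequentially"
      using e by (intro order_tendstoD) auto
    then obtain k where k: "M * q ^ k / (1 - q) < e" by (auto simp: eventually_sequentially)
    show "\<exists>g. P g \<and> (\<forall>y\<in>K. norm (g y - h y \<tau>) \<le> e)"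
    proof (intro exI conjI ballI)
      show "P (\<lambda>y. \<Sum>j<k. a j y * \<tau> ^ j)" by (rule sum) (rule coeff)
      fix y assume y: "y \<in> K"
      show "norm ((\<Sum>j<k. a j y * \<tau> ^ j) - h y \<tau>) \<le> e"
        using taylor_tail_geometric[OF hol[OF y] R bd[OF y], of \<tau> q k] q k
        by (simp add: a_def norm_minus_commute)
    qed
  qed
qed


section \<open>Directional derivatives, Cauchy and Lipschitz estimates\<close>

text \<open>Taken along a complex line, the derivative is a first Taylor coefficient in
  \<open>\<zeta>\<close>. The lemma on Taylor families therefore shows that it is holomorphic in
  \<open>z\<close>, with no appeal to second derivatives.\<close>

definition dirder :: "(complex^'n \<Rightarrow> complex) \<Rightarrow> complex^'n \<Rightarrow> complex^'n \<Rightarrow> complex" where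
  "dirder f v z = deriv (\<lambda>\<zeta>. f (z + \<zeta> *s v)) 0"

lemma dirder_eq:
  assumes "(f has_derivative D) (at z)" "\<And>c w. D (c *s w) = c * D w"
  shows "dirder f v z = D v"
  using holo_fun_line_deriv[of f D z 0 v] assms by (simp add: dirder_def DERIV_imp_deriv)

lemma holo_fun_line_dirder:
  fixes f :: "complex^'n::finite \<Rightarrow> complex"
  assumes "holo_fun f S" "z + \<zeta> *s v \<in> S"
  shows "((\<lambda>\<zeta>. f (z + \<zeta> *s v)) has_field_derivative dirder f v (z + \<zeta> *s v)) (at \<zeta>)"
proof -
  obtain D where "(f has_derivative D) (at (z + \<zeta> *s v))" "\<And>c v. D (c *s v) = c * D v"
    using assms by (auto simp: holo_fun_def)
  from holo_fun_line_deriv[OF this] dirder_eq[OF this] show ?thesis by simp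
qed

lemma has_derivative_dirder:
  fixes f :: "complex^'n::finite \<Rightarrow> complex"
  assumes "holo_fun f S" "z \<in> S"
  shows "(f has_derivative (\<lambda>v. dirder f v z)) (at z)"
proof -
  obtain D where D: "(f has_derivative D) (at z)" "\<And>c v. D (c *s v) = c * D v"
    using assms by (auto simp: holo_fun_def)
  then show ?thesis using dirder_eq[OF D] by simp
qed

lemma dirder_axis:
  fixes f :: "complex^'n::finite \<Rightarrow> complex"
  assumes "holo_fun f S" "z \<in> S"
  shows "dirder f v z = (\<Sum>j\<in>UNIV. v $ j * dirder f (axis j 1) z)"
proof -
  obtain D where D: "(f has_derivative D) (at z)" "\<And>c v. D (c *s v) = c * D v"
    using assms by (auto simp: holo_fun_def)
  have "D v = D (\<Sum>j\<in>UNIV. v $ j *s axis j 1)" by (simp add: basis_expansion)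
  also have "\<dots> = (\<Sum>j\<in>UNIV. v $ j * D (axis j 1))"
    using has_derivative_linear[OF D(1)] by (simp add: linear_sum D(2))
  finally show ?thesis by (simp add: dirder_eq[OF D])
qed

lemma compact_bound:
  fixes f :: "'a::topological_space \<Rightarrow> 'b::real_normed_vector"
  assumes "continuous_on S f" "compact K" "K \<subseteq> S"
  obtains M where "0 < M" "\<And>z. z \<in> K \<Longrightarrow> norm (f z) \<le> M"
  using compact_imp_bounded[OF compact_continuous_image[OF continuous_on_subset[OF assms(1,3)] assms(2)]]
  by (auto simp: bounded_pos)

lemma holo_map_translate: "holo_map (\<lambda>z::complex^'n::finite. z + v) S"
  unfolding holo_map_iff
  by (intro ballI exI[of _ "\<lambda>v. v"]) (auto intro!: derivative_eq_intros)

lemma holo_map_smult: "holo_map (\<lambda>z::complex^'n::finite. c *s z) S"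
  unfolding holo_map_iff
  by (intro ballI exI[of _ "\<lambda>v. c *s v"])
     (auto intro!: has_derivative_smult_right simp: vec_eq_iff)

lemma dist_add_smult_le:
  fixes v :: "complex^'n::finite"
  shows "dist w (z + \<zeta> *s v) \<le> dist w z + norm \<zeta> * norm v"
  using dist_triangle[of w "z + \<zeta> *s v" z] by (simp add: dist_norm norm_smult)

lemma holo_fun_dirder:
  fixes f :: "complex^'n::finite \<Rightarrow> complex"
  assumes S: "open S" and f: "holo_fun f S"
  shows "holo_fun (dirder f v) S"
proof (rule holo_fun_locally)
  fix z0 assume "z0 \<in> S"
  then obtain r where r: "0 < r" "cball z0 r \<subseteq> S" using S open_contains_cball by blast
  obtain M where M: "0 < M" "\<And>z. z \<in> cball z0 r \<Longrightarrow> norm (f z) \<le> M"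
    using compact_bound[OF holo_fun_continuous_on[OF f] compact_cball r(2)] by blast
  define K where "K = ball z0 (r / 2)"
  define R where "R = r / (2 * (norm v + 1))"
  have nv: "0 < norm v + 1" by (simp add: add_nonneg_pos)
  have R: "0 < R" "R * norm v \<le> r / 2"
    using r nv by (simp_all add: R_def field_simps)
  have in_ball: "z + \<zeta> *s v \<in> cball z0 r" if "z \<in> K" "norm \<zeta> \<le> R" for z \<zeta>
  proof -
    have "norm \<zeta> * norm v \<le> R * norm v" using that by (simp add: mult_right_mono)
    then show ?thesis using that R dist_add_smult_le[of z0 z \<zeta> v] by (simp add: K_def)
  qed
  have "holo_fun (\<lambda>z. (deriv ^^ 1) (\<lambda>\<zeta>. f (z + \<zeta> *s v)) 0 / fact 1) K"
  proof (rule taylor_family_coeff[where P = "\<lambda>g. holo_fun g K" and K = K and R = R and M = M and ?e0.0 = R])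
    fix z assume z: "z \<in> K"
    show "(\<lambda>\<zeta>. f (z + \<zeta> *s v)) holomorphic_on cball 0 R"
      by (rule holomorphic_on_subset[OF holo_fun_line[OF f]]) (use in_ball[OF z] r in auto)
    show "norm (f (z + \<zeta> *s v)) \<le> M" if "norm \<zeta> \<le> R" for \<zeta>
      using M in_ball[OF z that] by blast
  next
    fix e :: real assume e: "0 < e" "e < R"
    show "holo_fun (\<lambda>z. f (z + of_real e *s v)) K"
      by (rule holo_fun_compose[OF holo_map_translate f])
         (use in_ball[of _ "of_real e"] r e in auto)
  qed (use R in \<open>auto intro: holo_fun_add holo_fun_cmult holo_fun_uniform_approx simp: K_def\<close>)
  then have "holo_fun (dirder f v) K" by (simp add: dirder_def[abs_def])
  then show "\<exists>T. z0 \<in> T \<and> holo_fun (dirder f v) T"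
    using r by (intro exI[of _ K]) (simp add: K_def)
qed

lemma cauchy_dirder:
  fixes f :: "complex^'n::finite \<Rightarrow> complex"
  assumes f: "holo_fun f S" and s: "0 < s" "cball z s \<subseteq> S"
    and M: "\<And>w. w \<in> cball z s \<Longrightarrow> norm (f w) \<le> M"
  shows "norm (dirder f v z) \<le> M / s * norm v"
proof (cases "v = 0")
  case True
  then show ?thesis by (simp add: dirder_def)
next
  case False
  define R where "R = s / norm v"
  have R: "0 < R" "R * norm v = s" using False s by (auto simp: R_def)
  have in_ball: "z + \<zeta> *s v \<in> cball z s" if "norm \<zeta> \<le> R" for \<zeta>
    using mult_right_mono[OF that, of "norm v"] R dist_add_smult_le[of z z \<zeta> v] by simp
  have "(\<lambda>\<zeta>. f (z + \<zeta> *s v)) holomorphic_on cball 0 R"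
    by (rule holomorphic_on_subset[OF holo_fun_line[OF f]]) (use in_ball s in auto)
  from taylor_coeff_bound[OF this R(1), of M 1] M in_ball
  show ?thesis by (simp add: dirder_def R_def)
qed

text \<open>The mean value inequality on the convex set \<open>K\<close>, with Cauchy's bound
  \<open>M / s\<close> for the derivative.\<close>

lemma lipschitz_holo_fun:
  fixes f :: "complex^'n::finite \<Rightarrow> complex"
  assumes f: "holo_fun f S" and s: "0 < s" and K: "convex K" "\<And>z. z \<in> K \<Longrightarrow> cball z s \<subseteq> S"
    and M: "\<And>z w. z \<in> K \<Longrightarrow> w \<in> cball z s \<Longrightarrow> norm (f w) \<le> M" and xy: "x \<in> K" "y \<in> K"
  shows "norm (f x - f y) \<le> M / s * norm (x - y)"
proof (rule differentiable_bound[OF K(1) _ _ xy])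
  fix z assume z: "z \<in> K"
  then have zS: "z \<in> S" using K(2) s by force
  show "(f has_derivative (\<lambda>v. dirder f v z)) (at z within K)"
    by (rule has_derivative_at_withinI[OF has_derivative_dirder[OF f zS]])
  show "onorm (\<lambda>v. dirder f v z) \<le> M / s"
  proof (rule onorm_bound)
    have "norm (f z) \<le> M" using M[OF z, of z] s by simp
    then have "0 \<le> M" using norm_ge_zero order_trans by blast
    then show "0 \<le> M / s" using s by simp
    show "norm (dirder f v z) \<le> M / s * norm v" for v
      by (rule cauchy_dirder[OF f s K(2)[OF z] M[OF z]])
  qed
qed

lemma norm_vec_le_sum: "norm (x :: complex^'n::finite) \<le> (\<Sum>i\<in>UNIV. norm (x $ i))"
  by (simp add: norm_vec_def L2_set_le_sum)

text \<open>The factor \<open>CARD('m)\<close> comes from bounding the norm by the sum of the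
  components. Later constants are chosen to compensate for it.\<close>

lemma lipschitz_holo_map:
  fixes F :: "complex^'n::finite \<Rightarrow> complex^'m::finite"
  assumes F: "holo_map F S" and s: "0 < s" and K: "convex K" "\<And>z. z \<in> K \<Longrightarrow> cball z s \<subseteq> S"
    and M: "\<And>z w. z \<in> K \<Longrightarrow> w \<in> cball z s \<Longrightarrow> norm (F w) \<le> M" and xy: "x \<in> K" "y \<in> K"
  shows "norm (F x - F y) \<le> of_nat CARD('m) * (M / s) * norm (x - y)"
proof -
  have "norm (F x - F y) \<le> (\<Sum>i\<in>UNIV. norm (F x $ i - F y $ i))"
    using norm_vec_le_sum[of "F x - F y"] by simp
  also have "\<dots> \<le> (\<Sum>i\<in>(UNIV::'m set). M / s * norm (x - y))"
  proof (rule sum_mono)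
    fix i :: 'm
    show "norm (F x $ i - F y $ i) \<le> M / s * norm (x - y)"
      by (rule lipschitz_holo_fun[where f = "\<lambda>z. F z $ i" and S = S, OF _ s K _ xy])
         (use F M in \<open>auto simp: holo_map_def intro: order_trans[OF Finite_Cartesian_Product.norm_nth_le]\<close>)
  qed
  finally show ?thesis by simp
qed

lemma locally_lipschitz_holo_map:
  fixes F :: "complex^'n::finite \<Rightarrow> complex^'m::finite"
  assumes F: "holo_map F (ball 0 r)" and r: "0 < r"
  obtains C where "0 < C" "\<And>x y. x \<in> ball 0 (r / 4) \<Longrightarrow> y \<in> ball 0 (r / 4) \<Longrightarrow> norm (F x - F y) \<le> C * norm (x - y)"
proof -
  have sub: "cball 0 (r / 2) \<subseteq> ball (0::complex^'n) r" using r by auto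
  obtain M where M: "0 < M" "\<And>z. z \<in> cball 0 (r / 2) \<Longrightarrow> norm (F z) \<le> M"
    using compact_bound[OF holo_map_continuous_on[OF F] compact_cball sub] by blast
  have in_ball: "w \<in> cball 0 (r / 2)" if "z \<in> ball 0 (r / 4)" "w \<in> cball z (r / 4)" for z w :: "complex^'n"
    using that dist_triangle[of 0 w z] by auto
  show ?thesis
  proof
    show "0 < of_nat CARD('m) * (M / (r / 4))" using M r by simp
    show "norm (F x - F y) \<le> of_nat CARD('m) * (M / (r / 4)) * norm (x - y)"
      if "x \<in> ball 0 (r / 4)" "y \<in> ball 0 (r / 4)" for x y
    proof (rule lipschitz_holo_map[where s = "r/4", OF F _ convex_ball _ _ that])
      show "cball z (r / 4) \<subseteq> ball 0 r" if "z \<in> ball 0 (r / 4)" for z :: "complex^'n"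
        using in_ball[OF that] sub by blast
      show "norm (F w) \<le> M" if "z \<in> ball 0 (r / 4)" "w \<in> cball z (r / 4)" for z w
        using in_ball[OF that] M(2) by blast
    qed (use r in simp)
  qed
qed

section \<open>Homogeneous expansion at the origin\<close>

text \<open>The part of degree \<open>k\<close> in the Taylor expansion at the origin, read off
  along complex lines, so that neither multi-indices nor mixed partial derivatives occur.\<close>

definition hpart :: "(complex^'n \<Rightarrow> complex) \<Rightarrow> nat \<Rightarrow> complex^'n \<Rightarrow> complex" where
  "hpart f k z = (deriv ^^ k) (\<lambda>\<zeta>. f (\<zeta> *s z)) 0 / fact k"

context
  fixes f :: "complex^'n::finite \<Rightarrow> complex" and r :: real
  assumes f: "holo_fun f (ball 0 r)" and r: "0 < r"
begin

lemma holo_radial: "(\<lambda>\<zeta>. f (\<zeta> *s z)) holomorphic_on {\<zeta>. \<zeta> *s z \<in> ball 0 r}"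
  using holo_fun_line[OF f, of 0 z] by simp

lemma hpart_smult: "hpart f k (c *s z) = c ^ k * hpart f k z"
proof -
  have op: "open {\<zeta>. \<zeta> *s z \<in> ball 0 r}" for z :: "complex^'n"
    using open_vimage[OF open_ball, of "\<lambda>\<zeta>. \<zeta> *s z" 0 r] by (simp add: vimage_def continuous_intros)
  have "(deriv ^^ k) (\<lambda>\<zeta>. f ((c * \<zeta>) *s z)) 0 = c ^ k * (deriv ^^ k) (\<lambda>\<zeta>. f (\<zeta> *s z)) (c * 0)"
    by (rule higher_deriv_compose_linear[OF holo_radial op[of "c *s z"] op])
       (use r in \<open>auto simp: mult.commute\<close>)
  then show ?thesis by (simp add: hpart_def mult.commute)
qed

lemma hpart_tail:
  obtains C where "0 < C" "\<And>z. norm z \<le> r / 4 \<Longrightarrow> norm (f z - (\<Sum>j<k. hpart f j z)) \<le> C * norm z ^ k"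
proof -
  have sub: "cball 0 (r / 2) \<subseteq> ball 0 r" using r by auto
  obtain M where M: "0 < M" "\<And>z. z \<in> cball 0 (r / 2) \<Longrightarrow> norm (f z) \<le> M"
    using compact_bound[OF holo_fun_continuous_on[OF f] compact_cball sub] by blast
  show ?thesis
  proof
    show "0 < 2 * M / (r / 2) ^ k" using M r by simp
    fix z :: "complex^'n" assume z: "norm z \<le> r / 4"
    show "norm (f z - (\<Sum>j<k. hpart f j z)) \<le> 2 * M / (r / 2) ^ k * norm z ^ k"
    proof (cases "z = 0")
      \<comment> \<open>At the origin the line degenerates. Only the part of degree 0 survives, and
        for \<open>k = 0\<close> the right-hand side is still positive because
        \<open>0 ^ 0 = 1\<close>.\<close>
      case True
      have "f 0 - (\<Sum>j<k. hpart f j 0) = 0" if "k \<noteq> 0"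
      proof -
        have "hpart f j 0 = 0" if "j > 0" for j using hpart_smult[of j 0 0] that by (simp add: power_0_left)
        moreover have "hpart f 0 0 = f 0" by (simp add: hpart_def)
        ultimately have "(\<Sum>j<k. hpart f j 0) = (\<Sum>j<k. if j = 0 then f 0 else 0)"
          by (intro sum.cong) auto
        then show ?thesis using that by simp
      qed
      moreover have "norm (f 0) \<le> 2 * M" using M(1) M(2)[of 0] r by simp
      ultimately show ?thesis using True M by (cases "k = 0") (auto simp: power_0_left)
    next
      case False
      define R where "R = (r / 2) / norm z"
      have R: "0 < R" "1 \<le> R / 2" "R * norm z = r / 2" using False z r by (auto simp: R_def field_simps)
      have in_ball: "\<zeta> *s z \<in> cball 0 (r / 2)" if "norm \<zeta> \<le> R" for \<zeta>
        using mult_right_mono[OF that, of "norm z"] R by (simp add: norm_smult)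
      have "(\<lambda>\<zeta>. f (\<zeta> *s z)) holomorphic_on cball 0 R"
        by (rule holomorphic_on_subset[OF holo_radial]) (use in_ball r in fastforce)
      from taylor_tail[OF this R(1), of M 1 k] M(2) in_ball R(2)
      show ?thesis by (simp add: hpart_def R_def power_divide)
    qed
  qed
qed

text \<open>Near the origin this is a Taylor coefficient of the family
  \<open>f (\<zeta> *s z)\<close>. Homogeneity then extends holomorphy from a ball to the whole
  space, and this is how functions given only locally yield entire ones.\<close>

lemma holo_fun_hpart: "holo_fun (hpart f k) UNIV"
proof (rule holo_fun_locally)
  define K :: "(complex^'n) set" where "K = ball 0 (r / 2)"
  have sub: "cball 0 (r / 2) \<subseteq> ball 0 r" using r by auto
  obtain M where M: "0 < M" "\<And>z. z \<in> cball 0 (r / 2) \<Longrightarrow> norm (f z) \<le> M"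
    using compact_bound[OF holo_fun_continuous_on[OF f] compact_cball sub] by blast
  have in_ball: "\<zeta> *s z \<in> cball 0 (r / 2)" if "z \<in> K" "norm \<zeta> \<le> 1" for z \<zeta>
    using mult_mono[OF that(2), of "norm z" "r / 2"] that by (simp add: norm_smult K_def)
  have hK: "holo_fun (hpart f k) K"
    unfolding hpart_def
  proof (rule taylor_family_coeff[where P = "\<lambda>g. holo_fun g K" and K = K and R = 1 and M = M and ?e0.0 = 1])
    fix z assume z: "z \<in> K"
    show "(\<lambda>\<zeta>. f (\<zeta> *s z)) holomorphic_on cball 0 1"
      by (rule holomorphic_on_subset[OF holo_radial]) (use in_ball[OF z] r in fastforce)
    show "norm (f (\<zeta> *s z)) \<le> M" if "norm \<zeta> \<le> 1" for \<zeta>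
      using M in_ball[OF z that] by blast
  next
    fix e :: real assume e: "0 < e" "e < 1"
    show "holo_fun (\<lambda>z. f (of_real e *s z)) K"
      by (rule holo_fun_compose[OF holo_map_smult f])
         (use in_ball[of _ "of_real e"] r e in fastforce)
  qed (auto intro: holo_fun_add holo_fun_cmult holo_fun_uniform_approx simp: K_def)
  fix z :: "complex^'n"
  \<comment> \<open>A scaling factor that moves the ball of radius \<open>norm z + 1\<close> into
    the ball where holomorphy is already known.\<close>
  define e where "e = r / (4 * (norm z + 1))"
  have nz: "0 < norm z + 1" by (simp add: add_nonneg_pos)
  have e: "0 < e" "e * (norm z + 1) = r / 4" using r nz by (simp_all add: e_def field_simps)
  have "holo_fun (\<lambda>w. inverse (of_real e ^ k) * hpart f k (of_real e *s w)) (ball 0 (norm z + 1))"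
  proof (intro holo_fun_cmult open_ball holo_fun_compose[OF holo_map_smult hK])
    fix w :: "complex^'n" assume "w \<in> ball 0 (norm z + 1)"
    then have "e * norm w < e * (norm z + 1)" using e by simp
    then show "of_real e *s w \<in> K" using e r by (simp add: K_def norm_smult)
  qed
  moreover have "inverse (of_real e ^ k) * hpart f k (of_real e *s w) = hpart f k w" for w
    using e by (simp add: hpart_smult)
  ultimately show "\<exists>T. z \<in> T \<and> holo_fun (hpart f k) T"
    by (intro exI[of _ "ball 0 (norm z + 1)"]) simp
qed

text \<open>An intermediate radius \<open>t\<close> between \<open>s\<close> and \<open>r\<close>
  bounds \<open>f\<close> on a compact ball and gives the geometric ratio \<open>s / t < 1\<close>.
  These partial sums are the entire approximants in the Runge argument.\<close>

lemma hpart_approx: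
  assumes s: "0 < s" "s < r" and e: "0 < e"
  obtains N where "\<And>z. z \<in> ball 0 s \<Longrightarrow> norm (f z - (\<Sum>j<N. hpart f j z)) < e"
proof -
  define t where "t = (s + r) / 2"
  have t: "s < t" "t < r" "0 < t" using s by (auto simp: t_def)
  have sub: "cball 0 t \<subseteq> ball 0 r" using t by auto
  obtain M where M: "0 < M" "\<And>z. z \<in> cball 0 t \<Longrightarrow> norm (f z) \<le> M"
    using compact_bound[OF holo_fun_continuous_on[OF f] compact_cball sub] by blast
  define q where "q = s / t"
  have q: "0 \<le> q" "q < 1" using s t by (auto simp: q_def)
  have "(\<lambda>k. M * q ^ k / (1 - q)) \<longlonglongrightarrow> M * 0 / (1 - q)"
    using q by (intro tendsto_intros LIMSEQ_realpow_zero) auto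
  then have "eventually (\<lambda>k. M * q ^ k / (1 - q) < e) sequentially"
    using e by (intro order_tendstoD) auto
  then obtain N where N: "M * q ^ N / (1 - q) < e" by (auto simp: eventually_sequentially)
  show ?thesis
  proof
    fix z :: "complex^'n" assume z: "z \<in> ball 0 s"
    define R where "R = t / s"
    have R: "0 < R" "q * R = 1" using s t by (auto simp: R_def q_def)
    have in_ball: "\<zeta> *s z \<in> cball 0 t" if "norm \<zeta> \<le> R" for \<zeta>
      using mult_mono[OF that, of "norm z" s] z s R by (simp add: norm_smult R_def)
    have "(\<lambda>\<zeta>. f (\<zeta> *s z)) holomorphic_on cball 0 R"
      by (rule holomorphic_on_subset[OF holo_radial]) (use in_ball t in fastforce)
    from taylor_tail_geometric[OF this R(1), of M 1 q N] M(2) in_ball q R(2) N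
    show "norm (f z - (\<Sum>j<N. hpart f j z)) < e" by (simp add: hpart_def)
  qed
qed

text \<open>On the disc of radius \<open>x\<close> Cauchy's inequality gives a bound of order
  \<open>x ^ (m - k)\<close>; let \<open>x\<close> tend to 0.\<close>

lemma hpart_eq_0:
  assumes C: "\<And>z. norm z < s \<Longrightarrow> norm (f z) \<le> C * norm z ^ m" and s: "0 < s" and k: "k < m"
  shows "hpart f k z = 0"
proof -
  have le: "norm (hpart f k z) \<le> C * norm z ^ m * x"
    if x: "0 < x" "x < 1" "x * norm z < min r s" for x
  proof -
    have in_ball: "norm (\<zeta> *s z) < min r s" if "norm \<zeta> \<le> x" for \<zeta>
      using mult_right_mono[OF that, of "norm z"] x by (simp add: norm_smult)
    have C0: "0 \<le> C * (x * norm z) ^ m"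
      using C[of "of_real x *s z"] x in_ball[of "of_real x"] by (simp add: norm_smult order_trans[OF norm_ge_zero])
    have "norm (hpart f k z) \<le> C * (x * norm z) ^ m / x ^ k"
      unfolding hpart_def
    proof (rule taylor_coeff_bound)
      show "(\<lambda>\<zeta>. f (\<zeta> *s z)) holomorphic_on cball 0 x"
        by (rule holomorphic_on_subset[OF holo_radial]) (use in_ball in auto)
      fix \<zeta> :: complex assume \<zeta>: "norm \<zeta> \<le> x"
      have "norm (f (\<zeta> *s z)) \<le> C * norm (\<zeta> *s z) ^ m" using C in_ball[OF \<zeta>] by simp
      \<comment> \<open>The constant \<open>C\<close> carries no sign, so monotonicity needs a case
        distinction; a negative \<open>C\<close> contradicts \<open>C0\<close> unless
        \<open>z = 0\<close>.\<close>
      also have "\<dots> \<le> C * (x * norm z) ^ m"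
      proof (cases "norm z = 0 \<or> C \<ge> 0")
        case True
        then show ?thesis using \<zeta> x
          by (cases "norm z = 0") (auto simp: norm_smult mult_left_mono power_mono mult_right_mono)
      next
        case False
        then have "C * (x * norm z) ^ m < 0" using x by (simp add: mult_neg_pos)
        then show ?thesis using C0 by simp
      qed
      finally show "norm (f (\<zeta> *s z)) \<le> C * (x * norm z) ^ m" .
    qed (use x in auto)
    also have "\<dots> = C * norm z ^ m * x ^ (m - k)"
      using x k by (simp add: power_mult_distrib power_diff)
    also have "\<dots> \<le> C * norm z ^ m * x"
    proof (rule mult_left_mono)
      have "x ^ (m - k) \<le> x ^ 1" using x k by (intro power_decreasing) auto
      then show "x ^ (m - k) \<le> x" by simp
      show "0 \<le> C * norm z ^ m"
        using C0 x mult_le_cancel_right_pos[of "x ^ m" 0 "C * norm z ^ m"]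
        by (simp add: power_mult_distrib mult_ac)
    qed
    finally show ?thesis .
  qed
  have "((\<lambda>x. C * norm z ^ m * x) \<longlongrightarrow> C * norm z ^ m * 0) (at_right 0)" by (intro tendsto_intros)
  moreover have "eventually (\<lambda>x. norm (hpart f k z) \<le> C * norm z ^ m * x) (at_right 0)"
  proof -
    have "eventually (\<lambda>x::real. x < 1) (at_right 0)"
      by (rule order_tendstoD(2)[of _ 0]) (auto intro!: tendsto_intros)
    moreover have "((\<lambda>x. x * norm z) \<longlongrightarrow> 0 * norm z) (at_right 0)" by (intro tendsto_intros)
    then have "eventually (\<lambda>x. x * norm z < min r s) (at_right 0)"
      by (rule order_tendstoD(2)) (use r s in auto)
    ultimately show ?thesis
      using eventually_at_right_less[of "0::real"] by eventually_elim (rule le)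
  qed
  ultimately have "norm (hpart f k z) \<le> C * norm z ^ m * 0"
    by (intro tendsto_lowerbound[of _ _ "at_right 0"]) auto
  then show ?thesis by simp
qed

end

text \<open>Euler's identity \<open>(d + 1) q(z) = \<Sum>z\<^sub>j \<partial>\<^sub>jq(z)\<close> drives the induction.\<close>

lemma homogeneous_induct:
  fixes q :: "complex^'n::finite \<Rightarrow> complex"
  assumes "holo_fun q UNIV" "\<And>c z. c \<noteq> 0 \<Longrightarrow> q (c *s z) = c ^ d * q z"
    and "\<And>f g. P f \<Longrightarrow> P g \<Longrightarrow> P (\<lambda>z. f z + g z)" "\<And>c f. P f \<Longrightarrow> P (\<lambda>z. c * f z)"
    and "\<And>\<alpha>. (\<Sum>i\<in>UNIV. \<alpha> i) = d \<Longrightarrow> P (\<lambda>z. \<Prod>i\<in>UNIV. (z $ i) ^ \<alpha> i)"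
  shows "P q"
  using assms
proof (induction d arbitrary: q P)
  case 0
  \<comment> \<open>The scaling law is given for nonzero factors only, so the value at the origin is
    reached by continuity along a ray.\<close>
  have "q z = q 0" for z
  proof -
    have "isCont q 0"
      using holo_fun_continuous_on[OF 0(1)] by (simp add: continuous_on_eq_continuous_at)
    moreover have "((\<lambda>x. complex_of_real x *s z) \<longlongrightarrow> 0) (at_right 0)"
    proof -
      have "isCont (\<lambda>x. complex_of_real x *s z) 0"
        using has_derivative_continuous[OF has_derivative_smult_left, of complex_of_real complex_of_real 0 UNIV z]
        by (simp add: has_derivative_of_real)
      then show ?thesis by (simp add: isCont_def filterlim_at_split)
    qed
    ultimately have "((\<lambda>x. q (complex_of_real x *s z)) \<longlongrightarrow> q 0) (at_right 0)"
      by (rule isCont_tendsto_compose)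
    moreover have "eventually (\<lambda>x. q (complex_of_real x *s z) = q z) (at_right 0)"
      using eventually_at_right_less[of "0::real"] by eventually_elim (simp add: 0(2))
    ultimately have "((\<lambda>x. q z) \<longlongrightarrow> q 0) (at_right (0::real))" by (simp add: tendsto_cong)
    then show ?thesis by (simp add: tendsto_const_iff)
  qed
  then have "q = (\<lambda>z. q 0 * (\<Prod>i\<in>UNIV. (z $ i) ^ 0))" by auto
  moreover have "P (\<lambda>z. q 0 * (\<Prod>i\<in>UNIV. (z $ i) ^ 0))" by (intro 0(4,5)) simp
  ultimately show ?case by simp
next
  case (Suc d)
  have P0: "P (\<lambda>z. 0)"
  proof -
    obtain i :: 'n where True by simp
    have "(\<Sum>j\<in>UNIV. if j = i then Suc d else 0) = Suc d" by simp
    from Suc.prems(4)[OF Suc.prems(5)[OF this], of 0] show ?thesis by simp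
  qed
  have sum: "P (\<lambda>z. \<Sum>j\<in>J. g j z)" if "finite J" "\<And>j. P (g j)" for J :: "'n set" and g
    using that(1) by (induction) (auto intro: Suc.prems(3) P0 that(2))
  have diff: "(q has_derivative (\<lambda>v. dirder q v z)) (at z)" for z
    using has_derivative_dirder[OF Suc.prems(1)] by simp
  have dirder_homog: "dirder q v (c *s z) = c ^ d * dirder q v z" if c: "c \<noteq> 0" for c v z
  proof -
    have "((\<lambda>\<zeta>. q (z + \<zeta> *s v)) has_field_derivative dirder q v z) (at (inverse c * 0))"
      using holo_fun_line_dirder[OF Suc.prems(1), of z 0 v] by simp
    then have "((\<lambda>\<zeta>. q (z + (inverse c * \<zeta>) *s v)) has_field_derivative dirder q v z * inverse c) (at 0)"
      by (rule DERIV_chain2) (auto intro!: derivative_eq_intros)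
    then have "((\<lambda>\<zeta>. c ^ Suc d * q (z + (inverse c * \<zeta>) *s v)) has_field_derivative
        c ^ Suc d * (dirder q v z * inverse c)) (at 0)"
      by (rule DERIV_cmult)
    moreover have "c ^ Suc d * q (z + (inverse c * \<zeta>) *s v) = q (c *s z + \<zeta> *s v)" for \<zeta>
    proof -
      have "c *s (z + (inverse c * \<zeta>) *s v) = c *s z + \<zeta> *s v"
        using c by (simp add: vec_eq_iff field_simps)
      from Suc.prems(2)[OF c, of "z + (inverse c * \<zeta>) *s v", unfolded this] show ?thesis ..
    qed
    ultimately have "((\<lambda>\<zeta>. q (c *s z + \<zeta> *s v)) has_field_derivative c ^ d * dirder q v z) (at 0)"
      using c by (simp add: field_simps)
    then show ?thesis by (simp add: dirder_def DERIV_imp_deriv)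
  qed
  have euler: "of_nat (Suc d) * q z = (\<Sum>j\<in>UNIV. z $ j * dirder q (axis j 1) z)" for z
  proof -
    have "((\<lambda>\<zeta>. q (z + \<zeta> *s z)) has_field_derivative dirder q z z) (at 0)"
      using holo_fun_line_dirder[OF Suc.prems(1), of z 0 z] by simp
    moreover have "((\<lambda>\<zeta>. (1 + \<zeta>) ^ Suc d * q z) has_field_derivative of_nat (Suc d) * q z) (at 0)"
      by (auto intro!: derivative_eq_intros)
    then have "((\<lambda>\<zeta>. q (z + \<zeta> *s z)) has_field_derivative of_nat (Suc d) * q z) (at 0)"
    proof (rule has_field_derivative_transform_within_open[where S = "ball 0 1"])
      fix \<zeta> :: complex assume "\<zeta> \<in> ball 0 1"
      then have "1 + \<zeta> \<noteq> 0" by (metis add_eq_0_iff dist_0_norm mem_ball norm_minus_cancel norm_one order_less_irrefl)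
      from Suc.prems(2)[OF this, of z]
      show "(1 + \<zeta>) ^ Suc d * q z = q (z + \<zeta> *s z)" by (simp add: vector_sadd_rdistrib)
    qed auto
    ultimately have "of_nat (Suc d) * q z = dirder q z z" by (rule DERIV_unique[symmetric])
    then show ?thesis using dirder_axis[OF Suc.prems(1), of z z] by simp
  qed
  \<comment> \<open>The induction hypothesis is applied to the property
    \<open>P (\<lambda>z. z $ j * g z)\<close> of \<open>g\<close>; for this reason \<open>P\<close>
    varies in the induction.\<close>
  have "P (\<lambda>z. z $ j * dirder q (axis j 1) z)" for j
  proof (rule Suc.IH[where P = "\<lambda>g. P (\<lambda>z. z $ j * g z)"])
    show "holo_fun (dirder q (axis j 1)) UNIV" by (rule holo_fun_dirder[OF open_UNIV Suc.prems(1)])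
    show "dirder q (axis j 1) (c *s z) = c ^ d * dirder q (axis j 1) z" if "c \<noteq> 0" for c z
      using dirder_homog[OF that] .
    show "P (\<lambda>z. z $ j * (f z + g z))" if "P (\<lambda>z. z $ j * f z)" "P (\<lambda>z. z $ j * g z)" for f g
      using Suc.prems(3)[OF that] by (simp add: distrib_left)
    show "P (\<lambda>z. z $ j * (c * f z))" if "P (\<lambda>z. z $ j * f z)" for c f
      using Suc.prems(4)[OF that, of c] by (simp add: mult_ac)
    fix \<alpha> :: "'n \<Rightarrow> nat" assume \<alpha>: "sum \<alpha> UNIV = d"
    have "sum (\<alpha>(j := Suc (\<alpha> j))) UNIV = Suc d"
      using \<alpha> by (simp add: sum.remove[of UNIV j])
    from Suc.prems(5)[OF this]
    show "P (\<lambda>z. z $ j * (\<Prod>i\<in>UNIV. (z $ i) ^ \<alpha> i))"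
      by (simp add: prod.remove[of UNIV j] mult.assoc)
  qed
  then have "P (\<lambda>z. inverse (of_nat (Suc d)) * (\<Sum>j\<in>UNIV. z $ j * dirder q (axis j 1) z))"
    by (intro Suc.prems(4) sum) auto
  moreover have "inverse (of_nat (Suc d)) * (\<Sum>j\<in>UNIV. z $ j * dirder q (axis j 1) z) = q z" for z
    unfolding euler[symmetric] by (simp del: of_nat_Suc)
  ultimately show ?case by simp
qed


section \<open>Jets of automorphisms\<close>

text \<open>The filter \<open>nhds 0\<close> includes the origin itself, so for \<open>k > 0\<close>
  the condition forces \<open>F 0 = 0\<close>.\<close>

definition vanishes_to_order :: "nat \<Rightarrow> (complex^'n::finite \<Rightarrow> complex^'m::finite) \<Rightarrow> bool" where
  "vanishes_to_order k F \<longleftrightarrow> (\<exists>C. \<forall>\<^sub>F z in nhds 0. norm (F z) \<le> C * norm z ^ k)"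

lemma vanishes_to_orderE:
  assumes "vanishes_to_order k F"
  obtains C where "0 < C" "\<forall>\<^sub>F z in nhds 0. norm (F z) \<le> C * norm z ^ k"
proof -
  obtain C where C: "\<forall>\<^sub>F z in nhds 0. norm (F z) \<le> C * norm z ^ k"
    using assms by (auto simp: vanishes_to_order_def)
  from C have "\<forall>\<^sub>F z in nhds 0. norm (F z) \<le> (\<bar>C\<bar> + 1) * norm z ^ k"
    by eventually_elim (rule order_trans, assumption, auto intro: mult_right_mono)
  then show ?thesis by (intro that[of "\<bar>C\<bar> + 1"]) auto
qed

lemma vanishes_to_orderE_ball:
  assumes "vanishes_to_order k F"
  obtains C r where "0 < C" "0 < r" "\<And>z. norm z < r \<Longrightarrow> norm (F z) \<le> C * norm z ^ k"
proof -
  obtain C where C: "0 < C" "\<forall>\<^sub>F z in nhds 0. norm (F z) \<le> C * norm z ^ k"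
    by (rule vanishes_to_orderE[OF assms])
  from C(2) obtain r where "0 < r" "\<And>z. norm z < r \<Longrightarrow> norm (F z) \<le> C * norm z ^ k"
    by (auto simp: eventually_nhds_metric)
  then show ?thesis using that C(1) by blast
qed

lemma vanishes_to_orderI:
  assumes "0 < r" "\<And>z. norm z < r \<Longrightarrow> norm (F z) \<le> C * norm z ^ k"
  shows "vanishes_to_order k F"
  unfolding vanishes_to_order_def eventually_nhds_metric using assms by auto

lemma vanishes_to_order_add:
  assumes "vanishes_to_order k F" "vanishes_to_order k G"
  shows "vanishes_to_order k (\<lambda>z. F z + G z)"
proof -
  obtain C D where "\<forall>\<^sub>F z in nhds 0. norm (F z) \<le> C * norm z ^ k"
    "\<forall>\<^sub>F z in nhds 0. norm (G z) \<le> D * norm z ^ k"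
    using assms by (auto simp: vanishes_to_order_def)
  then have "\<forall>\<^sub>F z in nhds 0. norm (F z + G z) \<le> (C + D) * norm z ^ k"
    by eventually_elim (simp add: distrib_right norm_triangle_mono)
  then show ?thesis by (auto simp: vanishes_to_order_def)
qed

lemma vanishes_to_order_uminus: "vanishes_to_order k (\<lambda>z. - F z) \<longleftrightarrow> vanishes_to_order k F"
  by (simp add: vanishes_to_order_def)

lemma vanishes_to_order_minus_commute:
  "vanishes_to_order k (\<lambda>z. F z - G z) \<longleftrightarrow> vanishes_to_order k (\<lambda>z. G z - F z)"
  by (simp add: vanishes_to_order_def norm_minus_commute)

lemma vanishes_to_order_mono:
  assumes "vanishes_to_order k F" "l \<le> k"
  shows "vanishes_to_order l F"
proof -
  obtain C where C: "0 < C" "\<forall>\<^sub>F z in nhds 0. norm (F z) \<le> C * norm z ^ k"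
    by (rule vanishes_to_orderE[OF assms(1)])
  have "\<forall>\<^sub>F z :: complex^'a in nhds 0. norm z < 1"
    unfolding eventually_nhds_metric by (auto intro!: exI[of _ 1])
  with C(2) have "\<forall>\<^sub>F z in nhds 0. norm (F z) \<le> C * norm z ^ l"
  proof eventually_elim
    case (elim z)
    have "C * norm z ^ k \<le> C * norm z ^ l"
      using C elim assms(2) by (intro mult_left_mono power_decreasing) auto
    then show ?case using elim by linarith
  qed
  then show ?thesis by (auto simp: vanishes_to_order_def)
qed

lemma vanishes_to_order_compose:
  fixes F :: "complex^'n::finite \<Rightarrow> complex^'m::finite" and G :: "complex^'k::finite \<Rightarrow> complex^'n"
  assumes F: "vanishes_to_order k F" and G: "vanishes_to_order 1 G"
  shows "vanishes_to_order k (\<lambda>z. F (G z))"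
proof -
  obtain C where C: "0 < C" "\<forall>\<^sub>F z in nhds 0. norm (F z) \<le> C * norm z ^ k"
    by (rule vanishes_to_orderE[OF F])
  obtain D where D: "0 < D" "\<forall>\<^sub>F z in nhds 0. norm (G z) \<le> D * norm z ^ 1"
    by (rule vanishes_to_orderE[OF G])
  have "(G \<longlongrightarrow> 0) (nhds 0)"
  proof (rule Lim_null_comparison)
    show "\<forall>\<^sub>F z in nhds 0. norm (G z) \<le> D * norm z" using D(2) by simp
    have "((\<lambda>z::complex^'k. D * norm z) \<longlongrightarrow> D * norm (0::complex^'k)) (nhds 0)"
      by (rule tendsto_mult[OF tendsto_const tendsto_norm[OF filterlim_ident]])
    then show "((\<lambda>z::complex^'k. D * norm z) \<longlongrightarrow> 0) (nhds 0)" by simp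
  qed
  from eventually_compose_filterlim[OF C(2) this] D(2)
  have "\<forall>\<^sub>F z in nhds 0. norm (F (G z)) \<le> (C * D ^ k) * norm z ^ k"
  proof eventually_elim
    case (elim z)
    have "C * norm (G z) ^ k \<le> C * (D * norm z) ^ k"
      using elim C by (intro mult_left_mono power_mono) auto
    then show ?case using elim by (simp add: power_mult_distrib)
  qed
  then show ?thesis by (auto simp: vanishes_to_order_def)
qed

text \<open>\<open>F\<close> is Lipschitz near the origin, and both arguments are eventually close
  to it. This lets an automorphism be applied to both sides of a congruence of jets.\<close>

lemma vanishes_to_order_lipschitz:
  fixes F :: "complex^'n::finite \<Rightarrow> complex^'m::finite" and G H :: "complex^'k::finite \<Rightarrow> complex^'n"
  assumes F: "holo_map F UNIV" and G: "vanishes_to_order 1 G" "vanishes_to_order 1 H"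
    and k: "vanishes_to_order k (\<lambda>z. G z - H z)"
  shows "vanishes_to_order k (\<lambda>z. F (G z) - F (H z))"
proof -
  obtain C where C: "0 < C"
    "\<And>x y. x \<in> ball 0 (1 / 4) \<Longrightarrow> y \<in> ball 0 (1 / 4) \<Longrightarrow> norm (F x - F y) \<le> C * norm (x - y)"
    using locally_lipschitz_holo_map[of F 1] holo_map_subset[OF F] by (metis subset_UNIV zero_less_one)
  obtain D where D: "0 < D" "\<forall>\<^sub>F z in nhds 0. norm (G z) \<le> D * norm z ^ 1"
    by (rule vanishes_to_orderE[OF G(1)])
  obtain E where E: "0 < E" "\<forall>\<^sub>F z in nhds 0. norm (H z) \<le> E * norm z ^ 1"
    by (rule vanishes_to_orderE[OF G(2)])
  obtain K where K: "0 < K" "\<forall>\<^sub>F z in nhds 0. norm (G z - H z) \<le> K * norm z ^ k"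
    by (rule vanishes_to_orderE[OF k])
  have "\<forall>\<^sub>F z :: complex^'k in nhds 0. norm z < 1 / (4 * (D + E))"
    unfolding eventually_nhds_metric using D E by (intro exI[of _ "1 / (4 * (D + E))"]) auto
  with D(2) E(2) K(2) have "\<forall>\<^sub>F z in nhds 0. norm (F (G z) - F (H z)) \<le> (C * K) * norm z ^ k"
  proof eventually_elim
    case (elim z)
    have "(D + E) * norm z < 1 / 4"
      using elim(4) D E by (simp add: field_simps)
    moreover have "0 \<le> D * norm z" "0 \<le> E * norm z" using D(1) E(1) by auto
    ultimately have "D * norm z < 1 / 4" "E * norm z < 1 / 4" unfolding distrib_right by linarith+
    then have "norm (F (G z) - F (H z)) \<le> C * norm (G z - H z)"
      using elim by (intro C(2)) auto
    also have "\<dots> \<le> C * (K * norm z ^ k)" using C elim by (intro mult_left_mono) auto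
    finally show ?case by simp
  qed
  then show ?thesis by (auto simp: vanishes_to_order_def)
qed

lemma vanishes_to_order_1:
  fixes F :: "complex^'n::finite \<Rightarrow> complex^'m::finite"
  assumes "holo_map F (ball 0 r)" "0 < r" "F 0 = 0"
  shows "vanishes_to_order 1 F"
proof -
  obtain C where C: "0 < C"
    "\<And>x y. x \<in> ball 0 (r / 4) \<Longrightarrow> y \<in> ball 0 (r / 4) \<Longrightarrow> norm (F x - F y) \<le> C * norm (x - y)"
    using locally_lipschitz_holo_map[OF assms(1,2)] by blast
  show ?thesis
    by (rule vanishes_to_orderI[of "r / 4" _ C]) (use C(2)[of _ 0] assms in auto)
qed

section \<open>Automorphisms and homogeneous maps\<close>

text \<open>The inverse is carried along as data, so that its holomorphy never has to be
  derived.\<close>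

definition aut_pair :: "(complex^'n::finite \<Rightarrow> complex^'n) \<Rightarrow> (complex^'n \<Rightarrow> complex^'n) \<Rightarrow> bool" where
  "aut_pair G H \<longleftrightarrow> holo_map G UNIV \<and> holo_map H UNIV \<and> (\<forall>z. H (G z) = z) \<and> (\<forall>z. G (H z) = z) \<and> G 0 = 0"

lemma aut_pair_inverse_0: "aut_pair G H \<Longrightarrow> H 0 = 0"
  unfolding aut_pair_def by metis

lemma aut_pair_order_1:
  assumes "aut_pair G H"
  shows "vanishes_to_order 1 G" "vanishes_to_order 1 H"
proof -
  have "holo_map G (ball 0 1)" "holo_map H (ball 0 1)" "G 0 = 0"
    using assms by (auto simp: aut_pair_def intro: holo_map_subset)
  then show "vanishes_to_order 1 G" "vanishes_to_order 1 H"
    using vanishes_to_order_1[of _ 1] aut_pair_inverse_0[OF assms] by auto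
qed

lemma aut_pair_id: "aut_pair (\<lambda>z. z) (\<lambda>z. z)"
  by (simp add: aut_pair_def holo_map_id)

lemma aut_pair_compose:
  assumes "aut_pair G H" "aut_pair G' H'"
  shows "aut_pair (\<lambda>z. G (G' z)) (\<lambda>z. H' (H z))"
  using assms unfolding aut_pair_def by (auto intro: holo_map_compose)

definition homogeneous_map :: "nat \<Rightarrow> (complex^'n::finite \<Rightarrow> complex^'n) \<Rightarrow> bool" where
  "homogeneous_map d Q \<longleftrightarrow> holo_map Q UNIV \<and> (\<forall>c z. Q (c *s z) = c ^ d *s Q z)"

text \<open>Dividing both points by \<open>m\<close> reduces the claim to a fixed ball; homogeneity
  returns the factor \<open>m ^ d\<close>, of which one power is used up by the difference
  \<open>a - b\<close>.\<close>

lemma homogeneous_map_lipschitz: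
  assumes Q: "homogeneous_map d Q" and d: "0 < d"
  obtains C where "0 < C"
    "\<And>a b m. norm a \<le> m \<Longrightarrow> norm b \<le> m \<Longrightarrow> norm (Q a - Q b) \<le> C * m ^ (d - 1) * norm (a - b)"
proof -
  have "holo_map Q (ball 0 8)" using Q by (auto simp: homogeneous_map_def intro: holo_map_subset)
  from locally_lipschitz_holo_map[OF this]
  obtain C where C: "0 < C" "\<And>x y. x \<in> ball 0 2 \<Longrightarrow> y \<in> ball 0 2 \<Longrightarrow> norm (Q x - Q y) \<le> C * norm (x - y)"
    by auto
  show ?thesis
  proof (rule that[OF C(1)])
    fix a b :: "complex^'a" and m :: real assume ab: "norm a \<le> m" "norm b \<le> m"
    show "norm (Q a - Q b) \<le> C * m ^ (d - 1) * norm (a - b)"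
    proof (cases "m = 0")
      case True
      then show ?thesis using ab by simp
    next
      case False
      then have m: "0 < m" using ab norm_ge_zero[of a] by linarith
      define c :: complex where "c = of_real m"
      define a' b' where "a' = inverse c *s a" and "b' = inverse c *s b"
      have c: "c \<noteq> 0" "norm c = m" using m by (auto simp: c_def)
      have e: "a = c *s a'" "b = c *s b'" using c by (auto simp: a'_def b'_def vec_eq_iff)
      have n: "norm a' \<le> 1" "norm b' \<le> 1" using ab m c by (auto simp: a'_def b'_def norm_smult norm_inverse norm_divide divide_simps)
      have "Q a - Q b = c ^ d *s (Q a' - Q b')"
        using Q unfolding e homogeneous_map_def by (simp add: vec_eq_iff algebra_simps)
      then have "norm (Q a - Q b) = m ^ d * norm (Q a' - Q b')" by (simp only: norm_smult norm_power c)
      also have "\<dots> \<le> m ^ d * (C * norm (a' - b'))"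
        using n m by (intro mult_left_mono C(2)) auto
      also have "a' - b' = inverse c *s (a - b)" by (simp add: a'_def b'_def vec_eq_iff algebra_simps)
      also have "m ^ d * (C * norm (inverse c *s (a - b))) = C * m ^ (d - 1) * norm (a - b)"
        unfolding norm_smult norm_inverse c using m d by (simp add: power_eq_if)
      finally show ?thesis .
    qed
  qed
qed

lemma homogeneous_map_order:
  assumes "homogeneous_map d Q" "0 < d"
  shows "vanishes_to_order d Q"
proof -
  obtain C where C: "0 < C"
    "\<And>a b m. norm a \<le> m \<Longrightarrow> norm b \<le> m \<Longrightarrow> norm (Q a - Q b) \<le> C * m ^ (d - 1) * norm (a - b)"
    using homogeneous_map_lipschitz[OF assms] by metis
  have "Q (0 *s 0) = 0 ^ d *s Q 0" using assms(1) unfolding homogeneous_map_def by blast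
  then have Q0: "Q 0 = 0" using assms(2) by (simp add: power_0_left)
  show ?thesis
    by (rule vanishes_to_orderI[of 1 _ C])
       (use C(2)[of _ _ 0] Q0 assms(2) in \<open>auto simp: power_eq_if mult_ac\<close>)
qed

section \<open>Homogeneous maps as lowest terms of automorphisms\<close>

text \<open>\<open>Q\<close> is the lowest nonlinear term of an automorphism tangent to the
  identity. In each degree \<open>d \<ge> 2\<close> these maps turn out to form a linear space, and
  in dimension at least 2 every homogeneous map belongs to it.\<close>

definition realizable :: "nat \<Rightarrow> (complex^'n::finite \<Rightarrow> complex^'n) \<Rightarrow> bool" where
  "realizable d Q \<longleftrightarrow> homogeneous_map d Q \<and>
     (\<exists>S T. aut_pair S T \<and> vanishes_to_order (Suc d) (\<lambda>z. S z - z - Q z))"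

text \<open>Composing automorphisms adds their lowest terms. The cross term
  \<open>Q (S' z) - Q z\<close> has order \<open>(d - 1) + d\<close>, which reaches
  \<open>d + 1\<close> because \<open>d \<ge> 2\<close>.\<close>

lemma realizable_add:
  assumes Q: "realizable d Q" "realizable d Q'" and d: "2 \<le> d"
  shows "realizable d (\<lambda>z. Q z + Q' z)"
proof -
  obtain S T where S: "aut_pair S T" "vanishes_to_order (Suc d) (\<lambda>z. S z - z - Q z)"
    using Q(1) by (auto simp: realizable_def)
  obtain S' T' where S': "aut_pair S' T'" "vanishes_to_order (Suc d) (\<lambda>z. S' z - z - Q' z)"
    using Q(2) by (auto simp: realizable_def)
  have hom: "homogeneous_map d Q" "homogeneous_map d Q'" using Q by (auto simp: realizable_def)
  have "vanishes_to_order d (\<lambda>z. (S' z - z - Q' z) + Q' z)"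
    by (intro vanishes_to_order_add homogeneous_map_order hom vanishes_to_order_mono[OF S'(2)]) (use d in auto)
  then have S'1: "vanishes_to_order d (\<lambda>z. S' z - z)" by simp
  have Q1: "vanishes_to_order (Suc d) (\<lambda>z. Q (S' z) - Q z)"
  proof -
    obtain C where C: "0 < C" "\<And>a b m. norm a \<le> m \<Longrightarrow> norm b \<le> m \<Longrightarrow> norm (Q a - Q b) \<le> C * m ^ (d - 1) * norm (a - b)"
      using homogeneous_map_lipschitz[OF hom(1)] d by (metis less_le_trans pos2)
    obtain K where K: "0 < K" "\<forall>\<^sub>F z in nhds 0. norm (S' z) \<le> K * norm z ^ 1"
      by (rule vanishes_to_orderE[OF aut_pair_order_1(1)[OF S'(1)]])
    obtain M where M: "0 < M" "\<forall>\<^sub>F z in nhds 0. norm (S' z - z) \<le> M * norm z ^ d"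
      by (rule vanishes_to_orderE[OF S'1])
    from K(2) M(2) have "\<forall>\<^sub>F z in nhds 0. norm (Q (S' z) - Q z) \<le> (C * (K + 1) ^ (d - 1) * M) * norm z ^ (d - 1 + d)"
    proof eventually_elim
      case (elim z)
      have "norm (Q (S' z) - Q z) \<le> C * ((K + 1) * norm z) ^ (d - 1) * norm (S' z - z)"
        using elim K by (intro C(2)) (auto simp: distrib_right intro: order_trans add_increasing2)
      also have "\<dots> \<le> C * ((K + 1) * norm z) ^ (d - 1) * (M * norm z ^ d)"
        using elim C K by (intro mult_left_mono) auto
      finally show ?case by (simp add: power_mult_distrib power_add mult_ac)
    qed
    then have "vanishes_to_order (d - 1 + d) (\<lambda>z. Q (S' z) - Q z)" by (auto simp: vanishes_to_order_def)
    then show ?thesis by (rule vanishes_to_order_mono) (use d in simp)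
  qed
  have "vanishes_to_order (Suc d) (\<lambda>z. ((S (S' z) - S' z - Q (S' z)) + (S' z - z - Q' z)) + (Q (S' z) - Q z))"
    by (intro vanishes_to_order_add Q1 S'(2) vanishes_to_order_compose[OF S(2) aut_pair_order_1(1)[OF S'(1)]])
  then have "vanishes_to_order (Suc d) (\<lambda>z. S (S' z) - z - (Q z + Q' z))"
    by (simp add: algebra_simps)
  moreover have "homogeneous_map d (\<lambda>z. Q z + Q' z)"
    using hom by (auto simp: homogeneous_map_def holo_map_def holo_fun_add vector_add_ldistrib)
  ultimately show ?thesis
    using aut_pair_compose[OF S(1) S'(1)] unfolding realizable_def by blast
qed

lemma realizable_zero: "0 < d \<Longrightarrow> realizable d (\<lambda>z. 0)"
  unfolding realizable_def homogeneous_map_def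
  by (auto simp: holo_map_def holo_fun_const vanishes_to_order_def intro!: exI[of _ 0] exI[of _ "\<lambda>z. z"] aut_pair_id)

text \<open>Conjugation with the dilation by \<open>s\<close> multiplies a term of degree
  \<open>d\<close> by \<open>s ^ (d - 1)\<close>, and over the complex numbers every nonzero
  \<open>c\<close> is such a power.\<close>

lemma realizable_smult:
  assumes Q: "realizable d Q" and d: "2 \<le> d"
  shows "realizable d (\<lambda>z. c *s Q z)"
proof (cases "c = 0")
  case True
  then show ?thesis using realizable_zero[of d] d by simp
next
  case False
  define s where "s = exp (Ln c / of_nat (d - 1))"
  have s: "s \<noteq> 0" "s ^ (d - 1) = c"
    using False d by (simp_all add: s_def flip: exp_of_nat_mult)
  obtain S T where S: "aut_pair S T" "vanishes_to_order (Suc d) (\<lambda>z. S z - z - Q z)"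
    using Q by (auto simp: realizable_def)
  have hom: "homogeneous_map d Q" using Q by (auto simp: realizable_def)
  have cancel: "inverse s *s (s *s z) = z" "s *s (inverse s *s z) = z" for z :: "complex^'a"
    using s by (auto simp: vec_eq_iff)
  have L: "aut_pair (\<lambda>z::complex^'a. t *s z) (\<lambda>z. inverse t *s z)" if "t \<noteq> 0" for t
    using that by (auto simp: aut_pair_def holo_map_smult vec_eq_iff)
  have "aut_pair (\<lambda>z. inverse s *s S (s *s z)) (\<lambda>z. inverse s *s T (inverse (inverse s) *s z))"
    using aut_pair_compose[OF L[of "inverse s"] aut_pair_compose[OF S(1) L[OF s(1)]]] s by simp
  moreover have "vanishes_to_order (Suc d) (\<lambda>z. inverse s *s S (s *s z) - z - c *s Q z)"
  proof -
    \<comment> \<open>The lemma for Lipschitz maps compares two arguments. Here the second one is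
      the zero map, which accounts for the term \<open>inverse s *s 0\<close>.\<close>
    have "vanishes_to_order (Suc d) (\<lambda>z. inverse s *s (S (s *s z) - s *s z - Q (s *s z)) - inverse s *s 0)"
      by (intro vanishes_to_order_lipschitz[where F = "\<lambda>z. inverse s *s z"] holo_map_smult
          vanishes_to_order_mono[where l = 1 and k = "Suc d"])
         (use vanishes_to_order_compose[OF S(2) aut_pair_order_1(1)[OF L[OF s(1)]]] in
           \<open>auto simp: vanishes_to_order_def intro!: exI[of _ 0]\<close>)
    moreover have "inverse s *s (S (s *s z) - s *s z - Q (s *s z)) - inverse s *s 0
        = inverse s *s S (s *s z) - z - c *s Q z" for z
    proof -
      have "s ^ d = s * c" using s d by (simp add: power_eq_if flip: s(2))
      moreover have "Q (s *s z) = s ^ d *s Q z" using hom by (simp add: homogeneous_map_def)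
      ultimately show ?thesis using s(1) by (simp add: vec_eq_iff algebra_simps)
    qed
    ultimately show ?thesis by (simp only:)
  qed
  moreover have "homogeneous_map d (\<lambda>z. c *s Q z)"
    using hom by (auto simp: homogeneous_map_def vec_eq_iff intro: holo_map_compose[OF _ holo_map_smult])
  ultimately show ?thesis unfolding realizable_def by blast
qed

lemma realizable_sum:
  assumes "2 \<le> d" "finite I" "\<And>i. i \<in> I \<Longrightarrow> realizable d (Q i)"
  shows "realizable d (\<lambda>z. \<Sum>i\<in>I. Q i z)"
  using assms(2,3) by (induction) (use assms(1) in \<open>auto intro: realizable_zero realizable_add\<close>)

text \<open>A Vandermonde argument without determinants: subtracting \<open>2 ^ Suc N\<close> times
  the value at \<open>t\<close> from the value at \<open>2 * t\<close> removes the top coefficient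
  and multiplies the others by \<open>2 ^ k - 2 ^ Suc N\<close>, which is nonzero.\<close>

lemma realizable_coefficients:
  assumes d: "2 \<le> d" and "\<And>t. realizable d (\<lambda>z. \<Sum>k\<le>N. t ^ k *s c k z)" "k \<le> N"
  shows "realizable d (c k)"
  using assms(2,3)
proof (induction N arbitrary: c k)
  case 0
  from 0(1)[of 1] 0(2) show ?case by simp
next
  case (Suc N)
  let ?P = "\<lambda>t z. \<Sum>k\<le>Suc N. t ^ k *s c k z"
  have low: "realizable d (c k)" if "k \<le> N" for k
  proof -
    define e :: complex where "e = 2 ^ k - 2 ^ Suc N"
    have "realizable d (\<lambda>z. (2 ^ k - 2 ^ Suc N) *s c k z)"
    proof (rule Suc.IH[OF _ that, where c = "\<lambda>k z. (2 ^ k - 2 ^ Suc N) *s c k z"])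
      fix t
      have "realizable d (\<lambda>z. ?P (2 * t) z + (- (2 ^ Suc N)) *s ?P t z)"
        by (intro realizable_add realizable_smult Suc.prems d)
      moreover have "?P (2 * t) z + (- (2 ^ Suc N)) *s ?P t z
          = (\<Sum>k\<le>N. t ^ k *s ((2 ^ k - 2 ^ Suc N) *s c k z))" for z
      proof -
        have "?P (2 * t) z + (- (2 ^ Suc N)) *s ?P t z
            = (\<Sum>k\<le>Suc N. (2 * t) ^ k *s c k z + (- (2 ^ Suc N)) *s (t ^ k *s c k z))"
          by (simp only: sum.distrib vec.scale_sum_right)
        also have "\<dots> = (\<Sum>k\<le>Suc N. t ^ k *s ((2 ^ k - 2 ^ Suc N) *s c k z))"
          by (intro sum.cong refl) (simp add: vec_eq_iff power_mult_distrib algebra_simps)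
        finally show ?thesis by simp
      qed
      ultimately show "realizable d (\<lambda>z. \<Sum>k\<le>N. t ^ k *s ((2 ^ k - 2 ^ Suc N) *s c k z))" by simp
    qed
    then have "realizable d (\<lambda>z. inverse e *s (e *s c k z))"
      unfolding e_def by (rule realizable_smult[OF _ d])
    moreover have "e \<noteq> 0"
    proof -
      have "(2::nat) ^ k \<noteq> 2 ^ Suc N" using that by (subst power_inject_exp) auto
      then have "complex_of_nat (2 ^ k) \<noteq> complex_of_nat (2 ^ Suc N)" using of_nat_eq_iff by blast
      then show ?thesis by (simp add: e_def)
    qed
    then have "inverse e *s (e *s c k z) = c k z" for z by (simp add: vec_eq_iff)
    ultimately show ?thesis by simp
  qed
  show ?case
  proof (cases "k = Suc N")
    case True
    have "realizable d (\<lambda>z. ?P 1 z + (-1) *s (\<Sum>k\<le>N. c k z))"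
      by (intro realizable_add realizable_smult Suc.prems d realizable_sum low) auto
    then show ?thesis using True by simp
  next
    case False
    then show ?thesis using low Suc.prems by simp
  qed
qed

definition linear_form :: "complex^'n::finite \<Rightarrow> complex^'n \<Rightarrow> complex" where
  "linear_form l z = (\<Sum>j\<in>UNIV. l $ j * z $ j)"

lemma linear_form_add: "linear_form l (z + w) = linear_form l z + linear_form l w"
  and linear_form_smult: "linear_form l (c *s z) = c * linear_form l z"
  and linear_form_diff: "linear_form l (z - w) = linear_form l z - linear_form l w"
  and linear_form_add_left: "linear_form (l + m) z = linear_form l z + linear_form m z"
  and linear_form_smult_left: "linear_form (c *s l) z = c * linear_form l z"
  and linear_form_0: "linear_form l 0 = 0"
  by (simp_all add: linear_form_def algebra_simps sum.distrib sum_subtractf sum_distrib_left)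

lemma linear_form_axis: "linear_form (axis j 1) z = z $ j" "linear_form l (axis j c) = c * l $ j"
  by (simp_all add: linear_form_def axis_def if_distrib if_distribR cong: if_cong)

lemma holo_fun_linear_form: "holo_fun (linear_form l) UNIV"
  unfolding linear_form_def by (intro holo_fun_sum holo_fun_cmult holo_fun_nth open_UNIV)

lemma holo_map_scale: "holo_fun f UNIV \<Longrightarrow> holo_map (\<lambda>z::complex^'n::finite. f z *s w) UNIV"
  unfolding holo_map_def by (simp add: holo_fun_mult holo_fun_const)

lemma holo_map_ident_add_scale: "holo_fun f UNIV \<Longrightarrow> holo_map (\<lambda>z::complex^'n::finite. z + f z *s w) UNIV"
  unfolding holo_map_def by (simp add: holo_fun_mult holo_fun_const holo_fun_add holo_fun_nth)

text \<open>\<open>linear_form l\<close> is constant along \<open>w\<close>, so the inverse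
  subtracts the same term.\<close>

lemma realizable_shear:
  assumes d: "2 \<le> d" and w: "linear_form l w = 0"
  shows "realizable d (\<lambda>z. linear_form l z ^ d *s w)"
proof -
  have "aut_pair (\<lambda>z. z + linear_form l z ^ d *s w) (\<lambda>z. z + (- (linear_form l z ^ d)) *s w)"
    unfolding aut_pair_def
  proof (intro conjI allI holo_map_ident_add_scale)
    have "holo_fun (\<lambda>z. linear_form l z ^ d) UNIV"
      by (intro holo_fun_power open_UNIV holo_fun_linear_form)
    then show "holo_fun (\<lambda>z. linear_form l z ^ d) UNIV" "holo_fun (\<lambda>z. - (linear_form l z ^ d)) UNIV"
      using holo_fun_cmult[OF open_UNIV, of _ "-1"] by auto
  qed (use d in \<open>simp_all add: linear_form_add linear_form_diff linear_form_smult linear_form_0 w\<close>)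
  moreover have "homogeneous_map d (\<lambda>z. linear_form l z ^ d *s w)"
    unfolding homogeneous_map_def
    by (intro conjI holo_map_scale holo_fun_power open_UNIV holo_fun_linear_form)
       (simp add: linear_form_smult power_mult_distrib)
  moreover have "vanishes_to_order (Suc d) (\<lambda>z. z + linear_form l z ^ d *s w - z - linear_form l z ^ d *s w)"
    by (auto simp: vanishes_to_order_def intro!: exI[of _ 0])
  ultimately show ?thesis unfolding realizable_def by blast
qed

lemma linear_form_bound: "norm (linear_form l z) \<le> (\<Sum>j\<in>UNIV. norm (l $ j)) * norm z"
proof -
  have "norm (linear_form l z) \<le> (\<Sum>j\<in>UNIV. norm (l $ j * z $ j))"
    unfolding linear_form_def by (rule norm_sum)
  also have "\<dots> \<le> (\<Sum>j\<in>UNIV. norm (l $ j) * norm z)"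
    by (intro sum_mono) (simp add: norm_mult Finite_Cartesian_Product.norm_nth_le mult_left_mono)
  finally show ?thesis by (simp add: sum_distrib_right)
qed

text \<open>Along each line in direction \<open>u\<close> the function
  \<open>x = l ^ (d - 1)\<close> is constant, and the automorphism multiplies
  \<open>linear_form m\<close> by \<open>exp x\<close>; its inverse uses \<open>exp (- x)\<close>.
  The error is \<open>exp x - 1 - x\<close> times \<open>linear_form m\<close>, of order
  \<open>2 * (d - 1) + 1\<close>, again at least \<open>d + 1\<close> because
  \<open>d \<ge> 2\<close>.\<close>

lemma realizable_overshear:
  assumes d: "2 \<le> d" and u: "linear_form l u = 0" "linear_form m u = 1"
  shows "realizable d (\<lambda>z. (linear_form l z ^ (d - 1) * linear_form m z) *s u)"
proof -
  define x where "x z = linear_form l z ^ (d - 1)" for z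
  have hx: "holo_fun x UNIV" unfolding x_def by (intro holo_fun_power open_UNIV holo_fun_linear_form)
  have hmx: "holo_fun (\<lambda>z. - x z) UNIV" using holo_fun_cmult[OF open_UNIV hx, of "-1"] by simp
  have xu: "x (z + c *s u) = x z" for z c
    by (simp add: x_def linear_form_add linear_form_smult u)
  have mu: "linear_form m (z + c *s u) = linear_form m z + c" for z c
    by (simp add: linear_form_add linear_form_smult u)
  define S where "S z = z + ((exp (x z) - 1) * linear_form m z) *s u" for z
  define T where "T z = z + ((exp (- x z) - 1) * linear_form m z) *s u" for z
  have e: "exp (x z) * exp (- x z) = 1" for z by (simp flip: exp_add)
  have "aut_pair S T"
    unfolding aut_pair_def
  proof (intro conjI allI)
    show "holo_map S UNIV" "holo_map T UNIV"
      unfolding S_def T_def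
      by (intro holo_map_ident_add_scale holo_fun_mult holo_fun_diff holo_fun_exp open_UNIV hx hmx
          holo_fun_const holo_fun_linear_form)+
    show "T (S z) = z" for z
    proof -
      have "T (S z) = z + ((exp (x z) - 1) * linear_form m z + (exp (- x z) - 1) *
          (linear_form m z + (exp (x z) - 1) * linear_form m z)) *s u"
        unfolding T_def S_def xu mu by (simp add: vec_eq_iff algebra_simps)
      also have "(exp (x z) - 1) * linear_form m z + (exp (- x z) - 1) *
          (linear_form m z + (exp (x z) - 1) * linear_form m z) = (exp (x z) * exp (- x z) - 1) * linear_form m z"
        by algebra
      finally show ?thesis by (simp add: e)
    qed
    show "S (T z) = z" for z
    proof -
      have "S (T z) = z + ((exp (- x z) - 1) * linear_form m z + (exp (x z) - 1) *
          (linear_form m z + (exp (- x z) - 1) * linear_form m z)) *s u"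
        unfolding T_def S_def xu mu by (simp add: vec_eq_iff algebra_simps)
      also have "(exp (- x z) - 1) * linear_form m z + (exp (x z) - 1) *
          (linear_form m z + (exp (- x z) - 1) * linear_form m z) = (exp (x z) * exp (- x z) - 1) * linear_form m z"
        by algebra
      finally show ?thesis by (simp add: e)
    qed
    show "S 0 = 0" by (simp add: S_def linear_form_0)
  qed
  moreover have "homogeneous_map d (\<lambda>z. (x z * linear_form m z) *s u)"
    unfolding homogeneous_map_def
  proof (intro conjI allI holo_map_scale holo_fun_mult open_UNIV holo_fun_linear_form hx)
    show "(x (c *s z) * linear_form m (c *s z)) *s u = c ^ d *s ((x z * linear_form m z) *s u)" for c z
    proof -
      have "c ^ d = c ^ (d - 1) * c" using d by (simp add: power_eq_if)
      then show ?thesis by (simp add: x_def linear_form_smult power_mult_distrib mult_ac)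
    qed
  qed
  moreover have "vanishes_to_order (Suc d) (\<lambda>z. S z - z - (x z * linear_form m z) *s u)"
  proof -
    define A where "A = (\<Sum>j\<in>UNIV. norm (l $ j)) + 1"
    define B where "B = (\<Sum>j\<in>UNIV. norm (m $ j)) + 1"
    have AB: "1 \<le> A" "1 \<le> B" by (auto simp: A_def B_def sum_nonneg)
    have lA: "norm (linear_form l z) \<le> A * norm z" and mB: "norm (linear_form m z) \<le> B * norm z" for z
      using linear_form_bound[of l z] linear_form_bound[of m z] norm_ge_zero[of z]
      by (simp_all only: A_def B_def distrib_right mult_1 add_increasing2)
    obtain M where M: "0 < M" "\<And>\<zeta>::complex. norm \<zeta> \<le> 1 / 2 \<Longrightarrow> norm (exp \<zeta> - 1 - \<zeta>) \<le> M * norm \<zeta> ^ 2"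
    proof -
      have "norm (exp \<zeta> - 1 - \<zeta>) \<le> 2 * exp 1 * norm \<zeta> ^ 2" if "norm \<zeta> \<le> 1 / 2" for \<zeta> :: complex
      proof -
        have "deriv exp 0 = (1::complex)" by (simp add: DERIV_imp_deriv[OF DERIV_exp])
        moreover have "norm (exp \<xi>) \<le> exp 1" if "norm \<xi> \<le> 1" for \<xi> :: complex
          using that complex_Re_le_cmod[of \<xi>] by simp
        ultimately show ?thesis
          using taylor_tail[of exp 1 "exp 1" \<zeta> 2] that
          by (simp add: numeral_2_eq_2 diff_diff_eq holomorphic_on_exp)
      qed
      then show ?thesis using that[of "2 * exp 1"] by auto
    qed
    have "\<forall>\<^sub>F z :: complex^'a in nhds 0. norm z < 1 / (2 * A)"
      unfolding eventually_nhds_metric using AB by (intro exI[of _ "1 / (2 * A)"]) auto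
    then have "\<forall>\<^sub>F z in nhds 0. norm (S z - z - (x z * linear_form m z) *s u)
        \<le> (M * (A ^ (d - 1)) ^ 2 * B * norm u) * norm z ^ (2 * (d - 1) + 1)"
    proof eventually_elim
      case (elim z)
      have Az: "A * norm z \<le> 1 / 2" using elim AB by (simp add: field_simps)
      have nx: "norm (x z) \<le> (A * norm z) ^ (d - 1)" unfolding x_def norm_power by (rule power_mono) (use lA in auto)
      also have "(A * norm z) ^ (d - 1) \<le> (A * norm z) ^ 1"
        using d AB Az by (intro power_decreasing) auto
      finally have nx': "norm (x z) \<le> 1 / 2" using Az by simp
      have "S z - z - (x z * linear_form m z) *s u = ((exp (x z) - 1 - x z) * linear_form m z) *s u"
        by (simp add: S_def vec_eq_iff algebra_simps)
      then have "norm (S z - z - (x z * linear_form m z) *s u)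
          = norm (exp (x z) - 1 - x z) * norm (linear_form m z) * norm u" by (simp add: norm_smult norm_mult)
      also have "\<dots> \<le> (M * ((A * norm z) ^ (d - 1)) ^ 2) * (B * norm z) * norm u"
      proof (intro mult_right_mono mult_mono mB)
        show "norm (exp (x z) - 1 - x z) \<le> M * ((A * norm z) ^ (d - 1)) ^ 2"
          using M(2)[OF nx'] mult_left_mono[OF power_mono[OF nx norm_ge_zero], of M 2] M(1) by linarith
      qed (use M in auto)
      also have "\<dots> = (M * (A ^ (d - 1)) ^ 2 * B * norm u) * (norm z ^ (2 * (d - 1) + 1))"
        by (simp only: power_mult_distrib power_mult power_add power_one_right power_even_eq mult_ac)
      finally show ?case .
    qed
    then have "vanishes_to_order (2 * (d - 1) + 1) (\<lambda>z. S z - z - (x z * linear_form m z) *s u)"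
      by (auto simp: vanishes_to_order_def)
    then show ?thesis by (rule vanishes_to_order_mono) (use d in simp)
  qed
  ultimately show ?thesis unfolding realizable_def x_def[symmetric] by blast
qed


text \<open>The coefficient of \<open>t\<close> in \<open>(l + tm)\<^sup>d v\<^sub>t\<close>, where \<open>v\<^sub>t = tw - (l + tm)(w) u\<close> lies in the kernel of
  \<open>l + tm\<close>, is \<open>l\<^sup>d w\<close> up to shears and overshears.\<close>

lemma realizable_linear_power:
  fixes l w :: "complex^'n::finite"
  assumes d: "2 \<le> d" and n: "2 \<le> CARD('n)"
  shows "realizable d (\<lambda>z. linear_form l z ^ d *s w)"
proof (cases "l = 0")
  case True
  then have "(\<lambda>z. linear_form l z ^ d *s w) = (\<lambda>z. 0)"
    using d by (simp add: linear_form_def power_0_left)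
  then show ?thesis using realizable_zero[of d] d by simp
next
  case False
  then obtain i where i: "l $ i \<noteq> 0" by (auto simp: vec_eq_iff)
  \<comment> \<open>The dimension enters here: a second coordinate makes it possible to choose
    \<open>u \<noteq> 0\<close> in the kernel of \<open>l\<close>, together with a form
    \<open>m\<close> that equals 1 on \<open>u\<close>.\<close>
  have "\<not> UNIV \<subseteq> {i}" using n card_mono[of "{i}" "UNIV :: 'n set"] by auto
  then obtain j where j: "j \<noteq> i" by auto
  define u where "u = axis j 1 - axis i (l $ j / l $ i)"
  define m :: "complex^'n" where "m = axis j 1"
  have lu: "linear_form l u = 0" using i by (simp add: u_def linear_form_diff linear_form_axis)
  have mu: "linear_form m u = 1" using j by (simp only: u_def m_def linear_form_axis(1)) (simp add: axis_def)
  \<comment> \<open>\<open>A + t *s B\<close> is the vector \<open>v\<^sub>t\<close>, split by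
    powers of \<open>t\<close>, and \<open>a k\<close> is the coefficient of \<open>t ^ k\<close> in
    the power of the form. Their product has degree \<open>d + 1\<close> in \<open>t\<close>, and at
    both ends of the range of \<open>c\<close> one of the two contributions is missing.\<close>
  define A where "A = (- linear_form l w) *s u"
  define B where "B = w - linear_form m w *s u"
  define a where "a k z = of_nat (d choose k) * linear_form m z ^ k * linear_form l z ^ (d - k)" for k z
  define c where "c k z = (if k \<le> d then a k z *s A else 0) + (if k = 0 then 0 else a (k - 1) z *s B)" for k z
  have "realizable d (\<lambda>z. \<Sum>k\<le>Suc d. t ^ k *s c k z)" for t
  proof -
    have "linear_form (l + t *s m) (A + t *s B) = 0"
      by (simp add: A_def B_def linear_form_add linear_form_diff linear_form_smult
          linear_form_add_left linear_form_smult_left lu mu algebra_simps)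
    then have "realizable d (\<lambda>z. linear_form (l + t *s m) z ^ d *s (A + t *s B))"
      by (rule realizable_shear[OF d])
    moreover have "linear_form (l + t *s m) z ^ d *s (A + t *s B) = (\<Sum>k\<le>Suc d. t ^ k *s c k z)" for z
    proof -
      have "linear_form (l + t *s m) z ^ d = (t * linear_form m z + linear_form l z) ^ d"
        by (simp add: linear_form_add_left linear_form_smult_left add.commute)
      also have "\<dots> = (\<Sum>k\<le>d. t ^ k * a k z)"
        unfolding binomial_ring by (intro sum.cong refl) (simp add: a_def power_mult_distrib mult_ac)
      finally have 1: "linear_form (l + t *s m) z ^ d = (\<Sum>k\<le>d. t ^ k * a k z)" .
      have "(\<Sum>k\<le>Suc d. t ^ k *s c k z) = (\<Sum>k\<le>Suc d. t ^ k *s (if k \<le> d then a k z *s A else 0))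
          + (\<Sum>k\<le>Suc d. t ^ k *s (if k = 0 then 0 else a (k - 1) z *s B))"
        by (simp only: c_def vector_add_ldistrib sum.distrib)
      also have "(\<Sum>k\<le>Suc d. t ^ k *s (if k \<le> d then a k z *s A else 0)) = (\<Sum>k\<le>d. t ^ k *s (a k z *s A))"
        by simp
      also have "(\<Sum>k\<le>Suc d. t ^ k *s (if k = 0 then 0 else a (k - 1) z *s B))
          = (\<Sum>k\<le>d. t ^ Suc k *s (a k z *s B))"
        by (subst sum.atMost_Suc_shift) simp
      finally show ?thesis
        unfolding 1 by (simp add: vec_eq_iff sum_distrib_right sum_distrib_left distrib_left mult_ac)
    qed
    ultimately show ?thesis by simp
  qed
  from realizable_coefficients[OF d this, of 1] have "realizable d (c 1)" by simp
  then have "realizable d (\<lambda>z. c 1 z + ((of_nat d * linear_form l w) *s ((linear_form l z ^ (d - 1) * linear_form m z) *s u)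
      + linear_form m w *s (linear_form l z ^ d *s u)))"
    by (intro realizable_add realizable_smult realizable_shear realizable_overshear d lu mu)
  moreover have "c 1 z + ((of_nat d * linear_form l w) *s ((linear_form l z ^ (d - 1) * linear_form m z) *s u)
      + linear_form m w *s (linear_form l z ^ d *s u)) = linear_form l z ^ d *s w" for z
    using d by (simp add: c_def a_def A_def B_def vec_eq_iff algebra_simps)
  ultimately show ?thesis by simp
qed

text \<open>Polarization: replacing \<open>l\<close> by \<open>l + t *s axis a 1\<close> and
  extracting the coefficient of \<open>t ^ \<alpha> a\<close> splits off one coordinate at a time
  from a pure power. The binomial coefficient that appears is invertible.\<close>

lemma realizable_power_times_monomial:
  fixes l w :: "complex^'n::finite"
  assumes d: "2 \<le> d" and n: "2 \<le> CARD('n)" and A: "finite A" and e: "e + (\<Sum>j\<in>A. \<alpha> j) = d"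
  shows "realizable d (\<lambda>z. (linear_form l z ^ e * (\<Prod>j\<in>A. (z $ j) ^ \<alpha> j)) *s w)"
  using A e
proof (induction A arbitrary: e l)
  case empty
  then show ?case using realizable_linear_power[OF d n] by simp
next
  case (insert a A)
  define N where "N = e + \<alpha> a"
  define c where "c k z = (of_nat (N choose k) * (z $ a) ^ k * linear_form l z ^ (N - k) * (\<Prod>j\<in>A. (z $ j) ^ \<alpha> j)) *s w" for k z
  have "realizable d (\<lambda>z. \<Sum>k\<le>N. t ^ k *s c k z)" for t
  proof -
    have "realizable d (\<lambda>z. (linear_form (l + t *s axis a 1) z ^ N * (\<Prod>j\<in>A. (z $ j) ^ \<alpha> j)) *s w)"
      by (rule insert.IH) (use insert in \<open>simp add: N_def\<close>)
    moreover have "(linear_form (l + t *s axis a 1) z ^ N * (\<Prod>j\<in>A. (z $ j) ^ \<alpha> j)) *s w = (\<Sum>k\<le>N. t ^ k *s c k z)" for z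
    proof -
      have "linear_form (l + t *s axis a 1) z ^ N = (t * (z $ a) + linear_form l z) ^ N"
        by (simp only: linear_form_add_left linear_form_smult_left linear_form_axis add.commute)
      also have "\<dots> = (\<Sum>k\<le>N. t ^ k * (of_nat (N choose k) * (z $ a) ^ k * linear_form l z ^ (N - k)))"
        unfolding binomial_ring by (intro sum.cong refl) (simp add: power_mult_distrib mult_ac)
      finally show ?thesis
        by (simp add: c_def vec_eq_iff sum_distrib_right sum_distrib_left mult_ac)
    qed
    ultimately show ?thesis by simp
  qed
  from realizable_coefficients[OF d this, of "\<alpha> a"] have "realizable d (c (\<alpha> a))" by (simp add: N_def)
  then have "realizable d (\<lambda>z. inverse (of_nat (N choose \<alpha> a)) *s c (\<alpha> a) z)"
    by (rule realizable_smult[OF _ d])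
  moreover have "inverse (of_nat (N choose \<alpha> a)) *s c (\<alpha> a) z
      = (linear_form l z ^ e * (\<Prod>j\<in>insert a A. (z $ j) ^ \<alpha> j)) *s w" for z
  proof -
    have "complex_of_nat (N choose \<alpha> a) \<noteq> 0" by (simp add: N_def)
    then show ?thesis using insert.hyps by (simp add: c_def vec_eq_iff N_def mult_ac)
  qed
  ultimately show ?case by simp
qed

lemma realizable_homogeneous_map:
  fixes Q :: "complex^'n::finite \<Rightarrow> complex^'n"
  assumes d: "2 \<le> d" and n: "2 \<le> CARD('n)" and Q: "homogeneous_map d Q"
  shows "realizable d Q"
proof -
  have "realizable d (\<lambda>z. (Q z $ i) *s axis i 1)" for i
  proof (rule homogeneous_induct[where q = "\<lambda>z. Q z $ i" and d = d])
    show "holo_fun (\<lambda>z. Q z $ i) UNIV" "Q (c *s z) $ i = c ^ d * Q z $ i" for c z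
      using Q by (auto simp: homogeneous_map_def holo_map_def)
    show "realizable d (\<lambda>z. (f z + g z) *s axis i 1)"
      if "realizable d (\<lambda>z. f z *s axis i 1)" "realizable d (\<lambda>z. g z *s axis i 1)" for f g
      using realizable_add[OF that d] by (simp add: vector_sadd_rdistrib)
    show "realizable d (\<lambda>z. (c * f z) *s axis i 1)"
      if "realizable d (\<lambda>z. f z *s axis i 1)" for c f
      using realizable_smult[OF that d, of c] by simp
    \<comment> \<open>With \<open>l = 0\<close> and \<open>e = 0\<close> the power of the linear
      form is \<open>0 ^ 0 = 1\<close>, so only the monomial remains.\<close>
    show "realizable d (\<lambda>z. (\<Prod>i\<in>UNIV. (z $ i) ^ \<alpha> i) *s axis i 1)" if "sum \<alpha> UNIV = d" for \<alpha>
      using realizable_power_times_monomial[OF d n, of UNIV 0 \<alpha> 0 "axis i 1"] that by simp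
  qed
  then have "realizable d (\<lambda>z. \<Sum>i\<in>UNIV. (Q z $ i) *s axis i 1)"
    by (intro realizable_sum d) auto
  then show ?thesis by (simp add: basis_expansion)
qed

section \<open>Matching a prescribed jet\<close>

lemma vanishes_to_order_componentwise:
  fixes F :: "complex^'n::finite \<Rightarrow> complex^'m::finite"
  assumes "0 < r" "\<And>i z. norm z < r \<Longrightarrow> norm (F z $ i) \<le> C i * norm z ^ k"
  shows "vanishes_to_order k F"
proof (rule vanishes_to_orderI[OF assms(1)])
  fix z :: "complex^'n" assume "norm z < r"
  then have "norm (F z) \<le> (\<Sum>i\<in>UNIV. C i * norm z ^ k)"
    using assms(2) by (intro order_trans[OF norm_vec_le_sum] sum_mono)
  then show "norm (F z) \<le> (\<Sum>i\<in>UNIV. C i) * norm z ^ k" by (simp add: sum_distrib_right)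
qed

text \<open>The order of contact is raised one degree at a time: the lowest term of
  \<open>H \<circ> F - id\<close> is the lowest term of some automorphism \<open>S\<close>, and
  composing with its inverse removes it. These corrections are tangent to the identity, so the
  linear part of \<open>H\<close> never changes. The last conclusion records this, because a
  Lipschitz bound for \<open>H\<close> that does not depend on \<open>m\<close> is needed
  later.\<close>

lemma jet_realization:
  fixes F :: "complex^'n::finite \<Rightarrow> complex^'n"
  assumes n: "2 \<le> CARD('n)" and F: "holo_map F (ball 0 r)" "0 < r" "F 0 = 0"
    and L: "aut_pair L L'" "vanishes_to_order 2 (\<lambda>z. F z - L z)" and m: "1 \<le> m"
  shows "\<exists>G H. aut_pair G H \<and> vanishes_to_order (Suc m) (\<lambda>z. H (F z) - z) \<and>
    vanishes_to_order 2 (\<lambda>z. H z - L' z)"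
  using m
proof (induction m rule: nat_induct_at_least)
  case base
  have "vanishes_to_order 2 (\<lambda>z. L' (F z) - L' (L z))"
    by (rule vanishes_to_order_lipschitz[OF _ _ _ L(2)])
       (use L(1) aut_pair_order_1[OF L(1)] vanishes_to_order_1[OF F] in \<open>auto simp: aut_pair_def\<close>)
  then have "vanishes_to_order (Suc 1) (\<lambda>z. L' (F z) - z)"
    using L(1) by (simp add: aut_pair_def numeral_2_eq_2)
  moreover have "vanishes_to_order 2 (\<lambda>z. L' z - L' z)" by (auto simp: vanishes_to_order_def intro!: exI[of _ 0])
  ultimately show ?case using L(1) by blast
next
  case (Suc m)
  then obtain G H where G: "aut_pair G H" "vanishes_to_order (Suc m) (\<lambda>z. H (F z) - z)"
    "vanishes_to_order 2 (\<lambda>z. H z - L' z)" by blast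
  define d where "d = Suc m"
  have d: "2 \<le> d" using Suc by (simp add: d_def)
  define E where "E z = H (F z) - z" for z
  have HF: "holo_map (\<lambda>z. H (F z)) (ball 0 r)"
    by (rule holo_map_compose[OF F(1)]) (use G(1) in \<open>auto simp: aut_pair_def\<close>)
  have E: "holo_fun (\<lambda>z. E z $ i) (ball 0 r)" for i
    using HF by (simp add: E_def holo_map_def holo_fun_diff holo_fun_nth)
  \<comment> \<open>All homogeneous parts of \<open>E\<close> below degree \<open>d\<close> vanish
    by the order of contact reached so far; the part of degree \<open>d\<close> is the obstruction
    to be removed.\<close>
  define Q :: "complex^'n \<Rightarrow> complex^'n" where "Q z = (\<chi> i. hpart (\<lambda>z. E z $ i) d z)" for z
  have "homogeneous_map d Q"
    unfolding homogeneous_map_def holo_map_def Q_def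
    by (auto simp: holo_fun_hpart[OF E F(2)] hpart_smult[OF E F(2)] vec_eq_iff)
  from realizable_homogeneous_map[OF d n this]
  obtain S T where S: "aut_pair S T" "vanishes_to_order (Suc d) (\<lambda>z. S z - z - Q z)"
    by (auto simp: realizable_def)
  have hom: "homogeneous_map d Q" by fact
  have EQ: "vanishes_to_order (Suc d) (\<lambda>z. E z - Q z)"
  proof -
    obtain C s where C: "0 < C" "0 < s" "\<And>z. norm z < s \<Longrightarrow> norm (E z) \<le> C * norm z ^ d"
      using vanishes_to_orderE_ball[OF G(2)] unfolding E_def d_def by metis
    have "\<exists>K. \<forall>z. norm z \<le> r / 4 \<longrightarrow> norm ((E z - Q z) $ i) \<le> K * norm z ^ Suc d" for i
    proof -
      obtain K where K: "0 < K" "\<And>z. norm z \<le> r / 4 \<Longrightarrow>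
          norm (E z $ i - (\<Sum>j<Suc d. hpart (\<lambda>z. E z $ i) j z)) \<le> K * norm z ^ Suc d"
        using hpart_tail[OF E F(2)] by metis
      have "hpart (\<lambda>z. E z $ i) j z = 0" if "j < d" for j z
        by (rule hpart_eq_0[OF E F(2) _ C(2) that])
           (use C(3) order_trans[OF Finite_Cartesian_Product.norm_nth_le] in blast)
      then have "(\<Sum>j<Suc d. hpart (\<lambda>z. E z $ i) j z) = Q z $ i" for z by (simp add: Q_def)
      then show ?thesis using K(2) by auto
    qed
    then obtain K where "\<And>i z. norm z \<le> r / 4 \<Longrightarrow> norm ((E z - Q z) $ i) \<le> K i * norm z ^ Suc d" by metis
    then show ?thesis by (intro vanishes_to_order_componentwise[of "r / 4" _ K]) (use F(2) in auto)
  qed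
  have "vanishes_to_order (Suc d) (\<lambda>z. (E z - Q z) + - (S z - z - Q z))"
    by (intro vanishes_to_order_add EQ) (simp only: vanishes_to_order_uminus S(2))
  then have HS: "vanishes_to_order (Suc d) (\<lambda>z. H (F z) - S z)" by (simp add: E_def algebra_simps)
  have HF1: "vanishes_to_order 1 (\<lambda>z. H (F z))"
    by (rule vanishes_to_order_1[OF HF F(2)]) (use F(3) aut_pair_inverse_0[OF G(1)] in simp)
  have T: "holo_map T UNIV" using S(1) by (simp add: aut_pair_def)
  have "vanishes_to_order (Suc d) (\<lambda>z. T (H (F z)) - T (S z))"
    by (rule vanishes_to_order_lipschitz[OF T HF1 aut_pair_order_1(1)[OF S(1)] HS])
  then have 1: "vanishes_to_order (Suc (Suc m)) (\<lambda>z. T (H (F z)) - z)"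
    using S(1) by (simp add: aut_pair_def d_def)
  have "vanishes_to_order 2 (\<lambda>z. (S z - z - Q z) + Q z)"
    by (intro vanishes_to_order_add vanishes_to_order_mono[OF S(2)]
        vanishes_to_order_mono[OF homogeneous_map_order[OF hom]]) (use d in auto)
  then have "vanishes_to_order 2 (\<lambda>z. S (T z) - T z)"
    using vanishes_to_order_compose[OF _ aut_pair_order_1(2)[OF S(1)]] by simp
  then have "vanishes_to_order 2 (\<lambda>z. T z - z)"
    using S(1) by (subst vanishes_to_order_minus_commute) (simp add: aut_pair_def)
  from vanishes_to_order_compose[OF this aut_pair_order_1(2)[OF G(1)]]
  have "vanishes_to_order 2 (\<lambda>z. (T (H z) - H z) + (H z - L' z))"
    by (intro vanishes_to_order_add G(3))
  then have 2: "vanishes_to_order 2 (\<lambda>z. T (H z) - L' z)" by simp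
  show ?case using aut_pair_compose[OF G(1) S(1)] 1 2 by blast
qed


section \<open>Conjugating a contraction to an automorphism\<close>

text \<open>On a ball of radius \<open>2 * d\<close> the map is of size
  \<open>C * (2 * d)\<^sup>2\<close>; Cauchy's estimate with radius \<open>d\<close> turns this into
  a Lipschitz constant \<open>4 * n * C * d\<close>, which is small with \<open>d\<close>.\<close>

lemma small_lipschitz:
  fixes E :: "complex^'n::finite \<Rightarrow> complex^'m::finite"
  assumes E: "holo_map E (ball 0 r)" "0 < r" "vanishes_to_order 2 E" and e: "0 < e"
  obtains d where "0 < d" "d \<le> r" "\<forall>x\<in>ball 0 d. \<forall>y\<in>ball 0 d. norm (E x - E y) \<le> e * norm (x - y)"
proof -
  obtain C s where C: "0 < C" "0 < s" "\<And>z. norm z < s \<Longrightarrow> norm (E z) \<le> C * norm z ^ 2"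
    using vanishes_to_orderE_ball[OF E(3)] by metis
  define n where "n = real CARD('m)"
  have n: "0 < n" by (simp add: n_def)
  define d where "d = min (min (r / 3) (s / 3)) (e / (4 * n * C))"
  have d: "0 < d" "3 * d \<le> r" "3 * d \<le> s" "d \<le> e / (4 * n * C)"
    using E(2) C e n by (auto simp: d_def)
  show ?thesis
  proof (rule that[OF d(1)]; (intro ballI)?)
    show "d \<le> r" using d by linarith
    fix x y :: "complex^'n" assume xy: "x \<in> ball 0 d" "y \<in> ball 0 d"
    have in_ball: "norm w \<le> 2 * d" if "z \<in> ball 0 d" "w \<in> cball z d" for z w :: "complex^'n"
      using that dist_triangle[of 0 w z] by simp
    have "norm (E x - E y) \<le> real CARD('m) * (C * (2 * d) ^ 2 / d) * norm (x - y)"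
    proof (rule lipschitz_holo_map[OF E(1) d(1) convex_ball _ _ xy])
      fix z :: "complex^'n" assume z: "z \<in> ball 0 d"
      show "cball z d \<subseteq> ball 0 r" using in_ball[OF z] d by force
      fix w assume w: "w \<in> cball z d"
      have "norm (E w) \<le> C * norm w ^ 2" using C(3) in_ball[OF z w] d by simp
      also have "\<dots> \<le> C * (2 * d) ^ 2" using in_ball[OF z w] C by (intro mult_left_mono power_mono) auto
      finally show "norm (E w) \<le> C * (2 * d) ^ 2" .
    qed
    also have "real CARD('m) * (C * (2 * d) ^ 2 / d) = d * (4 * n * C)"
      using d by (simp add: n_def power2_eq_square)
    also have "\<dots> * norm (x - y) \<le> e * norm (x - y)"
      using d(4) n C by (intro mult_right_mono) (auto simp: pos_le_divide_eq)
    finally show "norm (E x - E y) \<le> e * norm (x - y)" .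
  qed
qed

text \<open>Along the ray \<open>z + t v\<close> the linear term dominates as \<open>t\<close> tends
  to 0. The purpose is that a map which expands distances from \<open>z\<close> by a positive factor
  has an injective derivative there.\<close>

lemma derivative_lower_bound:
  fixes f :: "'a::real_normed_vector \<Rightarrow> 'b::real_normed_vector"
  assumes D: "(f has_derivative D) (at z)" and S: "open S" "z \<in> S"
    and le: "\<And>x. x \<in> S \<Longrightarrow> c * norm (x - z) \<le> norm (f x - f z)"
  shows "c * norm v \<le> norm (D v)"
proof -
  have "c * norm v \<le> norm (D v) + e" if e: "0 < e" for e
  proof -
    define e' where "e' = e / (norm v + 1)"
    have nv: "0 < norm v + 1" by (simp add: add_nonneg_pos)
    have e': "0 < e'" "e' * norm v \<le> e" using e nv by (simp_all add: e'_def field_simps)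
    obtain d where d: "0 < d" "\<And>y. norm (y - z) < d \<Longrightarrow> norm (f y - f z - D (y - z)) \<le> e' * norm (y - z)"
      using D e' unfolding has_derivative_at_alt by blast
    obtain s where s: "0 < s" "ball z s \<subseteq> S" using S open_contains_ball by blast
    define t where "t = min (d / 2) (s / 2) / (norm v + 1)"
    have t: "0 < t" "t * (norm v + 1) < d" "t * (norm v + 1) < s" using d s nv by (simp_all add: t_def)
    have tn: "norm ((z + t *\<^sub>R v) - z) = t * norm v" "t * norm v \<le> t * (norm v + 1)" using t by simp_all
    have "z + t *\<^sub>R v \<in> ball z s" using t by (simp add: dist_norm distrib_left)
    then have "c * (t * norm v) \<le> norm (f (z + t *\<^sub>R v) - f z)" using le[of "z + t *\<^sub>R v"] s tn by auto
    moreover have "norm (f (z + t *\<^sub>R v) - f z - D (t *\<^sub>R v)) \<le> e' * (t * norm v)"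
      using d(2)[of "z + t *\<^sub>R v"] t by (simp add: distrib_left)
    moreover have "norm (f (z + t *\<^sub>R v) - f z) \<le> norm (D (t *\<^sub>R v)) + norm (f (z + t *\<^sub>R v) - f z - D (t *\<^sub>R v))"
      using norm_triangle_ineq[of "D (t *\<^sub>R v)" "f (z + t *\<^sub>R v) - f z - D (t *\<^sub>R v)"] by simp
    moreover have "norm (D (t *\<^sub>R v)) = t * norm (D v)"
      using has_derivative_linear[OF D] t by (simp add: linear_scale)
    ultimately have "t * (c * norm v) \<le> t * (norm (D v) + e' * norm v)" by (simp add: algebra_simps)
    then have "c * norm v \<le> norm (D v) + e' * norm v" using t by simp
    then show ?thesis using e' by linarith
  qed
  then show ?thesis by (rule field_le_epsilon)
qed

text \<open>Invariance of domain supplies openness and the continuity of the inverse. An injective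
  derivative then makes the inverse differentiable, and the inverse of a complex linear map is
  complex linear.\<close>

lemma holo_map_inverse:
  fixes F :: "complex^'n::finite \<Rightarrow> complex^'n"
  assumes S: "open S" and F: "holo_map F S" and inj: "inj_on F S"
    and D: "\<And>z D. z \<in> S \<Longrightarrow> (F has_derivative D) (at z) \<Longrightarrow> inj D"
  shows "open (F ` S)" "holo_map (inv_into S F) (F ` S)"
proof -
  have cont: "continuous_on S F" by (rule holo_map_continuous_on[OF F])
  show op: "open (F ` S)" by (rule invariance_of_domain[OF cont S inj])
  obtain g where g: "homeomorphism S (F ` S) F g"
    using invariance_of_domain_homeomorphism[OF S cont _ inj] by auto
  have "continuous_on (F ` S) (inv_into S F)"
    by (rule continuous_on_eq[of _ g]) (use g inj in \<open>auto simp: homeomorphism_def inv_into_f_f\<close>)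
  then have cont_inv: "continuous (at y) (inv_into S F)" if "y \<in> F ` S" for y
    using that op continuous_on_eq_continuous_at by blast
  show "holo_map (inv_into S F) (F ` S)"
    unfolding holo_map_iff
  proof
    fix y assume y: "y \<in> F ` S"
    define z where "z = inv_into S F y"
    have z: "z \<in> S" "F z = y" using y by (auto simp: z_def inv_into_into f_inv_into_f)
    obtain D where D1: "(F has_derivative D) (at z)" "\<And>c v. D (c *s v) = c *s D v"
      using F z unfolding holo_map_iff by blast
    have lin: "linear D" by (rule has_derivative_linear[OF D1(1)])
    have iD: "inj D" by (rule D[OF z(1) D1(1)])
    then have sD: "surj D" by (rule eucl.linear_inj_imp_surj[OF lin])
    obtain D' where D': "linear D'" "D' \<circ> D = id"
      using linear_injective_left_inverse[OF lin iD] by blast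
    have D'D: "D' (D v) = v" for v using D'(2) by (simp add: fun_eq_iff)
    have DD': "D (D' v) = v" for v using sD D'D by (metis surj_def)
    have "D (D' (c *s v)) = D (c *s D' v)" for c v by (simp add: DD' D1(2))
    then have "D' (c *s v) = c *s D' v" for c v using injD[OF iD] by blast
    moreover have "(inv_into S F has_derivative D') (at y)"
    proof (rule has_derivative_inverse_basic[where f = F and f' = D and T = "F ` S"])
      show "(F has_derivative D) (at (inv_into S F y))" using D1(1) by (simp add: z_def)
      show "bounded_linear D'" using D'(1) by (simp add: linear_conv_bounded_linear)
      show "continuous (at y) (inv_into S F)" by (rule cont_inv[OF y])
    qed (use D' y op in \<open>auto simp: f_inv_into_f\<close>)
    ultimately show "\<exists>D. (inv_into S F has_derivative D) (at y) \<and> (\<forall>c v. D (c *s v) = c *s D v)" by blast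
  qed
qed

text \<open>\<open>F - id\<close> has Lipschitz constant 1/2 near the origin, so \<open>F\<close>
  shrinks distances at most by the factor 1/2. This gives injectivity of \<open>F\<close> and of its
  derivatives at once.\<close>

lemma holo_map_near_identity:
  fixes F :: "complex^'n::finite \<Rightarrow> complex^'n"
  assumes F: "holo_map F (ball 0 r)" "0 < r" "vanishes_to_order 2 (\<lambda>z. F z - z)"
  obtains d where "0 < d" "d \<le> r" "inj_on F (ball 0 d)" "open (F ` ball 0 d)"
    "holo_map (inv_into (ball 0 d) F) (F ` ball 0 d)"
proof -
  have "holo_map (\<lambda>z. F z - z) (ball 0 r)"
    using F(1) by (simp add: holo_map_def holo_fun_diff holo_fun_nth)
  then obtain d where d: "0 < d" "d \<le> r"
    and lip: "\<forall>x\<in>ball 0 d. \<forall>y\<in>ball 0 d. norm ((F x - x) - (F y - y)) \<le> (1/2) * norm (x - y)"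
    by (rule small_lipschitz[OF _ F(2,3), of "1/2"]) simp_all
  have lower: "(1/2) * norm (x - y) \<le> norm (F x - F y)" if "x \<in> ball 0 d" "y \<in> ball 0 d" for x y
  proof -
    have "norm (x - y) \<le> norm (F x - F y) + norm ((F x - x) - (F y - y))"
      using norm_triangle_ineq4[of "F x - F y" "(F x - x) - (F y - y)"] by (simp add: algebra_simps)
    then show ?thesis using lip[rule_format, OF that] by linarith
  qed
  have inj: "inj_on F (ball 0 d)"
  proof (rule inj_onI)
    fix x y assume "x \<in> ball 0 d" "y \<in> ball 0 d" "F x = F y"
    then show "x = y" using lower[of x y] by simp
  qed
  have Fd: "holo_map F (ball 0 d)" by (rule holo_map_subset[OF F(1)]) (use d in auto)
  have D: "inj D" if "z \<in> ball 0 d" "(F has_derivative D) (at z)" for z D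
  proof -
    have "(1/2) * norm v \<le> norm (D v)" for v
      by (rule derivative_lower_bound[OF that(2) open_ball that(1)]) (rule lower[OF _ that(1)])
    have "v = 0" if "D v = 0" for v using \<open>\<And>v. (1/2) * norm v \<le> norm (D v)\<close>[of v] that by simp
    then show ?thesis using has_derivative_linear[OF that(2)] by (simp add: linear_injective_0)
  qed
  show ?thesis
    by (rule that[OF d inj]) (use holo_map_inverse[OF open_ball Fd inj D] in auto)
qed

text \<open>\<open>\<Psi>\<close> is the limit of \<open>H\<^sup>k \<circ> F\<^sup>k\<close>; the high order of contact of \<open>H \<circ> F\<close> with the identity beats the
  expansion of \<open>H\<close>.\<close>

lemma conjugation_limit:
  fixes F H :: "complex^'n::finite \<Rightarrow> complex^'n"
  assumes F: "holo_map F (ball 0 r)" "0 < r" "\<And>z. z \<in> ball 0 r \<Longrightarrow> norm (F z) \<le> a * norm z" "0 < a" "a < 1"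
    and H: "holo_map H UNIV" "0 < d" "\<And>x y. x \<in> ball 0 d \<Longrightarrow> y \<in> ball 0 d \<Longrightarrow> norm (H x - H y) \<le> b * norm (x - y)"
    and b: "0 < b" "b * a ^ m < 1" and m: "2 \<le> m" and HF: "vanishes_to_order m (\<lambda>z. H (F z) - z)"
  obtains \<rho> and \<Psi> :: "complex^'n \<Rightarrow> complex^'n" where "0 < \<rho>" "\<rho> \<le> r" "holo_map \<Psi> (ball 0 \<rho>)" "\<forall>z\<in>ball 0 \<rho>. \<Psi> z = H (\<Psi> (F z))"
    "vanishes_to_order 2 (\<lambda>z. \<Psi> z - z)"
proof -
  obtain C s where C: "0 < C" "0 < s" "\<And>z. norm z < s \<Longrightarrow> norm (H (F z) - z) \<le> C * norm z ^ m"
    using vanishes_to_orderE_ball[OF HF] by metis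
  define q where "q = b * a ^ m"
  have q: "0 < q" "q < 1" using b F(4) by (auto simp: q_def)
  \<comment> \<open>\<open>K\<close> is the fixed point of \<open>K \<mapsto> q * K + C\<close>, so
    that the bound \<open>norm (P k z - z) \<le> K * norm z ^ m\<close> reproduces itself under the
    recursion.\<close>
  define K where "K = C / (1 - q)"
  have K: "0 < K" "q * K + C = K" using C q by (auto simp: K_def field_simps)
  \<comment> \<open>\<open>\<rho> * (1 + K) \<le> d\<close> keeps every \<open>P k z\<close> in the
    ball where \<open>H\<close> is Lipschitz with constant \<open>b\<close>, and
    \<open>\<rho> \<le> 1\<close> allows \<open>norm z ^ m\<close> to be replaced by
    \<open>norm z\<close>.\<close>
  define \<rho> where "\<rho> = min (min r s) (min 1 (d / (1 + K)))"
  have \<rho>: "0 < \<rho>" "\<rho> \<le> r" "\<rho> \<le> s" "\<rho> \<le> 1" "\<rho> \<le> d / (1 + K)"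
    using F(2) C H(2) K by (auto simp: \<rho>_def)
  have \<rho>d: "\<rho> * (1 + K) \<le> d" using \<rho>(5) K by (simp add: pos_le_divide_eq)
  have Fb: "F z \<in> ball 0 \<rho>" and Fa: "norm (F z) \<le> a * norm z" if "z \<in> ball 0 \<rho>" for z
  proof -
    show le: "norm (F z) \<le> a * norm z" using F(3) that \<rho> by auto
    have "a * norm z \<le> 1 * norm z" using F(5) by (intro mult_right_mono) auto
    then show "F z \<in> ball 0 \<rho>" using le that by simp
  qed
  \<comment> \<open>The recursion splits off the innermost \<open>F\<close>. The induction
    hypothesis is thus used at \<open>F z\<close>, where it gains \<open>a ^ m\<close> against the
    loss \<open>b\<close> from applying \<open>H\<close>.\<close>
  define P where "P = rec_nat (\<lambda>z. z) (\<lambda>_ p z. H (p (F z)))"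
  have P0: "P 0 z = z" and PS: "P (Suc k) z = H (P k (F z))" for k z by (simp_all add: P_def)
  have am: "(a * norm z) ^ m = a ^ m * norm z ^ m" for z :: "complex^'n" by (rule power_mult_distrib)
  have Pm: "norm (z :: complex^'n) ^ m \<le> norm z" if "z \<in> ball 0 \<rho>" for z
    using power_decreasing[of 1 m "norm z"] that \<rho> m by simp
  have in_d: "x \<in> ball 0 d" if "z \<in> ball 0 \<rho>" "norm (x - z) \<le> K * norm z ^ m" for x z :: "complex^'n"
  proof -
    have "norm x \<le> norm z + norm (x - z)" using norm_triangle_ineq[of z "x - z"] by simp
    also have "\<dots> \<le> norm z + K * norm z" using that Pm[OF that(1)] K mult_left_mono[OF Pm[OF that(1)], of K] by linarith
    also have "\<dots> = norm z * (1 + K)" by (simp add: algebra_simps)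
    also have "\<dots> < \<rho> * (1 + K)" using that K by (intro mult_strict_right_mono) auto
    finally show ?thesis using \<rho>d by simp
  qed
  have Pid: "norm (P k z - z) \<le> K * norm z ^ m" if "z \<in> ball 0 \<rho>" for k z
    using that
  proof (induction k arbitrary: z)
    case 0
    then show ?case using K by (simp add: P0)
  next
    case (Suc k)
    have IH: "norm (P k (F z) - F z) \<le> K * norm (F z) ^ m" by (rule Suc.IH[OF Fb[OF Suc.prems]])
    have "norm (H (P k (F z)) - H (F z)) \<le> b * norm (P k (F z) - F z)"
      by (rule H(3)[OF in_d[OF Fb[OF Suc.prems] IH] in_d[OF Fb[OF Suc.prems]]]) (use K in simp)
    also have "\<dots> \<le> b * (K * norm (F z) ^ m)" using b IH by (intro mult_left_mono) auto
    also have "\<dots> \<le> b * (K * (a * norm z) ^ m)"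
      using b K Fa[OF Suc.prems] by (intro mult_left_mono power_mono) auto
    also have "\<dots> = q * K * norm z ^ m" by (simp add: am q_def)
    finally have "norm (H (P k (F z)) - H (F z)) \<le> q * K * norm z ^ m" .
    moreover have "norm (H (F z) - z) \<le> C * norm z ^ m" using C(3) Suc.prems \<rho> by simp
    ultimately have "norm (P (Suc k) z - z) \<le> q * K * norm z ^ m + C * norm z ^ m"
      using norm_triangle_ineq[of "H (P k (F z)) - H (F z)" "H (F z) - z"] by (simp add: PS)
    then show ?case by (simp only: K(2) flip: distrib_right)
  qed
  have step: "norm (P (Suc k) z - P k z) \<le> C * q ^ k * norm z ^ m" if "z \<in> ball 0 \<rho>" for k z
    using that
  proof (induction k arbitrary: z)
    case 0
    then show ?case using C(3) \<rho> by (simp add: P0 PS)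
  next
    case (Suc k)
    have "norm (H (P (Suc k) (F z)) - H (P k (F z))) \<le> b * norm (P (Suc k) (F z) - P k (F z))"
      by (rule H(3)) (rule in_d[OF Fb[OF Suc.prems] Pid[OF Fb[OF Suc.prems]]])+
    also have "\<dots> \<le> b * (C * q ^ k * norm (F z) ^ m)"
      using b Suc.IH[OF Fb[OF Suc.prems]] by (intro mult_left_mono) auto
    also have "\<dots> \<le> b * (C * q ^ k * (a * norm z) ^ m)"
      using b C q Fa[OF Suc.prems] by (intro mult_left_mono power_mono) auto
    also have "\<dots> = C * q ^ Suc k * norm z ^ m" by (simp add: am q_def)
    finally show ?case by (simp only: PS)
  qed
  define \<Psi> where "\<Psi> z = z + (\<Sum>j. P (Suc j) z - P j z)" for z
  have tail: "norm (\<Psi> z - P k z) \<le> C * q ^ k / (1 - q)" if z: "z \<in> ball 0 \<rho>" for k z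
  proof -
    have nz: "norm z ^ m \<le> 1" using z \<rho> by (intro power_le_one) auto
    have le: "norm (P (Suc j) z - P j z) \<le> C * q ^ j" for j
    proof -
      have "C * q ^ j * norm z ^ m \<le> C * q ^ j * 1" using nz C q by (intro mult_left_mono) auto
      then show ?thesis using step[OF z, of j] by linarith
    qed
    have geo: "(\<lambda>j. C * q ^ (j + k)) sums (C * q ^ k * (1 / (1 - q)))"
      using sums_mult[OF geometric_sums[of q], of "C * q ^ k"] q by (simp add: power_add mult_ac)
    have sm: "summable (\<lambda>j. P (Suc j) z - P j z)"
      by (rule summable_comparison_test'[where g = "\<lambda>j. C * q ^ j" and N = 0])
         (use le q in \<open>auto intro!: summable_mult summable_geometric\<close>)
    have "(\<Sum>j<k. P (Suc j) z - P j z) = P k z - z" using sum_lessThan_telescope[of "\<lambda>j. P j z" k] by (simp add: P0)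
    then have "\<Psi> z - P k z = (\<Sum>j. P (Suc (j + k)) z - P (j + k) z)"
      using suminf_split_initial_segment[OF sm, of k] by (simp add: \<Psi>_def algebra_simps)
    also have "norm \<dots> \<le> (\<Sum>j. C * q ^ (j + k))"
      by (rule norm_suminf_le) (use le geo in \<open>auto simp: sums_iff\<close>)
    also have "\<dots> = C * q ^ k / (1 - q)" using geo by (simp add: sums_iff)
    finally show ?thesis .
  qed
  have bound0: "(\<lambda>k. C * q ^ k / (1 - q)) \<longlonglongrightarrow> 0"
  proof -
    have "(\<lambda>k. C * q ^ k / (1 - q)) \<longlonglongrightarrow> C * 0 / (1 - q)"
      using q by (intro tendsto_intros LIMSEQ_realpow_zero) auto
    then show ?thesis by simp
  qed
  have lim: "(\<lambda>k. P k z) \<longlonglongrightarrow> \<Psi> z" if z: "z \<in> ball 0 \<rho>" for z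
  proof (rule LIM_zero_cancel, rule Lim_null_comparison[OF _ bound0])
    show "\<forall>\<^sub>F k in sequentially. norm (P k z - \<Psi> z) \<le> C * q ^ k / (1 - q)"
      using tail[OF z] by (intro always_eventually) (simp add: norm_minus_commute)
  qed
  have hP: "holo_map (P k) (ball 0 \<rho>)" for k
  proof (induction k)
    case 0
    then show ?case using holo_map_id by (simp add: P_def)
  next
    case (Suc k)
    have "holo_map (\<lambda>z. P k (F z)) (ball 0 \<rho>)"
      by (rule holo_map_compose[OF holo_map_subset[OF F(1)] Suc Fb]) (use \<rho> in auto)
    then show ?case using holo_map_compose[OF _ H(1)] by (simp add: PS[abs_def])
  qed
  show ?thesis
  proof (rule that[OF \<rho>(1,2)]; (intro ballI)?)
    show "holo_map \<Psi> (ball 0 \<rho>)"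
      unfolding holo_map_def
    proof (intro allI holo_fun_uniform_approx open_ball)
      fix i and e :: real assume "0 < e"
      with bound0 have "\<forall>\<^sub>F k in sequentially. C * q ^ k / (1 - q) < e" by (rule order_tendstoD)
      then obtain k where k: "C * q ^ k / (1 - q) < e" by (auto simp: eventually_sequentially)
      have "norm (P k z $ i - \<Psi> z $ i) \<le> e" if "z \<in> ball 0 \<rho>" for z
        using Finite_Cartesian_Product.norm_nth_le[of "\<Psi> z - P k z" i] tail[OF that, of k] k
        by (simp add: norm_minus_commute)
      then show "\<exists>g. holo_fun g (ball 0 \<rho>) \<and> (\<forall>z\<in>ball 0 \<rho>. norm (g z - \<Psi> z $ i) \<le> e)"
        using hP[of k] by (intro exI[of _ "\<lambda>z. P k z $ i"]) (simp add: holo_map_def)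
    qed
    show "\<Psi> z = H (\<Psi> (F z))" if z: "z \<in> ball 0 \<rho>" for z
    proof (rule LIMSEQ_unique)
      show "(\<lambda>k. P (Suc k) z) \<longlonglongrightarrow> \<Psi> z" using lim[OF z] by (rule LIMSEQ_Suc)
      have "isCont H (\<Psi> (F z))"
        using holo_map_continuous_on[OF H(1)] by (simp add: continuous_on_eq_continuous_at)
      then show "(\<lambda>k. P (Suc k) z) \<longlonglongrightarrow> H (\<Psi> (F z))"
        unfolding PS by (rule isCont_tendsto_compose[OF _ lim[OF Fb[OF z]]])
    qed
    have "vanishes_to_order m (\<lambda>z. \<Psi> z - z)"
    proof (rule vanishes_to_orderI[OF \<rho>(1)])
      fix z :: "complex^'n" assume "norm z < \<rho>"
      then have z: "z \<in> ball 0 \<rho>" by simp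
      have "(\<lambda>k. norm (P k z - z)) \<longlonglongrightarrow> norm (\<Psi> z - z)" by (intro tendsto_intros lim[OF z])
      then show "norm (\<Psi> z - z) \<le> K * norm z ^ m"
        by (rule tendsto_upperbound) (use Pid[OF z] in auto)
    qed
    then show "vanishes_to_order 2 (\<lambda>z. \<Psi> z - z)" by (rule vanishes_to_order_mono[OF _ m])
  qed
qed

lemma holo_map_linear:
  assumes "linear D" "\<And>c v. D (c *s v) = c *s D v"
  shows "holo_map (D :: complex^'n::finite \<Rightarrow> complex^'m::finite) S"
  unfolding holo_map_iff
  using assms by (auto intro!: exI[of _ D] bounded_linear_imp_has_derivative simp: linear_conv_bounded_linear)

theorem contraction_conjugacy:
  fixes F :: "complex^'n::finite \<Rightarrow> complex^'n"
  assumes n: "2 \<le> CARD('n)"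
    and F: "holo_map F (ball 0 r)" "0 < r" "\<And>z. z \<in> ball 0 r \<Longrightarrow> norm (F z) \<le> a * norm z" "0 < a" "a < 1"
    and D: "(F has_derivative D) (at 0)" "inj D"
  obtains G H \<Psi> :: "complex^'n \<Rightarrow> complex^'n" and \<rho> where "aut_pair G H" "0 < \<rho>" "\<rho> \<le> r" "holo_map \<Psi> (ball 0 \<rho>)"
    "\<forall>z\<in>ball 0 \<rho>. \<Psi> z = H (\<Psi> (F z))" "inj_on \<Psi> (ball 0 \<rho>)" "open (\<Psi> ` ball 0 \<rho>)"
    "holo_map (inv_into (ball 0 \<rho>) \<Psi>) (\<Psi> ` ball 0 \<rho>)" "\<Psi> 0 = 0"
proof -
  have F0: "F 0 = 0" using F(3)[of 0] F(2) by simp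
  have Dc: "D (c *s v) = c *s D v" for c v
  proof -
    obtain E where "(F has_derivative E) (at 0)" "\<And>c v. E (c *s v) = c *s E v"
      using F(1,2) unfolding holo_map_iff by (metis centre_in_ball)
    then show ?thesis using has_derivative_unique[OF D(1)] by metis
  qed
  have lin: "linear D" by (rule has_derivative_linear[OF D(1)])
  then have surj: "surj D" by (rule eucl.linear_inj_imp_surj[OF _ D(2)])
  obtain L where L: "linear L" "L \<circ> D = id"
    using linear_injective_left_inverse[OF lin D(2)] by blast
  have LD: "L (D v) = v" for v using L(2) by (simp add: fun_eq_iff)
  have DL: "D (L v) = v" for v using surj LD by (metis surj_def)
  have "D (L (c *s v)) = D (c *s L v)" for c v by (simp add: DL Dc)
  then have Lc: "L (c *s v) = c *s L v" for c v using injD[OF D(2)] by blast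
  have aut: "aut_pair D L"
    unfolding aut_pair_def using LD DL linear_0[OF lin] holo_map_linear lin L(1) Dc Lc by blast
  have ord: "vanishes_to_order 2 (\<lambda>z. F z - D z)"
  proof -
    have Fi: "holo_fun (\<lambda>z. F z $ i) (ball 0 r)" for i using F(1) by (simp add: holo_map_def)
    have "\<exists>K. \<forall>z. norm z \<le> r / 4 \<longrightarrow> norm ((F z - D z) $ i) \<le> K * norm z ^ 2" for i
    proof -
      obtain K where K: "0 < K" "\<And>z. norm z \<le> r / 4 \<Longrightarrow>
          norm (F z $ i - (\<Sum>j<2. hpart (\<lambda>z. F z $ i) j z)) \<le> K * norm z ^ 2"
        using hpart_tail[OF Fi F(2)] by metis
      have "hpart (\<lambda>z. F z $ i) 1 z = D z $ i" for z
      proof -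
        have "((\<lambda>z. F z $ i) has_derivative (\<lambda>v. D v $ i)) (at 0)"
          by (rule bounded_linear.has_derivative[OF bounded_linear_vec_nth D(1)])
        from dirder_eq[OF this, of z] show ?thesis by (simp add: Dc hpart_def dirder_def)
      qed
      moreover have "hpart (\<lambda>z. F z $ i) 0 z = 0" for z by (simp add: hpart_def F0)
      ultimately have "(\<Sum>j<2. hpart (\<lambda>z. F z $ i) j z) = D z $ i" for z by (simp add: numeral_2_eq_2)
      then show ?thesis using K(2) by auto
    qed
    then obtain K where "\<And>i z. norm z \<le> r / 4 \<Longrightarrow> norm ((F z - D z) $ i) \<le> K i * norm z ^ 2" by metis
    then show ?thesis by (intro vanishes_to_order_componentwise[of "r / 4" _ K]) (use F(2) in auto)
  qed
  obtain B where B: "0 < B" "\<And>v. norm (L v) \<le> norm v * B"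
    using L(1) by (auto simp: linear_conv_bounded_linear dest: bounded_linear.pos_bounded)
  \<comment> \<open>The order of contact must be chosen from a Lipschitz constant of
    \<open>H\<close> before \<open>H\<close> is known. This is not circular, since \<open>b\<close>
    depends on the linear part only: \<open>B\<close> bounds \<open>L\<close>, and the added 1
    covers \<open>H - L\<close>, which vanishes to second order and so has Lipschitz constant 1 on a
    small ball.\<close>
  define b where "b = B + 1"
  have "(\<lambda>k. b * a ^ k) \<longlonglongrightarrow> b * 0" using F(4,5) by (intro tendsto_intros LIMSEQ_realpow_zero) auto
  then have "\<forall>\<^sub>F k in sequentially. b * a ^ k < 1" by (intro order_tendstoD(2)[of _ "b * 0"]) auto
  then obtain k where "\<And>j. k \<le> j \<Longrightarrow> b * a ^ j < 1" by (auto simp: eventually_sequentially)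
  then have ba: "b * a ^ Suc (Suc k) < 1" by (metis le_SucI order_refl)
  obtain G H where G: "aut_pair G H" "vanishes_to_order (Suc (Suc k)) (\<lambda>z. H (F z) - z)"
    "vanishes_to_order 2 (\<lambda>z. H z - L z)"
    using jet_realization[OF n F(1,2) F0 aut ord, of "Suc k"] by auto
  have H: "holo_map H UNIV" using G(1) by (simp add: aut_pair_def)
  have "holo_map (\<lambda>z. H z - L z) (ball 0 1)"
    using holo_map_subset[OF H, of "ball 0 1"] holo_map_linear[OF L(1) Lc]
    by (simp add: holo_map_def holo_fun_diff)
  then obtain d where d: "0 < d"
    "\<forall>x\<in>ball 0 d. \<forall>y\<in>ball 0 d. norm ((H x - L x) - (H y - L y)) \<le> 1 * norm (x - y)"
    by (rule small_lipschitz[OF _ _ G(3), of 1 1]) simp_all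
  have lipH: "norm (H x - H y) \<le> b * norm (x - y)" if "x \<in> ball 0 d" "y \<in> ball 0 d" for x y
  proof -
    have "H x - H y = ((H x - L x) - (H y - L y)) + L (x - y)" using L(1) by (simp add: linear_diff)
    then have "norm (H x - H y) \<le> norm ((H x - L x) - (H y - L y)) + norm (L (x - y))"
      by (metis norm_triangle_ineq)
    also have "\<dots> \<le> 1 * norm (x - y) + norm (x - y) * B" using d(2)[rule_format, OF that] B(2) by (rule add_mono)
    finally show ?thesis by (simp add: b_def algebra_simps)
  qed
  have b0: "0 < b" using B by (simp add: b_def)
  have m2: "2 \<le> Suc (Suc k)" by simp
  obtain \<rho> \<Psi> where \<Psi>: "0 < \<rho>" "\<rho> \<le> r" "holo_map \<Psi> (ball 0 \<rho>)"
    "\<forall>z\<in>ball 0 \<rho>. \<Psi> z = H (\<Psi> (F z))" "vanishes_to_order 2 (\<lambda>z. \<Psi> z - z)"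
    by (rule conjugation_limit[OF F H d(1) lipH b0 ba m2 G(2)])
  obtain e where e: "0 < e" "e \<le> \<rho>" "inj_on \<Psi> (ball 0 e)" "open (\<Psi> ` ball 0 e)"
    "holo_map (inv_into (ball 0 e) \<Psi>) (\<Psi> ` ball 0 e)"
    by (rule holo_map_near_identity[OF \<Psi>(3,1,5)])
  have "\<Psi> 0 = 0"
  proof -
    obtain C s where C: "0 < s" "\<And>z. norm z < s \<Longrightarrow> norm (\<Psi> z - z) \<le> C * norm z ^ 2"
      using vanishes_to_orderE_ball[OF \<Psi>(5)] by metis
    then show ?thesis using C(2)[of 0] by simp
  qed
  show ?thesis
  proof (rule that[OF G(1) e(1) _ _ _ e(3-5) \<open>\<Psi> 0 = 0\<close>])
    show "e \<le> r" using e \<Psi> by linarith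
    show "holo_map \<Psi> (ball 0 e)" by (rule holo_map_subset[OF \<Psi>(3)]) (use e in auto)
    show "\<forall>z\<in>ball 0 e. \<Psi> z = H (\<Psi> (F z))" using \<Psi>(4) e by auto
  qed
qed


section \<open>Lie series\<close>

definition lie :: "(complex^'n::finite \<Rightarrow> complex^'n) \<Rightarrow> (complex^'n \<Rightarrow> complex) \<Rightarrow> complex^'n \<Rightarrow> complex" where
  "lie W f z = dirder f (W z) z"

lemma holo_fun_lie:
  assumes "open S" "holo_map W S" "holo_fun f S"
  shows "holo_fun (lie W f) S"
proof -
  have "holo_fun (\<lambda>z. \<Sum>j\<in>UNIV. W z $ j * dirder f (axis j 1) z) S"
    using assms by (intro holo_fun_sum holo_fun_mult holo_fun_dirder) (auto simp: holo_map_def)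
  then show ?thesis
    using holo_fun_cong[OF assms(1), of "lie W f" "\<lambda>z. \<Sum>j\<in>UNIV. W z $ j * dirder f (axis j 1) z"]
      dirder_axis[OF assms(3)] by (simp add: lie_def)
qed

text \<open>A single term of the exponential series at \<open>k\<close>. It turns the factor
  \<open>k ^ k\<close>, which \<open>k\<close> nested Cauchy estimates produce, into geometric
  growth times a factorial.\<close>

lemma self_power_le_exp_fact: "real k ^ k \<le> exp 1 ^ k * fact k"
proof -
  have "(\<Sum>n\<in>{k}. real k ^ n /\<^sub>R fact n) \<le> (\<Sum>n. real k ^ n /\<^sub>R fact n)"
    by (rule sum_le_suminf) (use summable_exp_generic[of "real k"] in auto)
  then have "real k ^ k / fact k \<le> exp (real k)" by (simp add: exp_def divide_inverse mult.commute)
  then show ?thesis by (simp add: pos_divide_le_eq flip: exp_of_nat_mult)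
qed

text \<open>The reciprocal is a lower bound for the radius of convergence of the Lie series on the
  ball of half radius. The factor 2 comes from halving the radius, and \<open>exp 1\<close> from the
  comparison of \<open>k ^ k\<close> with the factorial.\<close>

definition flow_rate :: "real \<Rightarrow> real \<Rightarrow> real" where
  "flow_rate R M = 2 * exp 1 * M / R"

text \<open>The series of \<open>exp (\<tau> W) f\<close>: formally the value of \<open>f\<close> at
  the point that the flow of \<open>W\<close> reaches from \<open>z\<close> at time
  \<open>\<tau>\<close>.\<close>

definition flow_series ::
    "(complex^'n::finite \<Rightarrow> complex^'n) \<Rightarrow> (complex^'n \<Rightarrow> complex) \<Rightarrow> complex^'n \<Rightarrow> complex \<Rightarrow> complex" where
  "flow_series W f z \<tau> = (\<Sum>k. (lie W ^^ k) f z / fact k * \<tau> ^ k)"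

context
  fixes W :: "complex^'n::finite \<Rightarrow> complex^'n" and f :: "complex^'n \<Rightarrow> complex" and a :: "complex^'n" and R M C :: real
  assumes R: "0 < R" and M: "0 < M" and W: "holo_map W (ball a R)" and f: "holo_fun f (ball a R)"
    and Wb: "\<And>z. z \<in> ball a R \<Longrightarrow> norm (W z) \<le> M" and fb: "\<And>z. z \<in> ball a R \<Longrightarrow> norm (f z) \<le> C"
begin

lemma holo_fun_lie_power: "holo_fun ((lie W ^^ k) f) (ball a R)"
  by (induction k) (auto intro: holo_fun_lie[OF open_ball W] f)

text \<open>Each Lie derivative is one Cauchy estimate on balls of radius \<open>d\<close>; it costs
  the factor \<open>M / d\<close> and shrinks the domain by \<open>d\<close>.\<close>

lemma lie_power_bound_aux:
  assumes d: "0 < d" and z: "z \<in> ball a (R - real j * d)"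
  shows "norm ((lie W ^^ j) f z) \<le> C * (M / d) ^ j"
  using z
proof (induction j arbitrary: z)
  case 0
  then show ?case using fb by simp
next
  case (Suc j)
  have sub: "w \<in> ball a (R - real j * d)" if "w \<in> cball z d" for w
    using Suc.prems that dist_triangle[of a w z] by (simp add: algebra_simps)
  have "ball a (R - real j * d) \<subseteq> ball a R" using d by (intro subset_ball) simp
  moreover have "z \<in> cball z d" using d by simp
  ultimately have zR: "z \<in> ball a R" "cball z d \<subseteq> ball a R" using sub by blast+
  have "norm (dirder ((lie W ^^ j) f) (W z) z) \<le> C * (M / d) ^ j / d * norm (W z)"
    by (rule cauchy_dirder[OF holo_fun_lie_power d zR(2)]) (rule Suc.IH[OF sub])
  also have "\<dots> \<le> C * (M / d) ^ j / d * M"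
  proof (rule mult_left_mono[OF Wb[OF zR(1)]])
    have "norm (f z) \<le> C" by (rule fb[OF zR(1)])
    then have "0 \<le> C" using norm_ge_zero order_trans by blast
    then show "0 \<le> C * (M / d) ^ j / d" using d M by simp
  qed
  finally show ?case by (simp add: lie_def[of W "(lie W ^^ j) f"] mult_ac)
qed

lemma flow_rate_pos: "0 < flow_rate R M" using R M by (simp add: flow_rate_def)

lemma C_nonneg: "0 \<le> C"
proof -
  have "norm (f a) \<le> C" using fb[of a] R by simp
  then show ?thesis using norm_ge_zero order_trans by blast
qed

lemma lie_power_bound:
  assumes z: "z \<in> ball a (R / 2)"
  shows "norm ((lie W ^^ k) f z) \<le> C * flow_rate R M ^ k * fact k"
proof (cases "k = 0")
  case True
  then show ?thesis using fb[of z] z R by simp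
next
  case False
  \<comment> \<open>The available loss of radius, \<open>R / 2\<close>, is shared equally among the
    \<open>k\<close> estimates.\<close>
  define d where "d = R / (2 * real k)"
  have d: "0 < d" "real k * d = R / 2" using False R by (auto simp: d_def)
  have "norm ((lie W ^^ k) f z) \<le> C * (M / d) ^ k"
    by (rule lie_power_bound_aux[OF d(1)]) (use z d in simp)
  also have "M / d = (2 * M / R) * real k" using False by (simp add: d_def)
  also have "C * ((2 * M / R) * real k) ^ k = C * (2 * M / R) ^ k * real k ^ k"
    by (simp only: power_mult_distrib mult.assoc)
  also have "\<dots> \<le> C * (2 * M / R) ^ k * (exp 1 ^ k * fact k)"
    using C_nonneg M R by (intro mult_left_mono self_power_le_exp_fact) auto
  also have "\<dots> = C * flow_rate R M ^ k * fact k"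
    by (simp add: flow_rate_def power_mult_distrib power_divide)
  finally show ?thesis .
qed

context
  fixes \<rho> :: real
  assumes \<rho>: "0 < \<rho>" "2 * flow_rate R M * \<rho> \<le> 1"
begin

lemma flow_series_term_bound:
  assumes "z \<in> ball a (R / 2)" "norm \<tau> \<le> \<rho>"
  shows "norm ((lie W ^^ k) f z / fact k * \<tau> ^ k) \<le> C * (1 / 2) ^ k"
proof -
  have "norm ((lie W ^^ k) f z / fact k * \<tau> ^ k) = norm ((lie W ^^ k) f z) / fact k * norm \<tau> ^ k"
    by (simp add: norm_mult norm_divide norm_power)
  also have "\<dots> \<le> (C * flow_rate R M ^ k * fact k) / fact k * \<rho> ^ k"
    using C_nonneg flow_rate_pos assms \<rho>
    by (intro mult_mono divide_right_mono power_mono lie_power_bound) auto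
  also have "\<dots> = C * (flow_rate R M * \<rho>) ^ k" by (simp add: power_mult_distrib)
  also have "\<dots> \<le> C * (1 / 2) ^ k"
    using C_nonneg flow_rate_pos \<rho> by (intro mult_left_mono power_mono) auto
  finally show ?thesis .
qed

lemma flow_series_sums:
  assumes "z \<in> ball a (R / 2)" "norm \<tau> \<le> \<rho>"
  shows "(\<lambda>k. (lie W ^^ k) f z / fact k * \<tau> ^ k) sums flow_series W f z \<tau>"
proof -
  have "summable (\<lambda>k. (lie W ^^ k) f z / fact k * \<tau> ^ k)"
    by (rule summable_comparison_test'[where g = "\<lambda>k. C * (1 / 2) ^ k" and N = 0])
       (use flow_series_term_bound[OF assms] in \<open>auto intro!: summable_mult summable_geometric\<close>)
  then show ?thesis by (simp add: flow_series_def summable_sums)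
qed

lemma flow_series_tail:
  assumes "z \<in> ball a (R / 2)" "norm \<tau> \<le> \<rho>"
  shows "norm (flow_series W f z \<tau> - (\<Sum>k<N. (lie W ^^ k) f z / fact k * \<tau> ^ k)) \<le> C * (1 / 2) ^ N * 2"
proof -
  have "(\<lambda>k. (lie W ^^ (k + N)) f z / fact (k + N) * \<tau> ^ (k + N)) sums
      (flow_series W f z \<tau> - (\<Sum>k<N. (lie W ^^ k) f z / fact k * \<tau> ^ k))"
    by (rule sums_split_initial_segment[OF flow_series_sums[OF assms]])
  then have e: "flow_series W f z \<tau> - (\<Sum>k<N. (lie W ^^ k) f z / fact k * \<tau> ^ k)
      = (\<Sum>k. (lie W ^^ (k + N)) f z / fact (k + N) * \<tau> ^ (k + N))" by (rule sums_unique)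
  have geo: "(\<lambda>k. C * (1 / 2) ^ (k + N)) sums (C * (1 / 2) ^ N * 2)"
    using sums_mult[OF geometric_sums[of "1/2 :: real"], of "C * (1 / 2) ^ N"] by (simp add: power_add mult_ac)
  have "norm (\<Sum>k. (lie W ^^ (k + N)) f z / fact (k + N) * \<tau> ^ (k + N)) \<le> (\<Sum>k. C * (1 / 2) ^ (k + N))"
    by (rule norm_suminf_le[OF flow_series_term_bound[OF assms]]) (use geo in \<open>simp add: sums_iff\<close>)
  also have "\<dots> = C * (1 / 2) ^ N * 2" using geo by (simp add: sums_iff)
  finally show ?thesis unfolding e .
qed

lemma flow_series_bound:
  assumes "z \<in> ball a (R / 2)" "norm \<tau> \<le> \<rho>"
  shows "norm (flow_series W f z \<tau>) \<le> 2 * C"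
  using flow_series_tail[OF assms, of 0] by simp

lemma flow_series_holomorphic_time:
  assumes "z \<in> ball a (R / 2)"
  shows "flow_series W f z holomorphic_on ball 0 \<rho>"
proof (rule power_series_holomorphic)
  fix \<tau> :: complex assume "\<tau> \<in> ball 0 \<rho>"
  then show "(\<lambda>k. (lie W ^^ k) f z / fact k * (\<tau> - 0) ^ k) sums flow_series W f z \<tau>"
    using flow_series_sums[OF assms, of \<tau>] by simp
qed

lemma flow_series_holomorphic_space:
  assumes "norm \<tau> \<le> \<rho>"
  shows "holo_fun (\<lambda>z. flow_series W f z \<tau>) (ball a (R / 2))"
proof (rule holo_fun_uniform_approx[OF open_ball])
  fix e :: real assume e: "0 < e"
  have "(\<lambda>N. C * (1 / 2 :: real) ^ N * 2) \<longlonglongrightarrow> C * 0 * 2"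
    by (intro tendsto_intros LIMSEQ_realpow_zero) auto
  then have "\<forall>\<^sub>F N in sequentially. C * (1 / 2) ^ N * 2 < e" using e by (intro order_tendstoD(2)) auto
  then obtain N where N: "C * (1 / 2) ^ N * 2 < e" by (auto simp: eventually_sequentially)
  have "holo_fun ((lie W ^^ k) f) (ball a (R / 2))" for k
    by (rule holo_fun_subset[OF holo_fun_lie_power]) (use R in auto)
  then have "holo_fun (\<lambda>z. \<Sum>k<N. (\<tau> ^ k / fact k) * (lie W ^^ k) f z) (ball a (R / 2))"
    by (intro holo_fun_sum holo_fun_cmult open_ball)
  moreover have "norm ((\<Sum>k<N. (\<tau> ^ k / fact k) * (lie W ^^ k) f z) - flow_series W f z \<tau>) \<le> e"
    if "z \<in> ball a (R / 2)" for z
    using flow_series_tail[OF that assms, of N] N by (simp add: norm_minus_commute mult.commute)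
  ultimately show "\<exists>g. holo_fun g (ball a (R / 2)) \<and> (\<forall>z\<in>ball a (R / 2). norm (g z - flow_series W f z \<tau>) \<le> e)"
    by blast
qed

text \<open>The derivatives of \<open>f \<circ> c\<close> are the iterated Lie derivatives along the
  curve, so Taylor's formula with integral remainder applies. The remainder is at most
  \<open>C * (p * x ^ p)\<close>, where the factor \<open>p\<close> is the quotient of
  \<open>fact p\<close> by \<open>fact (p - 1)\<close>, and it tends to 0 because
  \<open>x \<le> 1 / 2\<close>.\<close>

lemma flow_series_curve:
  assumes t: "0 \<le> t" "t \<le> \<rho>" and c: "\<And>s. 0 \<le> s \<Longrightarrow> s \<le> t \<Longrightarrow> c s \<in> ball a (R / 2)"
    and c': "\<And>s. 0 \<le> s \<Longrightarrow> s \<le> t \<Longrightarrow> (c has_vector_derivative W (c s)) (at s within {0..t})"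
  shows "f (c t) = flow_series W f (c 0) (of_real t)"
proof -
  define L where "L k s = (lie W ^^ k) f (c s)" for k s
  have L': "(L k has_vector_derivative L (Suc k) s) (at s within {0..t})" if s: "0 \<le> s" "s \<le> t" for k s
  proof -
    have "c s \<in> ball a R" using c[OF s] R by simp
    from has_derivative_dirder[OF holo_fun_lie_power this]
    have D: "((lie W ^^ k) f has_derivative (\<lambda>v. dirder ((lie W ^^ k) f) v (c s))) (at (c s))" .
    have "((\<lambda>s. (lie W ^^ k) f (c s)) has_derivative (\<lambda>h. dirder ((lie W ^^ k) f) (h *\<^sub>R W (c s)) (c s))) (at s within {0..t})"
      by (rule has_derivative_compose[OF c'[OF s, unfolded has_vector_derivative_def] D])
    moreover have "dirder ((lie W ^^ k) f) (h *\<^sub>R v) (c s) = h *\<^sub>R dirder ((lie W ^^ k) f) v (c s)" for h v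
      using linear_scale[OF has_derivative_linear[OF D]] by simp
    ultimately show ?thesis
      by (simp add: has_vector_derivative_def L_def[abs_def] lie_def[of W "(lie W ^^ k) f"])
  qed
  have Lb: "norm (L k s) \<le> C * flow_rate R M ^ k * fact k" if "0 \<le> s" "s \<le> t" for k s
    unfolding L_def by (rule lie_power_bound[OF c[OF that]])
  define x where "x = flow_rate R M * t"
  have "flow_rate R M * t \<le> flow_rate R M * \<rho>" using t flow_rate_pos by (intro mult_left_mono) auto
  then have "x \<le> 1 / 2" using \<rho>(2) unfolding x_def by linarith
  moreover have "0 \<le> x" using t flow_rate_pos by (simp add: x_def)
  ultimately have x: "0 \<le> x" "x \<le> 1 / 2" by auto
  have est: "norm (f (c t) - (\<Sum>i<p. (lie W ^^ i) f (c 0) / fact i * of_real t ^ i)) \<le> C * (real p * x ^ p)" if p: "0 < p" for p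
  proof -
    have int: "((\<lambda>s. ((t - s) ^ (p - 1) / fact (p - 1)) *\<^sub>R L p s) has_integral
        f (c t) - (\<Sum>i<p. ((t - 0) ^ i / fact i) *\<^sub>R L i 0)) {0..t}"
    proof (rule Taylor_has_integral[OF p _ _ t(1)])
      show "L 0 = (\<lambda>s. f (c s))" by (simp add: L_def[abs_def])
    qed (rule L')
    have "norm (f (c t) - (\<Sum>i<p. ((t - 0) ^ i / fact i) *\<^sub>R L i 0))
        \<le> (t ^ (p - 1) / fact (p - 1) * (C * flow_rate R M ^ p * fact p)) * measure lborel (cbox 0 t)"
    proof (rule has_integral_bound[where f = "\<lambda>s. ((t - s) ^ (p - 1) / fact (p - 1)) *\<^sub>R L p s"])
      show "0 \<le> t ^ (p - 1) / fact (p - 1) * (C * flow_rate R M ^ p * fact p)"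
        using t C_nonneg flow_rate_pos by simp
      show "((\<lambda>s. ((t - s) ^ (p - 1) / fact (p - 1)) *\<^sub>R L p s) has_integral
        f (c t) - (\<Sum>i<p. ((t - 0) ^ i / fact i) *\<^sub>R L i 0)) (cbox 0 t)" using int by simp
      fix s assume "s \<in> cbox 0 t"
      then have s: "0 \<le> s" "s \<le> t" by auto
      show "norm (((t - s) ^ (p - 1) / fact (p - 1)) *\<^sub>R L p s) \<le> t ^ (p - 1) / fact (p - 1) * (C * flow_rate R M ^ p * fact p)"
        unfolding norm_scaleR using s
        by (intro mult_mono Lb) (auto intro!: divide_right_mono power_mono)
    qed
    also have "\<dots> = C * (real p * x ^ p)"
    proof -
      obtain q where q: "p = Suc q" using p by (cases p) auto
      show ?thesis using t by (simp add: q x_def power_mult_distrib field_simps)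
    qed
    finally show ?thesis by (simp add: L_def scaleR_conv_of_real mult.commute)
  qed
  have z0: "c 0 \<in> ball a (R / 2)" using c[of 0] t by simp
  have nt: "norm (of_real t :: complex) \<le> \<rho>" using t by simp
  have "(\<lambda>p. (\<Sum>i<p. (lie W ^^ i) f (c 0) / fact i * of_real t ^ i)) \<longlonglongrightarrow> f (c t)"
  proof (rule LIM_zero_cancel, rule Lim_null_comparison)
    show "\<forall>\<^sub>F p in sequentially. norm ((\<Sum>i<p. (lie W ^^ i) f (c 0) / fact i * of_real t ^ i) - f (c t)) \<le> C * (real p * x ^ p)"
      using eventually_gt_at_top[of 0] by eventually_elim (use est in \<open>simp add: norm_minus_commute\<close>)
    have "(\<lambda>p. real p * x ^ p) \<longlonglongrightarrow> 0" by (rule powser_times_n_limit_0) (use x in simp)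
    then show "(\<lambda>p. C * (real p * x ^ p)) \<longlonglongrightarrow> 0" by (rule tendsto_mult_right_zero)
  qed
  moreover have "(\<lambda>p. (\<Sum>i<p. (lie W ^^ i) f (c 0) / fact i * of_real t ^ i)) \<longlonglongrightarrow> flow_series W f (c 0) (of_real t)"
    using flow_series_sums[OF z0 nt] by (simp add: sums_def)
  ultimately show ?thesis by (rule LIMSEQ_unique)
qed

end

end


section \<open>Germs on a complex manifold\<close>

text \<open>The infimum of the counterexamples satisfies \<open>P\<close> by the left condition, and
  the right condition then keeps all counterexamples a positive distance above it.\<close>

lemma real_induction:
  fixes P :: "real \<Rightarrow> bool"
  assumes "P 0" and left: "\<And>t. 0 < t \<Longrightarrow> (\<And>s. 0 \<le> s \<Longrightarrow> s < t \<Longrightarrow> P s) \<Longrightarrow> P t"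
    and right: "\<And>t. 0 \<le> t \<Longrightarrow> (\<And>s. 0 \<le> s \<Longrightarrow> s \<le> t \<Longrightarrow> P s) \<Longrightarrow> \<exists>d>0. \<forall>s. t \<le> s \<and> s < t + d \<longrightarrow> P s"
    and "0 \<le> t"
  shows "P t"
proof (rule ccontr)
  assume "\<not> P t"
  define B where "B = {s. 0 \<le> s \<and> \<not> P s}"
  define b where "b = Inf B"
  have B: "B \<noteq> {}" "bdd_below B" using \<open>\<not> P t\<close> \<open>0 \<le> t\<close> by (auto simp: B_def bdd_below_def)
  have b0: "0 \<le> b" unfolding b_def by (rule cInf_greatest[OF B(1)]) (auto simp: B_def)
  have below: "P s" if "0 \<le> s" "s < b" for s
    using that cInf_lower[OF _ B(2), of s] by (force simp: B_def b_def)
  have "P b" using left[of b] below \<open>P 0\<close> b0 by (cases "b = 0") auto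
  then have "\<And>s. 0 \<le> s \<Longrightarrow> s \<le> b \<Longrightarrow> P s" using below by force
  then obtain d where d: "0 < d" "\<forall>s. b \<le> s \<and> s < b + d \<longrightarrow> P s" using right[OF b0] by blast
  have "b + d \<le> b" unfolding b_def
  proof (rule cInf_greatest[OF B(1)])
    fix s assume s: "s \<in> B"
    then have "\<not> s < b" using below[of s] by (auto simp: B_def)
    then have "\<not> s < b + d" using d(2) s by (auto simp: B_def)
    then show "Inf B + d \<le> s" by (simp add: b_def)
  qed
  then show False using d by simp
qed

text \<open>Both conditions follow from one local statement: near each \<open>t0\<close>, on either
  side, the property passes from earlier to later times. This is what a flow box around the point
  reached at time \<open>t0\<close> delivers.\<close>

lemma real_induction_local:
  fixes P :: "real \<Rightarrow> bool"
  assumes "P 0" and step: "\<And>t0. 0 \<le> t0 \<Longrightarrow>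
      \<exists>d>0. \<forall>s t. 0 \<le> s \<and> s \<le> t \<and> \<bar>s - t0\<bar> < d \<and> \<bar>t - t0\<bar> < d \<and> P s \<longrightarrow> P t"
    and "0 \<le> t"
  shows "P t"
proof (rule real_induction[where P = P])
  fix t :: real assume t: "0 < t" and P: "\<And>s. 0 \<le> s \<Longrightarrow> s < t \<Longrightarrow> P s"
  obtain d where d: "0 < d" "\<forall>s u. 0 \<le> s \<and> s \<le> u \<and> \<bar>s - t\<bar> < d \<and> \<bar>u - t\<bar> < d \<and> P s \<longrightarrow> P u"
    using step[of t] t by auto
  define s where "s = max 0 (t - d / 2)"
  have "0 \<le> s" "s < t" "\<bar>s - t\<bar> < d" using d t by (auto simp: s_def)
  then show "P t" using d(1) d(2)[rule_format, of s t] P[of s] by auto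
next
  fix t :: real assume t: "0 \<le> t" and P: "\<And>s. 0 \<le> s \<Longrightarrow> s \<le> t \<Longrightarrow> P s"
  obtain d where d: "0 < d" "\<forall>s u. 0 \<le> s \<and> s \<le> u \<and> \<bar>s - t\<bar> < d \<and> \<bar>u - t\<bar> < d \<and> P s \<longrightarrow> P u"
    using step[OF t] by auto
  have "P s" if "t \<le> s" "s < t + d" for s
    using d(2)[rule_format, of t s] that P[of t] t d(1) by auto
  then show "\<exists>d>0. \<forall>s. t \<le> s \<and> s < t + d \<longrightarrow> P s" using d(1) by blast
qed (fact assms)+

section \<open>Charts and germs of holomorphic functions\<close>

locale cmanifold =
  fixes X :: "'a topology" and A :: "('a, 'n::finite) chart set"
  assumes mfd: "complex_manifold X A"
begin

lemma Hausdorff: "Hausdorff_space X" using mfd by (simp add: complex_manifold_def)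

lemma exists_chart: "x \<in> topspace X \<Longrightarrow> \<exists>U \<phi>. (U, \<phi>) \<in> A \<and> x \<in> U"
  using mfd unfolding complex_manifold_def by blast

context
  fixes U \<phi> assumes chart: "(U, \<phi>) \<in> A"
begin

lemma chart_hom: "openin X U" "open (\<phi> ` U)" "homeomorphic_map (subtopology X U) (top_of_set (\<phi> ` U)) \<phi>"
proof -
  have "chart_on X (U, \<phi>)" using mfd chart unfolding complex_manifold_def by blast
  then show "openin X U" "open (\<phi> ` U)" "homeomorphic_map (subtopology X U) (top_of_set (\<phi> ` U)) \<phi>"
    by (auto simp: chart_on_def)
qed

lemma chart_subset: "U \<subseteq> topspace X" using chart_hom(1) by (rule openin_subset)

lemma chart_inj: "inj_on \<phi> U"
  using homeomorphic_imp_injective_map[OF chart_hom(3)] chart_subset by (simp add: inf_absorb2)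

lemma chart_inverse: "x \<in> U \<Longrightarrow> inv_into U \<phi> (\<phi> x) = x"
  by (simp add: inv_into_f_f[OF chart_inj])

lemma chart_preimage_open: "open T \<Longrightarrow> openin X {x \<in> U. \<phi> x \<in> T}"
proof -
  assume T: "open T"
  have "continuous_map (subtopology X U) (top_of_set (\<phi> ` U)) \<phi>"
    by (rule homeomorphic_imp_continuous_map[OF chart_hom(3)])
  then have "continuous_map (subtopology X U) euclidean \<phi>" by (rule continuous_map_into_fulltopology)
  then have "openin (subtopology X U) {x \<in> topspace (subtopology X U). \<phi> x \<in> T}"
    using T by (intro openin_continuous_map_preimage) auto
  then have "openin X {x \<in> topspace (subtopology X U). \<phi> x \<in> T}"
    using chart_hom(1) openin_trans_full by blast
  then show ?thesis using chart_subset by (simp add: inf_absorb2)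
qed

lemma chart_image_open: "openin X N \<Longrightarrow> open (\<phi> ` (U \<inter> N))"
proof -
  assume N: "openin X N"
  have "openin (subtopology X U) (U \<inter> N)" using N by (auto simp: openin_subtopology Int_commute)
  then have "openin (top_of_set (\<phi> ` U)) (\<phi> ` (U \<inter> N))"
    using homeomorphic_imp_open_map[OF chart_hom(3)] by (simp add: open_map_def)
  then show ?thesis using chart_hom(2) openin_open_trans by blast
qed

lemma chart_inverse_continuous: "continuous_map (top_of_set (\<phi> ` U)) X (inv_into U \<phi>)"
  unfolding continuous_map_def
proof (intro conjI allI impI)
  show "inv_into U \<phi> \<in> topspace (top_of_set (\<phi> ` U)) \<rightarrow> topspace X"
    using chart_subset by (auto simp: chart_inverse)
  fix N assume N: "openin X N"
  have "{z \<in> topspace (top_of_set (\<phi> ` U)). inv_into U \<phi> z \<in> N} = \<phi> ` (U \<inter> N)"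
    by (auto simp: chart_inverse)
  then show "openin (top_of_set (\<phi> ` U)) {z \<in> topspace (top_of_set (\<phi> ` U)). inv_into U \<phi> z \<in> N}"
    using chart_image_open[OF N] by (auto intro!: openin_open_eq[OF chart_hom(2), THEN iffD2])
qed

lemma chart_compact_preimage:
  assumes "compact K" "K \<subseteq> \<phi> ` U"
  shows "compactin X {x \<in> U. \<phi> x \<in> K}"
proof -
  have "compactin (top_of_set (\<phi> ` U)) K" using assms by (simp add: compactin_subtopology)
  then have "compactin X (inv_into U \<phi> ` K)" by (rule image_compactin[OF _ chart_inverse_continuous])
  moreover have "inv_into U \<phi> ` K = {x \<in> U. \<phi> x \<in> K}"
  proof (intro equalityI subsetI)
    fix x assume "x \<in> inv_into U \<phi> ` K"
    then obtain y where "y \<in> U" "\<phi> y \<in> K" "x = inv_into U \<phi> (\<phi> y)" using assms(2) by blast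
    then show "x \<in> {x \<in> U. \<phi> x \<in> K}" by (simp add: chart_inverse)
  next
    fix x assume "x \<in> {x \<in> U. \<phi> x \<in> K}"
    then show "x \<in> inv_into U \<phi> ` K" by (intro image_eqI[of _ _ "\<phi> x"]) (auto simp: chart_inverse)
  qed
  ultimately show ?thesis by simp
qed

end

text \<open>Holomorphy near a single point, witnessed by one chart. The pointwise notion is needed
  because the flow carries a germ at \<open>x\<close> to a germ at another point, possibly in
  another chart.\<close>

definition hol_at :: "('a \<Rightarrow> complex) \<Rightarrow> 'a \<Rightarrow> bool" where
  "hol_at f x \<longleftrightarrow> (\<exists>U \<phi> g T. (U, \<phi>) \<in> A \<and> x \<in> U \<and> open T \<and> \<phi> x \<in> T \<and> holo_fun g T \<and>
     (\<forall>y\<in>U. \<phi> y \<in> T \<longrightarrow> f y = g (\<phi> y)))"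

lemma hol_atI:
  assumes "(U, \<phi>) \<in> A" "x \<in> U" "open T" "\<phi> x \<in> T" "holo_fun g T" "\<And>y. y \<in> U \<Longrightarrow> \<phi> y \<in> T \<Longrightarrow> f y = g (\<phi> y)"
  shows "hol_at f x"
  using assms unfolding hol_at_def by blast

text \<open>Composition with the holomorphic transition map moves the witness to any chosen chart
  around the point.\<close>

lemma hol_at_chart:
  assumes f: "hol_at f x" and W: "(W, \<psi>) \<in> A" "x \<in> W"
  obtains g e where "0 < e" "ball (\<psi> x) e \<subseteq> \<psi> ` W" "holo_fun g (ball (\<psi> x) e)"
    "\<forall>y\<in>W. \<psi> y \<in> ball (\<psi> x) e \<longrightarrow> f y = g (\<psi> y)"
proof -
  obtain U \<phi> g T where g: "(U, \<phi>) \<in> A" "x \<in> U" "open T" "\<phi> x \<in> T" "holo_fun g T"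
    "\<And>y. y \<in> U \<Longrightarrow> \<phi> y \<in> T \<Longrightarrow> f y = g (\<phi> y)"
    using f unfolding hol_at_def by blast
  define N where "N = {y \<in> U. \<phi> y \<in> T}"
  have "openin X N" unfolding N_def by (rule chart_preimage_open[OF g(1,3)])
  then have op: "open (\<psi> ` (W \<inter> N))" by (rule chart_image_open[OF W(1)])
  have "\<psi> x \<in> \<psi> ` (W \<inter> N)" using W g by (auto simp: N_def)
  then obtain e where e: "0 < e" "ball (\<psi> x) e \<subseteq> \<psi> ` (W \<inter> N)"
    using op open_contains_ball by blast
  have tr: "transition (W, \<psi>) (U, \<phi>) z = \<phi> (inv_into W \<psi> z)" for z by (simp add: transition_def)
  have "holo_map (transition (W, \<psi>) (U, \<phi>)) (\<psi> ` (W \<inter> U))"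
    using mfd W(1) g(1) unfolding complex_manifold_def by fast
  then have "holo_map (transition (W, \<psi>) (U, \<phi>)) (ball (\<psi> x) e)"
    by (rule holo_map_subset) (use e in \<open>auto simp: N_def\<close>)
  then have "holo_fun (\<lambda>z. g (transition (W, \<psi>) (U, \<phi>) z)) (ball (\<psi> x) e)"
  proof (rule holo_fun_compose[OF _ g(5)])
    fix z assume "z \<in> ball (\<psi> x) e"
    then obtain y where "y \<in> W" "y \<in> N" "z = \<psi> y" using e(2) by blast
    then show "transition (W, \<psi>) (U, \<phi>) z \<in> T" by (simp add: tr chart_inverse[OF W(1)] N_def)
  qed
  moreover have "f y = g (transition (W, \<psi>) (U, \<phi>) (\<psi> y))" if y: "y \<in> W" "\<psi> y \<in> ball (\<psi> x) e" for y
  proof -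
    obtain y' where "y' \<in> W" "y' \<in> N" "\<psi> y = \<psi> y'" using e(2) y(2) by blast
    then have "y \<in> N" using chart_inj[OF W(1)] y(1) by (auto dest: inj_onD)
    then show ?thesis using g(6) by (simp add: tr chart_inverse[OF W(1) y(1)] N_def)
  qed
  ultimately show ?thesis using that[OF e(1), of "\<lambda>z. g (transition (W, \<psi>) (U, \<phi>) z)"] e(2) by blast
qed

lemma hol_at_topspace: "hol_at f x \<Longrightarrow> x \<in> topspace X"
  unfolding hol_at_def using chart_subset by blast

lemma manifold_holo_fun_iff: "manifold_holo_fun A f \<longleftrightarrow> (\<forall>x\<in>topspace X. hol_at f x)"
proof
  assume f: "manifold_holo_fun A f"
  show "\<forall>x\<in>topspace X. hol_at f x"
  proof
    fix x assume "x \<in> topspace X"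
    then obtain U \<phi> where U: "(U, \<phi>) \<in> A" "x \<in> U" using exists_chart by blast
    show "hol_at f x"
      by (rule hol_atI[OF U chart_hom(2)[OF U(1)], of "f \<circ> inv_into U \<phi>"])
         (use U f in \<open>auto simp: manifold_holo_fun_def chart_inverse\<close>)
  qed
next
  assume f: "\<forall>x\<in>topspace X. hol_at f x"
  show "manifold_holo_fun A f"
    unfolding manifold_holo_fun_def
  proof clarify
    fix U \<phi> assume U: "(U, \<phi>) \<in> A"
    show "holo_fun (f \<circ> inv_into U \<phi>) (\<phi> ` U)"
    proof (rule holo_fun_locally)
      fix z assume "z \<in> \<phi> ` U"
      then obtain x where x: "x \<in> U" "z = \<phi> x" by blast
      then have "hol_at f x" using f chart_subset[OF U] by blast
      then obtain g e where g: "0 < e" "ball (\<phi> x) e \<subseteq> \<phi> ` U" "holo_fun g (ball (\<phi> x) e)"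
        "\<forall>y\<in>U. \<phi> y \<in> ball (\<phi> x) e \<longrightarrow> f y = g (\<phi> y)"
        by (rule hol_at_chart[OF _ U x(1)])
      have "(f \<circ> inv_into U \<phi>) w = g w" if w: "w \<in> ball (\<phi> x) e" for w
      proof -
        obtain y where y: "y \<in> U" "w = \<phi> y" using g(2) w by blast
        then show ?thesis using g(4) w by (simp add: chart_inverse[OF U])
      qed
      then have "holo_fun (f \<circ> inv_into U \<phi>) (ball (\<phi> x) e)"
        using g(3) holo_fun_cong[OF open_ball] by blast
      then show "\<exists>T. z \<in> T \<and> holo_fun (f \<circ> inv_into U \<phi>) T"
        using g(1) x by (intro exI[of _ "ball (\<phi> x) e"]) simp
    qed
  qed
qed

lemma hol_at_cong:
  assumes "hol_at f x" "openin X N" "x \<in> N" "\<And>y. y \<in> N \<Longrightarrow> f y = g y"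
  shows "hol_at g x"
proof -
  obtain U \<phi> h T where h: "(U, \<phi>) \<in> A" "x \<in> U" "open T" "\<phi> x \<in> T" "holo_fun h T"
    "\<And>y. y \<in> U \<Longrightarrow> \<phi> y \<in> T \<Longrightarrow> f y = h (\<phi> y)"
    using assms(1) unfolding hol_at_def by blast
  show ?thesis
  proof (rule hol_atI[OF h(1,2)])
    show "open (T \<inter> \<phi> ` (U \<inter> N))" by (intro open_Int h(3) chart_image_open[OF h(1) assms(2)])
    show "\<phi> x \<in> T \<inter> \<phi> ` (U \<inter> N)" using h assms by auto
    show "holo_fun h (T \<inter> \<phi> ` (U \<inter> N))" by (rule holo_fun_subset[OF h(5)]) auto
    fix y assume y: "y \<in> U" "\<phi> y \<in> T \<inter> \<phi> ` (U \<inter> N)"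
    then have "y \<in> N" using chart_inj[OF h(1)] by (auto dest: inj_onD)
    then show "g y = h (\<phi> y)" using h(6)[of y] y assms(4)[of y] by simp
  qed
qed

lemma hol_at_chart_compose:
  assumes "(U, \<phi>) \<in> A" "x \<in> U" "open T" "\<phi> x \<in> T" "holo_fun g T"
  shows "hol_at (\<lambda>y. g (\<phi> y)) x"
  by (rule hol_atI[OF assms]) auto

lemma hol_at_coord: "(U, \<phi>) \<in> A \<Longrightarrow> x \<in> U \<Longrightarrow> hol_at (\<lambda>y. \<phi> y $ i) x"
  by (rule hol_at_chart_compose[where T = UNIV]) (auto simp: holo_fun_nth)

lemma hol_at_vector_chart:
  fixes F :: "'a \<Rightarrow> complex^'m::finite"
  assumes F: "\<And>i. hol_at (\<lambda>y. F y $ i) x" and U: "(U, \<phi>) \<in> A" "x \<in> U"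
  obtains G e where "0 < e" "ball (\<phi> x) e \<subseteq> \<phi> ` U" "holo_map G (ball (\<phi> x) e)"
    "\<forall>y\<in>U. \<phi> y \<in> ball (\<phi> x) e \<longrightarrow> F y = G (\<phi> y)"
proof -
  have "\<exists>g e. 0 < e \<and> ball (\<phi> x) e \<subseteq> \<phi> ` U \<and> holo_fun g (ball (\<phi> x) e) \<and>
      (\<forall>y\<in>U. \<phi> y \<in> ball (\<phi> x) e \<longrightarrow> F y $ i = g (\<phi> y))" for i
    by (rule hol_at_chart[OF F[of i] U]) blast
  then obtain g e where ge: "\<And>i. 0 < e i" "\<And>i. ball (\<phi> x) (e i) \<subseteq> \<phi> ` U"
    "\<And>i. holo_fun (g i) (ball (\<phi> x) (e i))"
    "\<And>i y. y \<in> U \<Longrightarrow> \<phi> y \<in> ball (\<phi> x) (e i) \<Longrightarrow> F y $ i = g i (\<phi> y)" by metis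
  define d where "d = Min (range e)"
  have d: "0 < d" "d \<le> e i" for i using ge(1) by (auto simp: d_def Min_gr_iff)
  then have sub: "ball (\<phi> x) d \<subseteq> ball (\<phi> x) (e i)" for i by (simp add: subset_ball)
  show ?thesis
  proof (rule that[OF d(1), of "\<lambda>z. \<chi> i. g i z"])
    show "ball (\<phi> x) d \<subseteq> \<phi> ` U" using sub ge(2) by blast
    show "holo_map (\<lambda>z. \<chi> i. g i z) (ball (\<phi> x) d)"
      unfolding holo_map_def using holo_fun_subset[OF ge(3) sub] by simp
    show "\<forall>y\<in>U. \<phi> y \<in> ball (\<phi> x) d \<longrightarrow> F y = (\<chi> i. g i (\<phi> y))"
    proof (intro ballI impI)
      fix y assume y: "y \<in> U" "\<phi> y \<in> ball (\<phi> x) d"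
      then have "\<phi> y \<in> ball (\<phi> x) (e i)" for i using sub by blast
      then show "F y = (\<chi> i. g i (\<phi> y))" using ge(4)[OF y(1)] by (simp add: vec_eq_iff)
    qed
  qed
qed

lemma hol_at_compose:
  fixes F :: "'a \<Rightarrow> complex^'m::finite"
  assumes F: "\<And>i. hol_at (\<lambda>y. F y $ i) x" and T: "open T" "F x \<in> T" "holo_fun g T"
  shows "hol_at (\<lambda>y. g (F y)) x"
proof -
  obtain U \<phi> where U: "(U, \<phi>) \<in> A" "x \<in> U" using exists_chart hol_at_topspace[OF F] by blast
  obtain G e where G: "0 < e" "ball (\<phi> x) e \<subseteq> \<phi> ` U" "holo_map G (ball (\<phi> x) e)"
    "\<forall>y\<in>U. \<phi> y \<in> ball (\<phi> x) e \<longrightarrow> F y = G (\<phi> y)"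
    by (rule hol_at_vector_chart[OF F U])
  define S where "S = {z \<in> ball (\<phi> x) e. G z \<in> T}"
  have S: "open S" unfolding S_def
    using continuous_open_preimage[OF holo_map_continuous_on[OF G(3)] open_ball T(1)]
    by (simp add: vimage_def Int_def)
  have GS: "holo_map G S" by (rule holo_map_subset[OF G(3)]) (auto simp: S_def)
  show ?thesis
  proof (rule hol_atI[OF U S])
    show "\<phi> x \<in> S" using G T U by (auto simp: S_def)
    show "holo_fun (\<lambda>z. g (G z)) S" by (rule holo_fun_compose[OF GS T(3)]) (simp add: S_def)
  qed (use G(4) in \<open>auto simp: S_def\<close>)
qed

lemma hol_at_continuous:
  assumes f: "hol_at f x" and T: "open T" "f x \<in> T"
  shows "\<exists>N. openin X N \<and> x \<in> N \<and> (\<forall>y\<in>N. f y \<in> T)"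
proof -
  obtain U \<phi> where U: "(U, \<phi>) \<in> A" "x \<in> U" using exists_chart hol_at_topspace[OF f] by blast
  obtain g e where g: "0 < e" "ball (\<phi> x) e \<subseteq> \<phi> ` U" "holo_fun g (ball (\<phi> x) e)"
    "\<forall>y\<in>U. \<phi> y \<in> ball (\<phi> x) e \<longrightarrow> f y = g (\<phi> y)"
    by (rule hol_at_chart[OF f U])
  define S where "S = {z \<in> ball (\<phi> x) e. g z \<in> T}"
  have S: "open S" unfolding S_def
    using continuous_open_preimage[OF holo_fun_continuous_on[OF g(3)] open_ball T(1)]
    by (simp add: vimage_def Int_def)
  show ?thesis
    using chart_preimage_open[OF U(1) S] g T U by (intro exI[of _ "{x \<in> U. \<phi> x \<in> S}"]) (auto simp: S_def)
qed

end


section \<open>Integral curves\<close>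

locale vfield_manifold = cmanifold X A for X :: "'a topology" and A :: "('a, 'n::finite) chart set" +
  fixes V :: "('a, 'n) vfield"
  assumes vfield: "holomorphic_vector_field A V"
begin

abbreviation icurve :: "(real \<Rightarrow> 'a) \<Rightarrow> bool" where "icurve \<equiv> integral_curve X A V"

lemma icurve_topspace: "icurve \<gamma> \<Longrightarrow> 0 \<le> t \<Longrightarrow> \<gamma> t \<in> topspace X"
  unfolding integral_curve_def continuous_map_def by auto

lemma icurve_near:
  assumes "icurve \<gamma>" "0 \<le> t0" "openin X N" "\<gamma> t0 \<in> N"
  shows "\<exists>d>0. \<forall>s. 0 \<le> s \<and> \<bar>s - t0\<bar> < d \<longrightarrow> \<gamma> s \<in> N"
proof -
  have "openin (top_of_set {0..}) {s \<in> topspace (top_of_set {0..}). \<gamma> s \<in> N}"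
    using assms(1,3) unfolding integral_curve_def by (intro openin_continuous_map_preimage) auto
  then have "\<exists>e>0. \<forall>s\<in>{0..}. dist s t0 < e \<longrightarrow> s \<in> {s \<in> topspace (top_of_set {0..}). \<gamma> s \<in> N}"
    using assms(2,4) unfolding openin_euclidean_subtopology_iff by auto
  then show ?thesis by (auto simp: dist_real_def)
qed

lemma icurve_derivative:
  assumes "icurve \<gamma>" "0 \<le> t" "(U, \<phi>) \<in> A" "\<gamma> t \<in> U" "S \<subseteq> {0..}"
  shows "((\<lambda>s. \<phi> (\<gamma> s)) has_vector_derivative V (U, \<phi>) (\<gamma> t)) (at t within S)"
proof -
  have "((\<lambda>s. \<phi> (\<gamma> s)) has_vector_derivative V (U, \<phi>) (\<gamma> t)) (at t within {0..})"
    using assms(1-4) unfolding integral_curve_def by fast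
  then show ?thesis by (rule has_vector_derivative_within_subset) (fact assms(5))
qed

lemma icurve_shift:
  assumes "icurve \<gamma>" "0 \<le> s"
  shows "icurve (\<lambda>t. \<gamma> (s + t))"
  unfolding integral_curve_def
proof (intro conjI allI impI)
  have "continuous_map (top_of_set {0..}) (top_of_set {0..}) (\<lambda>t. s + t)"
    using assms(2) by (auto intro!: continuous_intros)
  then have "continuous_map (top_of_set {0..}) X (\<gamma> \<circ> (\<lambda>t. s + t))"
    using assms(1) unfolding integral_curve_def by (blast intro: continuous_map_compose)
  then show "continuous_map (top_of_set {0..}) X (\<lambda>t. \<gamma> (s + t))" by (simp add: comp_def)
next
  fix t :: real assume t: "0 \<le> t"
  show "\<forall>(U, \<phi>)\<in>A. \<gamma> (s + t) \<in> U \<longrightarrow>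
      ((\<lambda>u. \<phi> (\<gamma> (s + u))) has_vector_derivative V (U, \<phi>) (\<gamma> (s + t))) (at t within {0..})"
  proof clarify
    fix U \<phi> assume U: "(U, \<phi>) \<in> A" "\<gamma> (s + t) \<in> U"
    have 1: "((\<lambda>u. s + u) has_vector_derivative 1) (at t within {0..})"
      by (auto intro!: derivative_eq_intros)
    have 2: "((\<lambda>u. \<phi> (\<gamma> u)) has_vector_derivative V (U, \<phi>) (\<gamma> (s + t))) (at (s + t) within (\<lambda>u. s + u) ` {0..})"
      by (rule icurve_derivative[OF assms(1) _ U]) (use assms(2) t in auto)
    from vector_diff_chain_within[OF 1 2]
    show "((\<lambda>u. \<phi> (\<gamma> (s + u))) has_vector_derivative V (U, \<phi>) (\<gamma> (s + t))) (at t within {0..})"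
      by (simp add: comp_def)
  qed
qed

text \<open>With speed at most \<open>M\<close> in the chart, the curve cannot cover the distance
  \<open>r\<close> before time \<open>T\<close>. Since the coordinates only make sense inside
  \<open>U\<close>, the bound and the membership in \<open>U\<close> are proved together.\<close>

lemma icurve_stays:
  assumes U: "(U, \<phi>) \<in> A" and \<gamma>: "icurve \<gamma>" "\<gamma> 0 \<in> U" and sub: "cball (\<phi> (\<gamma> 0)) r \<subseteq> \<phi> ` U"
    and M: "0 \<le> M" "\<And>x. x \<in> U \<Longrightarrow> \<phi> x \<in> cball (\<phi> (\<gamma> 0)) r \<Longrightarrow> norm (V (U, \<phi>) x) \<le> M"
    and T: "M * T < r" and t: "0 \<le> t" "t \<le> T"
  shows "\<gamma> t \<in> U \<and> dist (\<phi> (\<gamma> 0)) (\<phi> (\<gamma> t)) \<le> M * t"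
proof -
  define P where "P t \<longleftrightarrow> (t \<le> T \<longrightarrow> \<gamma> t \<in> U \<and> dist (\<phi> (\<gamma> 0)) (\<phi> (\<gamma> t)) \<le> M * t)" for t
  have "P t"
  proof (rule real_induction[where P = P])
    show "P 0" using \<gamma> by (simp add: P_def)
  next
    fix t :: real assume t: "0 < t" and P: "\<And>s. 0 \<le> s \<Longrightarrow> s < t \<Longrightarrow> P s"
    show "P t"
      unfolding P_def
    proof
      assume tT: "t \<le> T"
      \<comment> \<open>The curve could have left \<open>U\<close> at time \<open>t\<close> although
        its coordinates stay bounded. This is excluded because the preimage of a compact ball is
        compact, hence closed in the Hausdorff space.\<close>
      define Y where "Y = {x \<in> U. \<phi> x \<in> cball (\<phi> (\<gamma> 0)) (M * t)}"
      have "M * t \<le> M * T" using M tT by (intro mult_left_mono) auto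
      then have "cball (\<phi> (\<gamma> 0)) (M * t) \<subseteq> \<phi> ` U" using sub T by force
      then have "compactin X Y" unfolding Y_def by (intro chart_compact_preimage[OF U] compact_cball)
      then have Y: "closedin X Y" using Hausdorff by (rule compactin_imp_closedin[rotated])
      have "\<gamma> t \<in> Y"
      proof (rule ccontr)
        assume "\<gamma> t \<notin> Y"
        then have "\<gamma> t \<in> topspace X - Y" using icurve_topspace[OF \<gamma>(1)] t by simp
        moreover have "openin X (topspace X - Y)" using Y by (simp add: openin_diff)
        ultimately obtain d where d: "0 < d" "\<forall>s. 0 \<le> s \<and> \<bar>s - t\<bar> < d \<longrightarrow> \<gamma> s \<in> topspace X - Y"
          using icurve_near[OF \<gamma>(1), of t] t by (meson less_imp_le)
        define s where "s = max 0 (t - d / 2)"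
        have s: "0 \<le> s" "s < t" "\<bar>s - t\<bar> < d" using d t by (auto simp: s_def)
        then have "\<gamma> s \<in> U" "dist (\<phi> (\<gamma> 0)) (\<phi> (\<gamma> s)) \<le> M * s" using P[of s] tT by (auto simp: P_def)
        moreover have "M * s \<le> M * t" using M s by (intro mult_left_mono) auto
        ultimately have "\<gamma> s \<in> Y" by (simp add: Y_def)
        then show False using d(2) s by blast
      qed
      then show "\<gamma> t \<in> U \<and> dist (\<phi> (\<gamma> 0)) (\<phi> (\<gamma> t)) \<le> M * t" by (simp add: Y_def)
    qed
  next
    fix t :: real assume t: "0 \<le> t" and P: "\<And>s. 0 \<le> s \<Longrightarrow> s \<le> t \<Longrightarrow> P s"
    show "\<exists>d>0. \<forall>s. t \<le> s \<and> s < t + d \<longrightarrow> P s"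
    proof (cases "t \<le> T")
      case False
      then show ?thesis by (intro exI[of _ 1]) (auto simp: P_def)
    next
      case True
      define N where "N = {x \<in> U. \<phi> x \<in> ball (\<phi> (\<gamma> 0)) r}"
      have N: "openin X N" unfolding N_def by (rule chart_preimage_open[OF U open_ball])
      have below: "\<gamma> s \<in> N" if "0 \<le> s" "s \<le> t" for s
      proof -
        have "M * s \<le> M * T" using M that True by (intro mult_left_mono) auto
        then show ?thesis using P[OF that] that True T by (auto simp: P_def N_def)
      qed
      obtain d where d: "0 < d" "\<forall>s. 0 \<le> s \<and> \<bar>s - t\<bar> < d \<longrightarrow> \<gamma> s \<in> N"
        using icurve_near[OF \<gamma>(1) t N below[OF t order_refl]] by blast
      have "P s" if s: "t \<le> s" "s < t + d" for s
      proof -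
        have in_N: "\<gamma> u \<in> N" if "0 \<le> u" "u \<le> s" for u
          using below[of u] d(2)[rule_format, of u] that s by (cases "u \<le> t") auto
        have "norm (\<phi> (\<gamma> s) - \<phi> (\<gamma> 0)) \<le> M * norm (s - 0)"
        proof (rule differentiable_bound[of "{0..s}" "\<lambda>u. \<phi> (\<gamma> u)" "\<lambda>u h. h *\<^sub>R V (U, \<phi>) (\<gamma> u)"])
          fix u assume u: "u \<in> {0..s}"
          then have uN: "\<gamma> u \<in> U" "\<phi> (\<gamma> u) \<in> ball (\<phi> (\<gamma> 0)) r" using in_N by (auto simp: N_def)
          have "((\<lambda>u. \<phi> (\<gamma> u)) has_vector_derivative V (U, \<phi>) (\<gamma> u)) (at u within {0..s})"
            by (rule icurve_derivative[OF \<gamma>(1) _ U uN(1)]) (use u in auto)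
          then show "((\<lambda>u. \<phi> (\<gamma> u)) has_derivative (\<lambda>h. h *\<^sub>R V (U, \<phi>) (\<gamma> u))) (at u within {0..s})"
            by (simp add: has_vector_derivative_def)
          show "onorm (\<lambda>h. h *\<^sub>R V (U, \<phi>) (\<gamma> u)) \<le> M"
          proof (rule onorm_le)
            fix h :: real
            have "norm (V (U, \<phi>) (\<gamma> u)) \<le> M" using M(2)[OF uN(1)] uN(2) by simp
            then show "norm (h *\<^sub>R V (U, \<phi>) (\<gamma> u)) \<le> M * norm h"
              by (simp add: mult.commute[of M] mult_left_mono)
          qed
        qed (use t s in auto)
        then show ?thesis using in_N[of s] t s by (simp add: P_def N_def dist_norm norm_minus_commute)
      qed
      then show ?thesis using d(1) by blast
    qed
  qed (fact t)
  then show ?thesis using t by (simp add: P_def)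
qed

text \<open>Around every point the integral curves are given, in any chart, by a series that converges for
  complex times.\<close>

lemma flow_box:
  assumes U: "(U, \<phi>) \<in> A" "x0 \<in> U" and e: "0 < e"
  obtains R \<rho> where "0 < R" "R \<le> e" "0 < \<rho>" "cball (\<phi> x0) R \<subseteq> \<phi> ` U"
    "\<forall>\<gamma> t. icurve \<gamma> \<and> \<gamma> 0 \<in> U \<and> \<phi> (\<gamma> 0) \<in> ball (\<phi> x0) (R / 4) \<and> 0 \<le> t \<and> t \<le> \<rho> \<longrightarrow>
      \<gamma> t \<in> U \<and> \<phi> (\<gamma> t) \<in> ball (\<phi> x0) (R / 2)"
    "\<forall>f C. holo_fun f (ball (\<phi> x0) R) \<and> (\<forall>z\<in>ball (\<phi> x0) R. norm (f z) \<le> C) \<longrightarrow>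
      (\<exists>h. (\<forall>z\<in>ball (\<phi> x0) (R / 2). h z holomorphic_on cball 0 \<rho>) \<and>
        (\<forall>z\<in>ball (\<phi> x0) (R / 2). \<forall>\<tau>\<in>cball 0 \<rho>. norm (h z \<tau>) \<le> 2 * C) \<and>
        (\<forall>\<tau>\<in>cball 0 \<rho>. holo_fun (\<lambda>z. h z \<tau>) (ball (\<phi> x0) (R / 2))) \<and>
        (\<forall>\<gamma> t. icurve \<gamma> \<and> \<gamma> 0 \<in> U \<and> \<phi> (\<gamma> 0) \<in> ball (\<phi> x0) (R / 4) \<and> 0 \<le> t \<and> t \<le> \<rho> \<longrightarrow>
          f (\<phi> (\<gamma> t)) = h (\<phi> (\<gamma> 0)) (of_real t)))"
proof -
  let ?a = "\<phi> x0"
  have "?a \<in> \<phi> ` U" using U by blast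
  then obtain e0 where e0: "0 < e0" "cball ?a e0 \<subseteq> \<phi> ` U"
    using chart_hom(2)[OF U(1)] open_contains_cball by blast
  define R where "R = min e e0"
  have R: "0 < R" "R \<le> e" "cball ?a R \<subseteq> \<phi> ` U" using e e0 by (auto simp: R_def)
  define W where "W z = V (U, \<phi>) (inv_into U \<phi> z)" for z
  have "holo_map (V (U, \<phi>) \<circ> inv_into U \<phi>) (\<phi> ` U)"
    using vfield U(1) unfolding holomorphic_vector_field_def by fast
  then have WU: "holo_map W (\<phi> ` U)" by (simp add: W_def[abs_def] comp_def)
  have WV: "W (\<phi> x) = V (U, \<phi>) x" if "x \<in> U" for x
    by (simp add: W_def chart_inverse[OF U(1) that])
  obtain M where M: "0 < M" "\<And>z. z \<in> cball ?a R \<Longrightarrow> norm (W z) \<le> M"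
    using compact_bound[OF holo_map_continuous_on[OF WU] compact_cball R(3)] by blast
  have Rs: "ball ?a R \<subseteq> cball ?a R" by auto
  have W: "holo_map W (ball ?a R)" by (rule holo_map_subset[OF WU]) (use R(3) Rs in blast)
  have Wb: "norm (W z) \<le> M" if "z \<in> ball ?a R" for z using M(2) that Rs by blast
  \<comment> \<open>The denominator 16 exceeds \<open>4 * exp 1\<close>, which gives the convergence
    condition for the Lie series. It also makes the distance \<open>M * \<rho>\<close> travelled in
    the box less than \<open>R / 4\<close>.\<close>
  define \<rho>1 where "\<rho>1 = R / (16 * M)"
  define \<rho> where "\<rho> = \<rho>1 / 2"
  have \<rho>1: "0 < \<rho>1" "2 * (2 * exp 1 * M / R) * \<rho>1 \<le> 1"
    using R M exp_le by (auto simp: \<rho>1_def field_simps)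
  have \<rho>: "0 < \<rho>" "\<rho> < \<rho>1" using \<rho>1 by (simp_all add: \<rho>_def)
  have "M * \<rho> = R / 32" using M by (simp add: \<rho>_def \<rho>1_def)
  then have \<rho>M: "M * \<rho> < R / 4" using R by simp
  have stays: "\<gamma> t \<in> U \<and> \<phi> (\<gamma> t) \<in> ball ?a (R / 2)"
    if \<gamma>: "icurve \<gamma>" "\<gamma> 0 \<in> U" "\<phi> (\<gamma> 0) \<in> ball ?a (R / 4)" and t: "0 \<le> t" "t \<le> \<rho>" for \<gamma> t
  proof -
    have sub: "cball (\<phi> (\<gamma> 0)) (R / 4) \<subseteq> ball ?a (R / 2)"
    proof
      fix z assume "z \<in> cball (\<phi> (\<gamma> 0)) (R / 4)"
      then show "z \<in> ball ?a (R / 2)" using \<gamma>(3) dist_triangle[of ?a z "\<phi> (\<gamma> 0)"] by simp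
    qed
    have sub2: "ball ?a (R / 2) \<subseteq> cball ?a R" using R by auto
    have "\<gamma> t \<in> U \<and> dist (\<phi> (\<gamma> 0)) (\<phi> (\<gamma> t)) \<le> M * t"
    proof (rule icurve_stays[OF U(1) \<gamma>(1,2) _ _ _ \<rho>M t])
      show "cball (\<phi> (\<gamma> 0)) (R / 4) \<subseteq> \<phi> ` U" using sub sub2 R(3) by blast
      show "norm (V (U, \<phi>) x) \<le> M" if "x \<in> U" "\<phi> x \<in> cball (\<phi> (\<gamma> 0)) (R / 4)" for x
      proof -
        have "\<phi> x \<in> cball ?a R" using that(2) sub sub2 by blast
        then show ?thesis using M(2) WV[OF that(1)] by metis
      qed
    qed (use M in simp)
    moreover have "M * t \<le> M * \<rho>" using M t by (intro mult_left_mono) auto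
    ultimately have "\<phi> (\<gamma> t) \<in> cball (\<phi> (\<gamma> 0)) (R / 4)" using \<rho>M by simp
    then show ?thesis using sub \<open>\<gamma> t \<in> U \<and> _\<close> by blast
  qed
  show ?thesis
  proof (rule that[OF R(1,2) \<rho>(1) R(3)])
    show "\<forall>\<gamma> t. icurve \<gamma> \<and> \<gamma> 0 \<in> U \<and> \<phi> (\<gamma> 0) \<in> ball ?a (R / 4) \<and> 0 \<le> t \<and> t \<le> \<rho> \<longrightarrow>
      \<gamma> t \<in> U \<and> \<phi> (\<gamma> t) \<in> ball ?a (R / 2)" using stays by blast
  next
    show "\<forall>f C. holo_fun f (ball ?a R) \<and> (\<forall>z\<in>ball ?a R. norm (f z) \<le> C) \<longrightarrow>
      (\<exists>h. (\<forall>z\<in>ball ?a (R / 2). h z holomorphic_on cball 0 \<rho>) \<and>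
        (\<forall>z\<in>ball ?a (R / 2). \<forall>\<tau>\<in>cball 0 \<rho>. norm (h z \<tau>) \<le> 2 * C) \<and>
        (\<forall>\<tau>\<in>cball 0 \<rho>. holo_fun (\<lambda>z. h z \<tau>) (ball ?a (R / 2))) \<and>
        (\<forall>\<gamma> t. icurve \<gamma> \<and> \<gamma> 0 \<in> U \<and> \<phi> (\<gamma> 0) \<in> ball ?a (R / 4) \<and> 0 \<le> t \<and> t \<le> \<rho> \<longrightarrow>
          f (\<phi> (\<gamma> t)) = h (\<phi> (\<gamma> 0)) (of_real t)))"
    proof (intro allI impI)
      fix f C assume f: "holo_fun f (ball ?a R) \<and> (\<forall>z\<in>ball ?a R. norm (f z) \<le> C)"
      then have fb: "\<And>z. z \<in> ball ?a R \<Longrightarrow> norm (f z) \<le> C" by blast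
      note fs = R(1) M(1) W conjunct1[OF f] Wb fb
      have rate: "2 * flow_rate R M * \<rho>1 \<le> 1" using \<rho>1(2) unfolding flow_rate_def .
      have \<tau>: "norm \<tau> \<le> \<rho>1" if "\<tau> \<in> cball 0 \<rho>" for \<tau> :: complex using that \<rho> by simp
      have sub\<rho>: "cball (0::complex) \<rho> \<subseteq> ball 0 \<rho>1" using \<rho> by auto
      show "\<exists>h. (\<forall>z\<in>ball ?a (R / 2). h z holomorphic_on cball 0 \<rho>) \<and>
        (\<forall>z\<in>ball ?a (R / 2). \<forall>\<tau>\<in>cball 0 \<rho>. norm (h z \<tau>) \<le> 2 * C) \<and>
        (\<forall>\<tau>\<in>cball 0 \<rho>. holo_fun (\<lambda>z. h z \<tau>) (ball ?a (R / 2))) \<and>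
        (\<forall>\<gamma> t. icurve \<gamma> \<and> \<gamma> 0 \<in> U \<and> \<phi> (\<gamma> 0) \<in> ball ?a (R / 4) \<and> 0 \<le> t \<and> t \<le> \<rho> \<longrightarrow>
          f (\<phi> (\<gamma> t)) = h (\<phi> (\<gamma> 0)) (of_real t))"
      proof (intro exI[of _ "flow_series W f"] conjI ballI allI impI)
        show "flow_series W f z holomorphic_on cball 0 \<rho>" if "z \<in> ball ?a (R / 2)" for z
          by (rule holomorphic_on_subset[OF flow_series_holomorphic_time[OF fs \<rho>1(1) rate that] sub\<rho>])
        show "norm (flow_series W f z \<tau>) \<le> 2 * C" if "z \<in> ball ?a (R / 2)" "\<tau> \<in> cball 0 \<rho>" for z \<tau>
          by (rule flow_series_bound[OF fs \<rho>1(1) rate that(1) \<tau>[OF that(2)]])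
        show "holo_fun (\<lambda>z. flow_series W f z \<tau>) (ball ?a (R / 2))" if "\<tau> \<in> cball 0 \<rho>" for \<tau>
          by (rule flow_series_holomorphic_space[OF fs \<rho>1(1) rate \<tau>[OF that]])
        fix \<gamma> t assume a: "icurve \<gamma> \<and> \<gamma> 0 \<in> U \<and> \<phi> (\<gamma> 0) \<in> ball ?a (R / 4) \<and> 0 \<le> t \<and> t \<le> \<rho>"
        then have \<gamma>: "icurve \<gamma>" "\<gamma> 0 \<in> U" "\<phi> (\<gamma> 0) \<in> ball ?a (R / 4)" and t: "0 \<le> t" "t \<le> \<rho>" by auto
        show "f (\<phi> (\<gamma> t)) = flow_series W f (\<phi> (\<gamma> 0)) (of_real t)"
        proof (rule flow_series_curve[where c = "\<lambda>s. \<phi> (\<gamma> s)", OF fs \<rho>1(1) rate t(1)])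
          show "t \<le> \<rho>1" using t \<rho> by simp
          fix s assume s: "0 \<le> s" "s \<le> t"
          have st: "\<gamma> s \<in> U \<and> \<phi> (\<gamma> s) \<in> ball ?a (R / 2)" by (rule stays[OF \<gamma>]) (use s t in auto)
          then show "\<phi> (\<gamma> s) \<in> ball ?a (R / 2)" ..
          have "((\<lambda>s. \<phi> (\<gamma> s)) has_vector_derivative V (U, \<phi>) (\<gamma> s)) (at s within {0..t})"
            by (rule icurve_derivative[OF \<gamma>(1) s(1) U(1)]) (use st in auto)
          then show "((\<lambda>s. \<phi> (\<gamma> s)) has_vector_derivative W (\<phi> (\<gamma> s))) (at s within {0..t})"
            using st by (simp add: WV)
        qed
      qed
    qed
  qed
qed

text \<open>The flow box for the coordinate functions: \<open>u z \<tau>\<close> is the local flow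
  in the chart, available also for complex and in particular for negative
  \<open>\<tau>\<close>.\<close>

lemma flow_box_coords:
  assumes U: "(U, \<phi>) \<in> A" "x0 \<in> U" and e: "0 < e"
  obtains R \<rho> u where "0 < R" "R \<le> e" "0 < \<rho>" "cball (\<phi> x0) R \<subseteq> \<phi> ` U"
    "\<forall>\<gamma> t. icurve \<gamma> \<and> \<gamma> 0 \<in> U \<and> \<phi> (\<gamma> 0) \<in> ball (\<phi> x0) (R / 4) \<and> 0 \<le> t \<and> t \<le> \<rho> \<longrightarrow>
      \<gamma> t \<in> U \<and> \<phi> (\<gamma> t) \<in> ball (\<phi> x0) (R / 2) \<and> \<phi> (\<gamma> t) = u (\<phi> (\<gamma> 0)) (of_real t)"
    "\<forall>z\<in>ball (\<phi> x0) (R / 2). \<forall>i. (\<lambda>\<tau>. u z \<tau> $ i) holomorphic_on cball 0 \<rho>"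
    "\<forall>\<tau>\<in>cball 0 \<rho>. holo_map (\<lambda>z. u z \<tau>) (ball (\<phi> x0) (R / 2))"
proof -
  obtain R \<rho> where R: "0 < R" "R \<le> e" "0 < \<rho>" "cball (\<phi> x0) R \<subseteq> \<phi> ` U"
    "\<forall>\<gamma> t. icurve \<gamma> \<and> \<gamma> 0 \<in> U \<and> \<phi> (\<gamma> 0) \<in> ball (\<phi> x0) (R / 4) \<and> 0 \<le> t \<and> t \<le> \<rho> \<longrightarrow>
      \<gamma> t \<in> U \<and> \<phi> (\<gamma> t) \<in> ball (\<phi> x0) (R / 2)"
    "\<forall>f C. holo_fun f (ball (\<phi> x0) R) \<and> (\<forall>z\<in>ball (\<phi> x0) R. norm (f z) \<le> C) \<longrightarrow>
      (\<exists>h. (\<forall>z\<in>ball (\<phi> x0) (R / 2). h z holomorphic_on cball 0 \<rho>) \<and>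
        (\<forall>z\<in>ball (\<phi> x0) (R / 2). \<forall>\<tau>\<in>cball 0 \<rho>. norm (h z \<tau>) \<le> 2 * C) \<and>
        (\<forall>\<tau>\<in>cball 0 \<rho>. holo_fun (\<lambda>z. h z \<tau>) (ball (\<phi> x0) (R / 2))) \<and>
        (\<forall>\<gamma> t. icurve \<gamma> \<and> \<gamma> 0 \<in> U \<and> \<phi> (\<gamma> 0) \<in> ball (\<phi> x0) (R / 4) \<and> 0 \<le> t \<and> t \<le> \<rho> \<longrightarrow>
          f (\<phi> (\<gamma> t)) = h (\<phi> (\<gamma> 0)) (of_real t)))"
    by (rule flow_box[OF U e])
  have b: "norm (z $ i) \<le> norm (\<phi> x0) + R" if "z \<in> ball (\<phi> x0) R" for z :: "complex^'n" and i
    using that Finite_Cartesian_Product.norm_nth_le[of z i] norm_triangle_ineq[of "\<phi> x0" "z - \<phi> x0"]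
    by (simp add: dist_norm norm_minus_commute)
  have "\<exists>h. (\<forall>z\<in>ball (\<phi> x0) (R / 2). h z holomorphic_on cball 0 \<rho>) \<and>
        (\<forall>\<tau>\<in>cball 0 \<rho>. holo_fun (\<lambda>z. h z \<tau>) (ball (\<phi> x0) (R / 2))) \<and>
        (\<forall>\<gamma> t. icurve \<gamma> \<and> \<gamma> 0 \<in> U \<and> \<phi> (\<gamma> 0) \<in> ball (\<phi> x0) (R / 4) \<and> 0 \<le> t \<and> t \<le> \<rho> \<longrightarrow>
          \<phi> (\<gamma> t) $ i = h (\<phi> (\<gamma> 0)) (of_real t))" for i
    using R(6)[rule_format, of "\<lambda>z. z $ i" "norm (\<phi> x0) + R"] b holo_fun_nth by blast
  then obtain h where h: "\<And>i. \<forall>z\<in>ball (\<phi> x0) (R / 2). h i z holomorphic_on cball 0 \<rho>"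
    "\<And>i. \<forall>\<tau>\<in>cball 0 \<rho>. holo_fun (\<lambda>z. h i z \<tau>) (ball (\<phi> x0) (R / 2))"
    "\<And>i. \<forall>\<gamma> t. icurve \<gamma> \<and> \<gamma> 0 \<in> U \<and> \<phi> (\<gamma> 0) \<in> ball (\<phi> x0) (R / 4) \<and> 0 \<le> t \<and> t \<le> \<rho> \<longrightarrow>
          \<phi> (\<gamma> t) $ i = h i (\<phi> (\<gamma> 0)) (of_real t)" by metis
  show ?thesis
  proof (rule that[OF R(1-4), of "\<lambda>z \<tau>. \<chi> i. h i z \<tau>"])
    show "\<forall>\<gamma> t. icurve \<gamma> \<and> \<gamma> 0 \<in> U \<and> \<phi> (\<gamma> 0) \<in> ball (\<phi> x0) (R / 4) \<and> 0 \<le> t \<and> t \<le> \<rho> \<longrightarrow>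
      \<gamma> t \<in> U \<and> \<phi> (\<gamma> t) \<in> ball (\<phi> x0) (R / 2) \<and> \<phi> (\<gamma> t) = (\<chi> i. h i (\<phi> (\<gamma> 0)) (of_real t))"
    proof (intro allI impI conjI)
      fix \<gamma> t assume a: "icurve \<gamma> \<and> \<gamma> 0 \<in> U \<and> \<phi> (\<gamma> 0) \<in> ball (\<phi> x0) (R / 4) \<and> 0 \<le> t \<and> t \<le> \<rho>"
      show "\<gamma> t \<in> U" "\<phi> (\<gamma> t) \<in> ball (\<phi> x0) (R / 2)" using R(5) a by blast+
      have "\<phi> (\<gamma> t) $ i = h i (\<phi> (\<gamma> 0)) (of_real t)" for i by (rule h(3)[rule_format, OF a])
      then show "\<phi> (\<gamma> t) = (\<chi> i. h i (\<phi> (\<gamma> 0)) (of_real t))" by (simp add: vec_eq_iff)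
    qed
  qed (use h(1,2) in \<open>simp_all add: holo_map_def\<close>)
qed

text \<open>Near each time both curves are given by the same \<open>u\<close>, so agreement passes
  from earlier to later times.\<close>

lemma icurve_unique:
  assumes \<gamma>: "icurve \<gamma>" "icurve \<gamma>'" "\<gamma> 0 = \<gamma>' 0" and t: "0 \<le> t"
  shows "\<gamma> t = \<gamma>' t"
proof (rule real_induction_local[where P = "\<lambda>t. \<gamma> t = \<gamma>' t", OF \<gamma>(3) _ t])
  fix t0 :: real assume t0: "0 \<le> t0"
  obtain U \<phi> where U: "(U, \<phi>) \<in> A" "\<gamma> t0 \<in> U" using exists_chart[OF icurve_topspace[OF \<gamma>(1) t0]] by blast
  obtain R \<rho> and u :: "complex^'n \<Rightarrow> complex \<Rightarrow> complex^'n" where R: "0 < R" "R \<le> 1" "0 < \<rho>" "cball (\<phi> (\<gamma> t0)) R \<subseteq> \<phi> ` U"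
    "\<forall>\<gamma>' t. icurve \<gamma>' \<and> \<gamma>' 0 \<in> U \<and> \<phi> (\<gamma>' 0) \<in> ball (\<phi> (\<gamma> t0)) (R / 4) \<and> 0 \<le> t \<and> t \<le> \<rho> \<longrightarrow>
      \<gamma>' t \<in> U \<and> \<phi> (\<gamma>' t) \<in> ball (\<phi> (\<gamma> t0)) (R / 2) \<and> \<phi> (\<gamma>' t) = u (\<phi> (\<gamma>' 0)) (of_real t)"
    "\<forall>z\<in>ball (\<phi> (\<gamma> t0)) (R / 2). \<forall>i. (\<lambda>\<tau>. u z \<tau> $ i) holomorphic_on cball 0 \<rho>"
    "\<forall>\<tau>\<in>cball 0 \<rho>. holo_map (\<lambda>z. u z \<tau>) (ball (\<phi> (\<gamma> t0)) (R / 2))"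
    by (rule flow_box_coords[OF U zero_less_one])
  define N where "N = {x \<in> U. \<phi> x \<in> ball (\<phi> (\<gamma> t0)) (R / 4)}"
  have N: "openin X N" "\<gamma> t0 \<in> N"
    using chart_preimage_open[OF U(1) open_ball[of "\<phi> (\<gamma> t0)" "R / 4"]] U(2) R(1) by (simp_all add: N_def)
  obtain d where d: "0 < d" "\<forall>s. 0 \<le> s \<and> \<bar>s - t0\<bar> < d \<longrightarrow> \<gamma> s \<in> N"
    using icurve_near[OF \<gamma>(1) t0 N] by blast
  have "\<gamma> t = \<gamma>' t" if s: "0 \<le> s" "s \<le> t" "\<bar>s - t0\<bar> < min d (\<rho> / 2)" "\<bar>t - t0\<bar> < min d (\<rho> / 2)" "\<gamma> s = \<gamma>' s" for s t
  proof -
    have sN: "\<gamma> s \<in> N" using d(2) s(1,3) by simp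
    have ts: "0 \<le> t - s" "t - s \<le> \<rho>" using s(2,3,4) by linarith+
    have "\<gamma> (s + (t - s)) \<in> U \<and> \<phi> (\<gamma> (s + (t - s))) = u (\<phi> (\<gamma> s)) (of_real (t - s))"
      using R(5)[rule_format, of "\<lambda>t. \<gamma> (s + t)" "t - s"] icurve_shift[OF \<gamma>(1) s(1)] sN ts by (simp add: N_def)
    moreover have "\<gamma>' (s + (t - s)) \<in> U \<and> \<phi> (\<gamma>' (s + (t - s))) = u (\<phi> (\<gamma>' s)) (of_real (t - s))"
      using R(5)[rule_format, of "\<lambda>t. \<gamma>' (s + t)" "t - s"] icurve_shift[OF \<gamma>(2) s(1)] sN ts s(5) by (simp add: N_def)
    ultimately have "\<gamma> t \<in> U" "\<gamma>' t \<in> U" "\<phi> (\<gamma> t) = \<phi> (\<gamma>' t)" using s(5) by simp_all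
    then show ?thesis using chart_inj[OF U(1)] by (auto dest: inj_onD)
  qed
  then show "\<exists>d>0. \<forall>s t. 0 \<le> s \<and> s \<le> t \<and> \<bar>s - t0\<bar> < d \<and> \<bar>t - t0\<bar> < d \<and> \<gamma> s = \<gamma>' s \<longrightarrow> \<gamma> t = \<gamma>' t"
    using d(1) R(3) by (intro exI[of _ "min d (\<rho> / 2)"]) (simp, blast)
qed

end


section \<open>The flow near and away from the equilibrium\<close>

lemma zero_islimpt_of_real_interval:
  assumes "0 < r"
  shows "(0::complex) islimpt of_real ` {0<..<r}"
  unfolding islimpt_approachable
proof (intro allI impI)
  fix e :: real assume e: "0 < e"
  define x where "x = min (e / 2) (r / 2)"
  have "0 < x" "x < e" "x < r" using e assms by (auto simp: x_def)
  then show "\<exists>x'\<in>of_real ` {0<..<r}. x' \<noteq> 0 \<and> dist x' (0::complex) < e"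
    by (intro bexI[of _ "of_real x"]) auto
qed

locale gas_flow = vfield_manifold X A V
  for X :: "'a topology" and A :: "('a, 'n::finite) chart set" and V :: "('a, 'n) vfield" +
  fixes \<theta> :: "real \<Rightarrow> 'a \<Rightarrow> 'a" and p :: 'a
  assumes equil: "equilibrium_point X A V p"
    and flow: "forward_flow X A V \<theta>"
    and gas: "globally_asymptotically_stable X \<theta> p"
begin

lemma flow_icurve: "z \<in> topspace X \<Longrightarrow> icurve (\<lambda>t. \<theta> t z)"
  and flow_0: "z \<in> topspace X \<Longrightarrow> \<theta> 0 z = z"
  using flow by (auto simp: forward_flow_def)

lemma flow_topspace: "z \<in> topspace X \<Longrightarrow> 0 \<le> t \<Longrightarrow> \<theta> t z \<in> topspace X"
  using icurve_topspace[OF flow_icurve] by blast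

lemma flow_add:
  assumes "z \<in> topspace X" "0 \<le> s" "0 \<le> t"
  shows "\<theta> (s + t) z = \<theta> t (\<theta> s z)"
  using icurve_unique[OF icurve_shift[OF flow_icurve[OF assms(1)] assms(2)]
      flow_icurve[OF flow_topspace[OF assms(1,2)]] _ assms(3)] flow_0[OF flow_topspace[OF assms(1,2)]]
  by simp

lemma flow_diff:
  assumes "z \<in> topspace X" "0 \<le> s" "s \<le> t"
  shows "\<theta> t z = \<theta> (t - s) (\<theta> s z)"
  using flow_add[of z s "t - s"] assms by simp

lemma p_topspace: "p \<in> topspace X" using equil by (simp add: equilibrium_point_def)

lemma flow_p:
  assumes "0 \<le> t"
  shows "\<theta> t p = p"
proof -
  have "icurve (\<lambda>t. p)"
    unfolding integral_curve_def using equil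
    by (auto simp: equilibrium_point_def p_topspace)
  from icurve_unique[OF flow_icurve[OF p_topspace] this _ assms] flow_0[OF p_topspace]
  show ?thesis by simp
qed

text \<open>The short-time flow is a local biholomorphism, uniformly for base points in
  \<open>N\<close>. The facts are phrased through neighbourhoods and germs so that they can be
  chained along an orbit; the third one, which writes a germ at \<open>y\<close> as the pullback of
  a germ at \<open>\<theta> \<tau> y\<close>, expresses local invertibility.\<close>

lemma flow_local:
  assumes x0: "x0 \<in> topspace X"
  obtains N \<sigma> where "openin X N" "x0 \<in> N" "0 < \<sigma>"
    "\<forall>\<tau> y Q. 0 \<le> \<tau> \<and> \<tau> \<le> \<sigma> \<and> y \<in> N \<and> openin X Q \<and> \<theta> \<tau> y \<in> Q \<longrightarrow>
      (\<exists>O'. openin X O' \<and> y \<in> O' \<and> (\<forall>y'\<in>O'. \<theta> \<tau> y' \<in> Q))"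
    "\<forall>\<tau> y f. 0 \<le> \<tau> \<and> \<tau> \<le> \<sigma> \<and> y \<in> N \<and> hol_at f (\<theta> \<tau> y) \<longrightarrow> hol_at (\<lambda>y'. f (\<theta> \<tau> y')) y"
    "\<forall>\<tau> y f. 0 \<le> \<tau> \<and> \<tau> \<le> \<sigma> \<and> y \<in> N \<and> hol_at f y \<longrightarrow>
      (\<exists>g O'. hol_at g (\<theta> \<tau> y) \<and> openin X O' \<and> y \<in> O' \<and> (\<forall>y'\<in>O'. f y' = g (\<theta> \<tau> y')))"
    "\<forall>\<tau> y y'. 0 \<le> \<tau> \<and> \<tau> \<le> \<sigma> \<and> y \<in> N \<and> y' \<in> N \<and> \<theta> \<tau> y = \<theta> \<tau> y' \<longrightarrow> y = y'"
proof -
  obtain U \<phi> where U: "(U, \<phi>) \<in> A" "x0 \<in> U" using exists_chart[OF x0] by blast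
  let ?a = "\<phi> x0"
  obtain R \<rho> and u :: "complex^'n \<Rightarrow> complex \<Rightarrow> complex^'n" where R: "0 < R" "R \<le> 1" "0 < \<rho>" "cball ?a R \<subseteq> \<phi> ` U"
    "\<forall>\<gamma> t. icurve \<gamma> \<and> \<gamma> 0 \<in> U \<and> \<phi> (\<gamma> 0) \<in> ball ?a (R / 4) \<and> 0 \<le> t \<and> t \<le> \<rho> \<longrightarrow>
      \<gamma> t \<in> U \<and> \<phi> (\<gamma> t) \<in> ball ?a (R / 2) \<and> \<phi> (\<gamma> t) = u (\<phi> (\<gamma> 0)) (of_real t)"
    "\<forall>z\<in>ball ?a (R / 2). \<forall>i. (\<lambda>\<tau>. u z \<tau> $ i) holomorphic_on cball 0 \<rho>"
    "\<forall>\<tau>\<in>cball 0 \<rho>. holo_map (\<lambda>z. u z \<tau>) (ball ?a (R / 2))"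
    by (rule flow_box_coords[OF U zero_less_one])
  \<comment> \<open>A second box inside the first: orbits that start in it still lie in the domain
    of the first box at time \<open>\<tau>\<close>, so the flow can be continued, and reversed, from
    \<open>\<theta> \<tau> y\<close>.\<close>
  have R4: "0 < R / 4" using R by simp
  obtain R' \<rho>' and u' :: "complex^'n \<Rightarrow> complex \<Rightarrow> complex^'n" where R': "0 < R'" "R' \<le> R / 4" "0 < \<rho>'" "cball ?a R' \<subseteq> \<phi> ` U"
    "\<forall>\<gamma> t. icurve \<gamma> \<and> \<gamma> 0 \<in> U \<and> \<phi> (\<gamma> 0) \<in> ball ?a (R' / 4) \<and> 0 \<le> t \<and> t \<le> \<rho>' \<longrightarrow>
      \<gamma> t \<in> U \<and> \<phi> (\<gamma> t) \<in> ball ?a (R' / 2) \<and> \<phi> (\<gamma> t) = u' (\<phi> (\<gamma> 0)) (of_real t)"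
    "\<forall>z\<in>ball ?a (R' / 2). \<forall>i. (\<lambda>\<tau>. u' z \<tau> $ i) holomorphic_on cball 0 \<rho>'"
    "\<forall>\<tau>\<in>cball 0 \<rho>'. holo_map (\<lambda>z. u' z \<tau>) (ball ?a (R' / 2))"
    by (rule flow_box_coords[OF U R4])
  \<comment> \<open>With \<open>\<tau> \<le> \<rho> / 4\<close> and
    \<open>norm s < \<rho> / 2\<close> the time \<open>\<tau> + s\<close> stays in the disc of
    radius \<open>\<rho>\<close>, where \<open>u\<close> is holomorphic in time.\<close>
  define \<sigma> where "\<sigma> = min (\<rho> / 4) \<rho>'"
  have \<sigma>: "0 < \<sigma>" "\<sigma> \<le> \<rho> / 4" "\<sigma> \<le> \<rho>'" using R(3) R'(3) by (auto simp: \<sigma>_def)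
  define N where "N = {y \<in> U. \<phi> y \<in> ball ?a (R' / 4)}"
  have N: "openin X N" "x0 \<in> N"
    using chart_preimage_open[OF U(1) open_ball[of "\<phi> (x0)" "R' / 4"]] U(2) R'(1) by (simp_all add: N_def)
  have NX: "N \<subseteq> topspace X" by (rule openin_subset[OF N(1)])
  have sub: "ball ?a (R' / 4) \<subseteq> ball ?a (R / 4)" "ball ?a (R' / 2) \<subseteq> ball ?a (R / 4)"
    "ball ?a (R / 4) \<subseteq> ball ?a (R / 2)" using R(1) R'(1,2) by (auto intro!: subset_ball)
  have box: "\<theta> \<tau> y \<in> U" "\<phi> (\<theta> \<tau> y) = u (\<phi> y) (of_real \<tau>)"
    if "y \<in> U" "\<phi> y \<in> ball ?a (R / 4)" "0 \<le> \<tau>" "\<tau> \<le> \<rho>" for \<tau> y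
  proof -
    have y: "y \<in> topspace X" using chart_subset[OF U(1)] that(1) by blast
    show "\<theta> \<tau> y \<in> U" "\<phi> (\<theta> \<tau> y) = u (\<phi> y) (of_real \<tau>)"
      using R(5)[rule_format, of "\<lambda>t. \<theta> t y" \<tau>] flow_icurve[OF y] flow_0[OF y] that by auto
  qed
  have step: "\<theta> \<tau> y \<in> U" "\<phi> (\<theta> \<tau> y) \<in> ball ?a (R / 4)" "\<phi> (\<theta> \<tau> y) = u (\<phi> y) (of_real \<tau>)"
    "\<phi> y \<in> ball ?a (R / 2)" "y \<in> U" "y \<in> topspace X"
    if "y \<in> N" "0 \<le> \<tau>" "\<tau> \<le> \<sigma>" for \<tau> y
  proof -
    have y: "y \<in> U" "\<phi> y \<in> ball ?a (R' / 4)" "y \<in> topspace X" using that NX by (auto simp: N_def)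
    have "\<phi> (\<theta> \<tau> y) \<in> ball ?a (R' / 2)"
      using R'(5)[rule_format, of "\<lambda>t. \<theta> t y" \<tau>] flow_icurve[OF y(3)] flow_0[OF y(3)] y that \<sigma> by auto
    then show "\<phi> (\<theta> \<tau> y) \<in> ball ?a (R / 4)" using sub by blast
    have y4: "\<phi> y \<in> ball ?a (R / 4)" using y sub by blast
    have "\<tau> \<le> \<rho>" using that(3) \<sigma> R(3) by linarith
    then show "\<theta> \<tau> y \<in> U" "\<phi> (\<theta> \<tau> y) = u (\<phi> y) (of_real \<tau>)" using box[OF y(1) y4 that(2)] by auto
    show "\<phi> y \<in> ball ?a (R / 2)" using y4 sub by blast
  qed (use that NX in \<open>auto simp: N_def\<close>)
  txt \<open>Time reversal: by the identity theorem in the time variable, the flow for time \<open>- \<tau>\<close> undoes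
    \<open>\<theta> \<tau>\<close>.\<close>
  have rev_flow: "u (\<phi> (\<theta> \<tau> y)) (- of_real \<tau>) = \<phi> y" if y: "y \<in> N" and \<tau>: "0 \<le> \<tau>" "\<tau> \<le> \<sigma>" for \<tau> y
  proof -
    note st = step[OF y \<tau>]
    have "u (\<phi> (\<theta> \<tau> y)) (- of_real \<tau>) $ i = \<phi> y $ i" for i
    proof -
      \<comment> \<open>For small \<open>s > 0\<close> both terms are coordinates of the point at
        time \<open>\<tau> + s\<close>, so \<open>F\<close> vanishes there; at
        \<open>s = - \<tau>\<close> the second term is the starting point.\<close>
      define F where "F s = u (\<phi> (\<theta> \<tau> y)) s $ i - u (\<phi> y) (of_real \<tau> + s) $ i" for s
      have "F (- of_real \<tau>) = 0"
      proof (rule analytic_continuation[where f = F and S = "ball 0 (\<rho> / 2)" and U = "of_real ` {0<..<\<rho> / 2}"])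
        have 1: "(\<lambda>s. u (\<phi> (\<theta> \<tau> y)) s $ i) holomorphic_on ball 0 (\<rho> / 2)"
          by (rule holomorphic_on_subset[of _ "cball 0 \<rho>"]) (use R(3,6) st(2) sub in auto)
        have 2: "(\<lambda>s. u (\<phi> y) s $ i) holomorphic_on cball 0 \<rho>" using R(6) st(4) by blast
        have 3: "(\<lambda>s. of_real \<tau> + s) ` ball 0 (\<rho> / 2) \<subseteq> cball (0::complex) \<rho>"
        proof clarify
          fix s :: complex assume "s \<in> ball 0 (\<rho> / 2)"
          then have "norm (of_real \<tau> + s) \<le> \<rho>"
            using norm_triangle_ineq[of "of_real \<tau>" s] \<tau> \<sigma> by simp
          then show "of_real \<tau> + s \<in> cball 0 \<rho>" by simp
        qed
        have "(\<lambda>s. u (\<phi> y) s $ i) \<circ> (\<lambda>s. of_real \<tau> + s) holomorphic_on ball 0 (\<rho> / 2)"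
          by (rule holomorphic_on_compose_gen[OF _ 2 3]) (intro holomorphic_intros)
        then show "F holomorphic_on ball 0 (\<rho> / 2)"
          unfolding F_def[abs_def] using 1 by (auto intro!: holomorphic_on_diff simp: comp_def)
        show "of_real ` {0<..<\<rho> / 2} \<subseteq> ball (0::complex) (\<rho> / 2)" by auto
        show "(0::complex) islimpt of_real ` {0<..<\<rho> / 2}"
          by (rule zero_islimpt_of_real_interval) (use R(3) in simp)
        fix s :: complex assume "s \<in> of_real ` {0<..<\<rho> / 2}"
        then obtain r where r: "s = of_real r" "0 < r" "r < \<rho> / 2" by auto
        have "u (\<phi> (\<theta> \<tau> y)) (of_real r) = \<phi> (\<theta> r (\<theta> \<tau> y))"
          using box(2)[OF st(1,2), of r] r by simp
        also have "\<dots> = \<phi> (\<theta> (\<tau> + r) y)" using flow_add[OF st(6) \<tau>(1), of r] r by simp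
        also have "\<dots> = u (\<phi> y) (of_real (\<tau> + r))"
        proof (rule box(2)[OF st(5)])
          show "\<phi> y \<in> ball ?a (R / 4)" using y sub by (auto simp: N_def)
        qed (use r \<tau> \<sigma> in auto)
        finally show "F s = 0" by (simp add: F_def r)
      qed (use R(3) \<tau> \<sigma> in auto)
      moreover have "u (\<phi> y) 0 = \<phi> y"
        using step(3)[OF y order_refl less_imp_le[OF \<sigma>(1)]] flow_0[OF st(6)] by simp
      ultimately show ?thesis by (simp add: F_def)
    qed
    then show ?thesis by (simp add: vec_eq_iff)
  qed
  have hu: "holo_map (\<lambda>z. u z (of_real \<tau>)) (ball ?a (R / 2))" "holo_map (\<lambda>z. u z (- of_real \<tau>)) (ball ?a (R / 2))"
    if "0 \<le> \<tau>" "\<tau> \<le> \<sigma>" for \<tau>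
    using R(3,7) that \<sigma> by auto
  have pre: "open {z \<in> ball ?a (R / 2). F z \<in> S}" if "holo_map F (ball ?a (R / 2))" "open S" for F :: "complex^'n \<Rightarrow> complex^'n" and S
    using continuous_open_preimage[OF holo_map_continuous_on[OF that(1)] open_ball that(2)]
    by (simp add: vimage_def Int_def)
  show ?thesis
  proof (rule that[OF N \<sigma>(1)]; intro allI impI)
    fix \<tau> y Q assume a: "0 \<le> \<tau> \<and> \<tau> \<le> \<sigma> \<and> y \<in> N \<and> openin X Q \<and> \<theta> \<tau> y \<in> Q"
    then have \<tau>: "0 \<le> \<tau>" "\<tau> \<le> \<sigma>" and y: "y \<in> N" and Q: "openin X Q" "\<theta> \<tau> y \<in> Q" by auto
    define T where "T = {z \<in> ball ?a (R / 2). u z (of_real \<tau>) \<in> \<phi> ` (U \<inter> Q)}"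
    have T: "open T" unfolding T_def by (rule pre[OF hu(1)[OF \<tau>] chart_image_open[OF U(1) Q(1)]])
    show "\<exists>O'. openin X O' \<and> y \<in> O' \<and> (\<forall>y'\<in>O'. \<theta> \<tau> y' \<in> Q)"
    proof (intro exI[of _ "N \<inter> {y \<in> U. \<phi> y \<in> T}"] conjI ballI)
      show "openin X (N \<inter> {y \<in> U. \<phi> y \<in> T})" by (intro openin_Int N chart_preimage_open[OF U(1) T])
      have "\<phi> (\<theta> \<tau> y) \<in> \<phi> ` (U \<inter> Q)" using step(1)[OF y \<tau>] Q(2) by blast
      then show "y \<in> N \<inter> {y \<in> U. \<phi> y \<in> T}" using y step(3-5)[OF y \<tau>] by (simp add: T_def)
      fix y' assume y': "y' \<in> N \<inter> {y \<in> U. \<phi> y \<in> T}"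
      then have "\<phi> (\<theta> \<tau> y') \<in> \<phi> ` (U \<inter> Q)" using step(3)[of y' \<tau>] \<tau> by (simp add: T_def)
      then show "\<theta> \<tau> y' \<in> Q" using step(1)[of y' \<tau>] \<tau> y' chart_inj[OF U(1)] by (auto dest: inj_onD)
    qed
  next
    fix \<tau> y f assume a: "0 \<le> \<tau> \<and> \<tau> \<le> \<sigma> \<and> y \<in> N \<and> hol_at f (\<theta> \<tau> y)"
    then have \<tau>: "0 \<le> \<tau>" "\<tau> \<le> \<sigma>" and y: "y \<in> N" and f: "hol_at f (\<theta> \<tau> y)" by auto
    obtain g e where g: "0 < e" "ball (\<phi> (\<theta> \<tau> y)) e \<subseteq> \<phi> ` U" "holo_fun g (ball (\<phi> (\<theta> \<tau> y)) e)"
      "\<forall>y'\<in>U. \<phi> y' \<in> ball (\<phi> (\<theta> \<tau> y)) e \<longrightarrow> f y' = g (\<phi> y')"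
      by (rule hol_at_chart[OF f U(1) step(1)[OF y \<tau>]])
    define T where "T = {z \<in> ball ?a (R / 2). u z (of_real \<tau>) \<in> ball (\<phi> (\<theta> \<tau> y)) e} \<inter> ball ?a (R' / 4)"
    have T: "open T" unfolding T_def by (intro open_Int pre[OF hu(1)[OF \<tau>]] open_ball)
    show "hol_at (\<lambda>y'. f (\<theta> \<tau> y')) y"
    proof (rule hol_atI[OF U(1) step(5)[OF y \<tau>] T])
      show "\<phi> y \<in> T" using y step[OF y \<tau>] g(1) by (simp add: T_def N_def)
      have "holo_map (\<lambda>z. u z (of_real \<tau>)) T" by (rule holo_map_subset[OF hu(1)[OF \<tau>]]) (auto simp: T_def)
      then show "holo_fun (\<lambda>z. g (u z (of_real \<tau>))) T" by (rule holo_fun_compose[OF _ g(3)]) (auto simp: T_def)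
      fix y' assume y': "y' \<in> U" "\<phi> y' \<in> T"
      then have "y' \<in> N" by (simp add: N_def T_def)
      from step[OF this \<tau>] g(4) y' show "f (\<theta> \<tau> y') = g (u (\<phi> y') (of_real \<tau>))" by (simp add: T_def)
    qed
  next
    fix \<tau> y f assume a: "0 \<le> \<tau> \<and> \<tau> \<le> \<sigma> \<and> y \<in> N \<and> hol_at f y"
    then have \<tau>: "0 \<le> \<tau>" "\<tau> \<le> \<sigma>" and y: "y \<in> N" and f: "hol_at f y" by auto
    note st = step[OF y \<tau>]
    obtain g e where g: "0 < e" "ball (\<phi> y) e \<subseteq> \<phi> ` U" "holo_fun g (ball (\<phi> y) e)"
      "\<forall>y'\<in>U. \<phi> y' \<in> ball (\<phi> y) e \<longrightarrow> f y' = g (\<phi> y')"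
      by (rule hol_at_chart[OF f U(1) st(5)])
    define T where "T = {z \<in> ball ?a (R / 2). u z (- of_real \<tau>) \<in> ball (\<phi> y) e}"
    have T: "open T" unfolding T_def by (rule pre[OF hu(2)[OF \<tau>] open_ball])
    have "holo_map (\<lambda>z. u z (- of_real \<tau>)) T" by (rule holo_map_subset[OF hu(2)[OF \<tau>]]) (auto simp: T_def)
    then have h: "holo_fun (\<lambda>z. g (u z (- of_real \<tau>))) T" by (rule holo_fun_compose[OF _ g(3)]) (auto simp: T_def)
    show "\<exists>g O'. hol_at g (\<theta> \<tau> y) \<and> openin X O' \<and> y \<in> O' \<and> (\<forall>y'\<in>O'. f y' = g (\<theta> \<tau> y'))"
    proof (intro exI[of _ "\<lambda>x. g (u (\<phi> x) (- of_real \<tau>))"] exI[of _ "N \<inter> {y' \<in> U. \<phi> y' \<in> ball (\<phi> y) e}"] conjI ballI)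
      have "\<phi> (\<theta> \<tau> y) \<in> ball ?a (R / 2)" using st(2) sub by blast
      then have "\<phi> (\<theta> \<tau> y) \<in> T" using rev_flow[OF y \<tau>] g(1) by (simp add: T_def)
      then show "hol_at (\<lambda>x. g (u (\<phi> x) (- of_real \<tau>))) (\<theta> \<tau> y)"
        by (rule hol_at_chart_compose[OF U(1) st(1) T _ h])
      show "openin X (N \<inter> {y' \<in> U. \<phi> y' \<in> ball (\<phi> y) e})"
        by (intro openin_Int N chart_preimage_open[OF U(1) open_ball])
      show "y \<in> N \<inter> {y' \<in> U. \<phi> y' \<in> ball (\<phi> y) e}" using y st g(1) by simp
      fix y' assume "y' \<in> N \<inter> {y' \<in> U. \<phi> y' \<in> ball (\<phi> y) e}"
      then show "f y' = g (u (\<phi> (\<theta> \<tau> y')) (- of_real \<tau>))" using rev_flow[of y' \<tau>] \<tau> g(4) by simp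
    qed
  next
    fix \<tau> y y' assume a: "0 \<le> \<tau> \<and> \<tau> \<le> \<sigma> \<and> y \<in> N \<and> y' \<in> N \<and> \<theta> \<tau> y = \<theta> \<tau> y'"
    then have "\<phi> y = \<phi> y'" using rev_flow[of y \<tau>] rev_flow[of y' \<tau>] by simp
    then show "y = y'" using a chart_inj[OF U(1)] by (auto simp: N_def dest: inj_onD)
  qed
qed

text \<open>The short-time statements are composed along the orbit of \<open>x\<close> by continuous
  induction. Continuity is carried along because the step for \<open>?G\<close> needs a
  neighbourhood of \<open>x\<close> that the flow moves into a given one. \<open>?G\<close> does the
  work of an inverse of \<open>\<theta> t\<close>, which need not exist globally.\<close>

lemma flow_regular:
  assumes x: "x \<in> topspace X" and t: "0 \<le> t"
  shows "\<forall>Q. openin X Q \<and> \<theta> t x \<in> Q \<longrightarrow> (\<exists>O'. openin X O' \<and> x \<in> O' \<and> (\<forall>y\<in>O'. \<theta> t y \<in> Q))" (is "?C t")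
    and "\<forall>f. hol_at f (\<theta> t x) \<longrightarrow> hol_at (\<lambda>y. f (\<theta> t y)) x" (is "?H t")
    and "\<forall>f. hol_at f x \<longrightarrow> (\<exists>g O'. hol_at g (\<theta> t x) \<and> openin X O' \<and> x \<in> O' \<and> (\<forall>y\<in>O'. f y = g (\<theta> t y)))" (is "?G t")
proof -
  define P where "P t \<longleftrightarrow> ?C t \<and> ?H t \<and> ?G t" for t
  have "P t"
  proof (rule real_induction_local[where P = P, OF _ _ t])
    show "P 0"
      unfolding P_def
    proof (intro conjI allI impI)
      fix Q assume Q: "openin X Q \<and> \<theta> 0 x \<in> Q"
      then have "\<theta> 0 y \<in> Q" if "y \<in> Q" for y using that flow_0 openin_subset by fastforce
      then show "\<exists>O'. openin X O' \<and> x \<in> O' \<and> (\<forall>y\<in>O'. \<theta> 0 y \<in> Q)" using Q flow_0[OF x] by auto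
    next
      fix f assume "hol_at f (\<theta> 0 x)"
      then have "hol_at f x" by (simp add: flow_0[OF x])
      then show "hol_at (\<lambda>y. f (\<theta> 0 y)) x" by (rule hol_at_cong[OF _ openin_topspace x]) (simp add: flow_0)
    next
      fix f assume "hol_at f x"
      then show "\<exists>g O'. hol_at g (\<theta> 0 x) \<and> openin X O' \<and> x \<in> O' \<and> (\<forall>y\<in>O'. f y = g (\<theta> 0 y))"
        by (intro exI[of _ f] exI[of _ "topspace X"]) (simp add: flow_0 x)
    qed
  next
    fix t0 :: real assume t0: "0 \<le> t0"
    obtain N \<sigma> where N: "openin X N" "\<theta> t0 x \<in> N" "0 < \<sigma>"
      "\<forall>\<tau> y Q. 0 \<le> \<tau> \<and> \<tau> \<le> \<sigma> \<and> y \<in> N \<and> openin X Q \<and> \<theta> \<tau> y \<in> Q \<longrightarrow>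
        (\<exists>O'. openin X O' \<and> y \<in> O' \<and> (\<forall>y'\<in>O'. \<theta> \<tau> y' \<in> Q))"
      "\<forall>\<tau> y f. 0 \<le> \<tau> \<and> \<tau> \<le> \<sigma> \<and> y \<in> N \<and> hol_at f (\<theta> \<tau> y) \<longrightarrow> hol_at (\<lambda>y'. f (\<theta> \<tau> y')) y"
      "\<forall>\<tau> y f. 0 \<le> \<tau> \<and> \<tau> \<le> \<sigma> \<and> y \<in> N \<and> hol_at f y \<longrightarrow>
        (\<exists>g O'. hol_at g (\<theta> \<tau> y) \<and> openin X O' \<and> y \<in> O' \<and> (\<forall>y'\<in>O'. f y' = g (\<theta> \<tau> y')))"
      "\<forall>\<tau> y y'. 0 \<le> \<tau> \<and> \<tau> \<le> \<sigma> \<and> y \<in> N \<and> y' \<in> N \<and> \<theta> \<tau> y = \<theta> \<tau> y' \<longrightarrow> y = y'"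
      by (rule flow_local[OF flow_topspace[OF x t0]])
    obtain d where d: "0 < d" "\<forall>s. 0 \<le> s \<and> \<bar>s - t0\<bar> < d \<longrightarrow> \<theta> s x \<in> N"
      using icurve_near[OF flow_icurve[OF x] t0 N(1,2)] by blast
    have "P t"
      if s: "0 \<le> s" "s \<le> t" "\<bar>s - t0\<bar> < min d (\<sigma> / 2)" "\<bar>t - t0\<bar> < min d (\<sigma> / 2)" and Ps: "P s" for s t
    proof -
      note IH = Ps[unfolded P_def]
      define \<tau> where "\<tau> = t - s"
      have \<tau>: "0 \<le> \<tau>" "\<tau> \<le> \<sigma>" using s(2,3,4) unfolding \<tau>_def by linarith+
      have y: "\<theta> s x \<in> N" using d(2) s(1,3) by simp
      have comp: "\<theta> t z = \<theta> \<tau> (\<theta> s z)" if "z \<in> topspace X" for z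
        using flow_diff[OF that s(1,2)] by (simp add: \<tau>_def)
      show ?thesis
        unfolding P_def
      proof (intro conjI allI impI)
        fix Q assume Q: "openin X Q \<and> \<theta> t x \<in> Q"
        then have "0 \<le> \<tau> \<and> \<tau> \<le> \<sigma> \<and> \<theta> s x \<in> N \<and> openin X Q \<and> \<theta> \<tau> (\<theta> s x) \<in> Q" using \<tau> y comp[OF x] by simp
        from N(4)[rule_format, OF this] obtain Q' where Q': "openin X Q'" "\<theta> s x \<in> Q'" "\<forall>y'\<in>Q'. \<theta> \<tau> y' \<in> Q" by blast
        then obtain Q'' where Q'': "openin X Q''" "x \<in> Q''" "\<forall>y\<in>Q''. \<theta> s y \<in> Q'" using IH by blast
        have "\<theta> t z \<in> Q" if "z \<in> Q''" for z
          using that Q' Q'' comp[of z] openin_subset[OF Q''(1)] by auto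
        then show "\<exists>O'. openin X O' \<and> x \<in> O' \<and> (\<forall>y\<in>O'. \<theta> t y \<in> Q)" using Q'' by blast
      next
        fix f assume "hol_at f (\<theta> t x)"
        then have "0 \<le> \<tau> \<and> \<tau> \<le> \<sigma> \<and> \<theta> s x \<in> N \<and> hol_at f (\<theta> \<tau> (\<theta> s x))" using \<tau> y comp[OF x] by simp
        from N(5)[rule_format, OF this] have "hol_at (\<lambda>y'. f (\<theta> \<tau> y')) (\<theta> s x)" .
        then have "hol_at (\<lambda>z. f (\<theta> \<tau> (\<theta> s z))) x" using IH by blast
        then show "hol_at (\<lambda>z. f (\<theta> t z)) x" by (rule hol_at_cong[OF _ openin_topspace x]) (simp add: comp)
      next
        fix f assume "hol_at f x"
        then obtain g Q where g: "hol_at g (\<theta> s x)" "openin X Q" "x \<in> Q" "\<forall>y\<in>Q. f y = g (\<theta> s y)" using IH by blast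
        then have "0 \<le> \<tau> \<and> \<tau> \<le> \<sigma> \<and> \<theta> s x \<in> N \<and> hol_at g (\<theta> s x)" using \<tau> y by simp
        from N(6)[rule_format, OF this] obtain h Q' where h: "hol_at h (\<theta> \<tau> (\<theta> s x))" "openin X Q'" "\<theta> s x \<in> Q'"
          "\<forall>y'\<in>Q'. g y' = h (\<theta> \<tau> y')" by blast
        then obtain Q'' where Q'': "openin X Q''" "x \<in> Q''" "\<forall>y\<in>Q''. \<theta> s y \<in> Q'" using IH by blast
        have "f z = h (\<theta> t z)" if "z \<in> Q \<inter> Q''" for z
          using that g h Q'' comp[of z] openin_subset[OF Q''(1)] by auto
        then show "\<exists>g O'. hol_at g (\<theta> t x) \<and> openin X O' \<and> x \<in> O' \<and> (\<forall>y\<in>O'. f y = g (\<theta> t y))"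
          using h(1) g Q'' by (intro exI[of _ h] exI[of _ "Q \<inter> Q''"]) (simp add: comp[OF x] openin_Int)
      qed
    qed
    then show "\<exists>d>0. \<forall>s t. 0 \<le> s \<and> s \<le> t \<and> \<bar>s - t0\<bar> < d \<and> \<bar>t - t0\<bar> < d \<and> P s \<longrightarrow> P t"
      using d(1) N(3) by (intro exI[of _ "min d (\<sigma> / 2)"]) (simp, blast)
  qed
  then show "?C t" "?H t" "?G t" unfolding P_def by simp_all
qed

lemma flow_continuous:
  assumes "x \<in> topspace X" "0 \<le> t" "openin X Q" "\<theta> t x \<in> Q"
  obtains O' where "openin X O'" "x \<in> O'" "\<forall>y\<in>O'. \<theta> t y \<in> Q"
  using flow_regular(1)[OF assms(1,2)] assms(3,4) by blast

text \<open>Where two orbits meet at time \<open>t0\<close>, the local injectivity shows that they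
  already met slightly earlier; where they differ, disjoint neighbourhoods keep them apart for
  nearby times.\<close>

lemma flow_injective:
  assumes x: "x \<in> topspace X" "y \<in> topspace X" and t: "0 \<le> t" and eq: "\<theta> t x = \<theta> t y"
  shows "x = y"
proof -
  have "\<theta> t x = \<theta> t y \<longrightarrow> x = y"
  proof (rule real_induction_local[where P = "\<lambda>t. \<theta> t x = \<theta> t y \<longrightarrow> x = y", OF _ _ t])
    show "\<theta> 0 x = \<theta> 0 y \<longrightarrow> x = y" using flow_0 x by simp
  next
    fix t0 :: real assume t0: "0 \<le> t0"
    show "\<exists>d>0. \<forall>s t. 0 \<le> s \<and> s \<le> t \<and> \<bar>s - t0\<bar> < d \<and> \<bar>t - t0\<bar> < d \<and> (\<theta> s x = \<theta> s y \<longrightarrow> x = y) \<longrightarrow> \<theta> t x = \<theta> t y \<longrightarrow> x = y"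
    proof (cases "\<theta> t0 x = \<theta> t0 y")
      case True
      obtain N \<sigma> where N: "openin X N" "\<theta> t0 x \<in> N" "0 < \<sigma>"
        "\<forall>\<tau> y Q. 0 \<le> \<tau> \<and> \<tau> \<le> \<sigma> \<and> y \<in> N \<and> openin X Q \<and> \<theta> \<tau> y \<in> Q \<longrightarrow>
          (\<exists>O'. openin X O' \<and> y \<in> O' \<and> (\<forall>y'\<in>O'. \<theta> \<tau> y' \<in> Q))"
        "\<forall>\<tau> y f. 0 \<le> \<tau> \<and> \<tau> \<le> \<sigma> \<and> y \<in> N \<and> hol_at f (\<theta> \<tau> y) \<longrightarrow> hol_at (\<lambda>y'. f (\<theta> \<tau> y')) y"
        "\<forall>\<tau> y f. 0 \<le> \<tau> \<and> \<tau> \<le> \<sigma> \<and> y \<in> N \<and> hol_at f y \<longrightarrow>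
          (\<exists>g O'. hol_at g (\<theta> \<tau> y) \<and> openin X O' \<and> y \<in> O' \<and> (\<forall>y'\<in>O'. f y' = g (\<theta> \<tau> y')))"
        "\<forall>\<tau> y y'. 0 \<le> \<tau> \<and> \<tau> \<le> \<sigma> \<and> y \<in> N \<and> y' \<in> N \<and> \<theta> \<tau> y = \<theta> \<tau> y' \<longrightarrow> y = y'"
        by (rule flow_local[OF flow_topspace[OF x(1) t0]])
      obtain d where d: "0 < d" "\<forall>s. 0 \<le> s \<and> \<bar>s - t0\<bar> < d \<longrightarrow> \<theta> s x \<in> N"
        using icurve_near[OF flow_icurve[OF x(1)] t0 N(1,2)] by blast
      obtain d' where d': "0 < d'" "\<forall>s. 0 \<le> s \<and> \<bar>s - t0\<bar> < d' \<longrightarrow> \<theta> s y \<in> N"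
        using icurve_near[OF flow_icurve[OF x(2)] t0 N(1)] N(2) True by auto
      have "x = y" if s: "0 \<le> s" "s \<le> t" "\<bar>s - t0\<bar> < min (min d d') (\<sigma> / 2)" "\<bar>t - t0\<bar> < min (min d d') (\<sigma> / 2)"
          and IH: "\<theta> s x = \<theta> s y \<longrightarrow> x = y" and e: "\<theta> t x = \<theta> t y" for s t
      proof -
        have "\<theta> (t - s) (\<theta> s x) = \<theta> (t - s) (\<theta> s y)"
          using e flow_diff[OF x(1) s(1,2)] flow_diff[OF x(2) s(1,2)] by simp
        moreover have "\<theta> s x \<in> N" "\<theta> s y \<in> N" using d(2) d'(2) s(1,3) by simp_all
        moreover have "0 \<le> t - s" "t - s \<le> \<sigma>" using s(2,3,4) by linarith+
        ultimately have "\<theta> s x = \<theta> s y" using N(7) by blast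
        then show ?thesis using IH by blast
      qed
      then show ?thesis using d(1) d'(1) N(3) by (intro exI[of _ "min (min d d') (\<sigma> / 2)"]) auto
    next
      case False
      then obtain N N' where N: "openin X N" "openin X N'" "\<theta> t0 x \<in> N" "\<theta> t0 y \<in> N'" "disjnt N N'"
        using Hausdorff flow_topspace[OF x(1) t0] flow_topspace[OF x(2) t0] unfolding Hausdorff_space_def by meson
      obtain d where d: "0 < d" "\<forall>s. 0 \<le> s \<and> \<bar>s - t0\<bar> < d \<longrightarrow> \<theta> s x \<in> N"
        using icurve_near[OF flow_icurve[OF x(1)] t0 N(1,3)] by blast
      obtain d' where d': "0 < d'" "\<forall>s. 0 \<le> s \<and> \<bar>s - t0\<bar> < d' \<longrightarrow> \<theta> s y \<in> N'"
        using icurve_near[OF flow_icurve[OF x(2)] t0 N(2,4)] by blast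
      have "\<theta> t x \<noteq> \<theta> t y" if "0 \<le> t" "\<bar>t - t0\<bar> < min d d'" for t
        using d(2)[rule_format, of t] d'(2)[rule_format, of t] that N(5) by (auto simp: disjnt_iff)
      then show ?thesis using d(1) d'(1) by (intro exI[of _ "min d d'"]) auto
    qed
  qed
  then show ?thesis using eq by blast
qed

text \<open>Stability upgrades pointwise attraction: an orbit that has entered \<open>U\<close>
  stays in \<open>W\<close> forever, so the largest entry time of a finite cover works for all of
  \<open>K\<close>.\<close>

lemma flow_converges_uniformly:
  assumes K: "compactin X K" and W: "openin X W" "p \<in> W"
  obtains T where "0 \<le> T" "\<forall>t\<ge>T. \<forall>x\<in>K. \<theta> t x \<in> W"
proof -
  have KX: "K \<subseteq> topspace X" using K by (simp add: compactin_def)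
  obtain U where U: "openin X U" "p \<in> U" "\<forall>t\<ge>0. \<forall>z\<in>U. \<theta> t z \<in> W"
    using gas W unfolding globally_asymptotically_stable_def by blast
  have "\<exists>t Q. 0 \<le> t \<and> openin X Q \<and> x \<in> Q \<and> (\<forall>y\<in>Q. \<theta> t y \<in> U)" if x: "x \<in> K" for x
  proof -
    have xX: "x \<in> topspace X" using x KX by blast
    have "limitin X (\<lambda>t. \<theta> t x) p at_top" using gas xX unfolding globally_asymptotically_stable_def by blast
    then have "\<forall>\<^sub>F t in at_top. \<theta> t x \<in> U" using U unfolding limitin_def by blast
    then obtain b where b: "\<And>t. b \<le> t \<Longrightarrow> \<theta> t x \<in> U" by (auto simp: eventually_at_top_linorder)
    have "\<theta> (max 0 b) x \<in> U" by (rule b) simp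
    from flow_continuous[OF xX _ U(1) this] show ?thesis by (metis max.cobounded1)
  qed
  then obtain t Q where tQ: "\<And>x. x \<in> K \<Longrightarrow> 0 \<le> t x" "\<And>x. x \<in> K \<Longrightarrow> openin X (Q x)" "\<And>x. x \<in> K \<Longrightarrow> x \<in> Q x"
    "\<And>x y. x \<in> K \<Longrightarrow> y \<in> Q x \<Longrightarrow> \<theta> (t x) y \<in> U" by metis
  have "\<exists>\<F>. finite \<F> \<and> \<F> \<subseteq> Q ` K \<and> K \<subseteq> \<Union>\<F>"
    using K tQ unfolding compactin_def by (metis (no_types, lifting) UN_I imageE subsetI)
  then obtain F where F: "finite F" "F \<subseteq> K" "K \<subseteq> \<Union>(Q ` F)"
    by (metis finite_subset_image)
  define T where "T = Max (insert 0 (t ` F))"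
  have T: "0 \<le> T" "\<And>x. x \<in> F \<Longrightarrow> t x \<le> T" using F(1) by (auto simp: T_def)
  show ?thesis
  proof (rule that[OF T(1)]; intro allI impI ballI)
    fix s x assume s: "T \<le> s" and x: "x \<in> K"
    then obtain y where y: "y \<in> F" "x \<in> Q y" using F(3) by blast
    then have "\<theta> (t y) x \<in> U" "0 \<le> t y" "t y \<le> s" using tQ F(2) T s by force+
    then show "\<theta> s x \<in> W" using U(3) flow_diff[of x "t y" s] x KX by auto
  qed
qed

end


section \<open>Joint continuity and analyticity in time\<close>

context gas_flow
begin

lemma flow_joint_continuous:
  assumes x: "x \<in> topspace X" and t0: "0 \<le> t0" and N: "openin X N" "\<theta> t0 x \<in> N"
  obtains Q d where "openin X Q" "x \<in> Q" "0 < d" "\<forall>y\<in>Q. \<forall>s. 0 \<le> s \<and> \<bar>s - t0\<bar> < d \<longrightarrow> \<theta> s y \<in> N"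
proof -
  define x1 where "x1 = \<theta> t0 x"
  obtain U \<phi> where U: "(U, \<phi>) \<in> A" "x1 \<in> U" using exists_chart[OF flow_topspace[OF x t0]] x1_def by blast
  have "open (\<phi> ` (U \<inter> N))" by (rule chart_image_open[OF U(1) N(1)])
  moreover have "\<phi> x1 \<in> \<phi> ` (U \<inter> N)" using U(2) N(2) by (auto simp: x1_def)
  ultimately obtain e where e: "0 < e" "ball (\<phi> x1) e \<subseteq> \<phi> ` (U \<inter> N)" using open_contains_ball by blast
  obtain R \<rho> and u :: "complex^'n \<Rightarrow> complex \<Rightarrow> complex^'n" where R: "0 < R" "R \<le> e" "0 < \<rho>" "cball (\<phi> x1) R \<subseteq> \<phi> ` U"
    "\<forall>\<gamma> t. icurve \<gamma> \<and> \<gamma> 0 \<in> U \<and> \<phi> (\<gamma> 0) \<in> ball (\<phi> x1) (R / 4) \<and> 0 \<le> t \<and> t \<le> \<rho> \<longrightarrow>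
      \<gamma> t \<in> U \<and> \<phi> (\<gamma> t) \<in> ball (\<phi> x1) (R / 2) \<and> \<phi> (\<gamma> t) = u (\<phi> (\<gamma> 0)) (of_real t)"
    "\<forall>z\<in>ball (\<phi> x1) (R / 2). \<forall>i. (\<lambda>\<tau>. u z \<tau> $ i) holomorphic_on cball 0 \<rho>"
    "\<forall>\<tau>\<in>cball 0 \<rho>. holo_map (\<lambda>z. u z \<tau>) (ball (\<phi> x1) (R / 2))"
    by (rule flow_box_coords[OF U e(1)])
  define N' where "N' = {y \<in> U. \<phi> y \<in> ball (\<phi> x1) (R / 4)}"
  have N': "openin X N'" "\<theta> t0 x \<in> N'"
    using chart_preimage_open[OF U(1) open_ball[of "\<phi> x1" "R / 4"]] U(2) R(1) by (simp_all add: N'_def x1_def)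
  obtain d0 where d0: "0 < d0" "\<forall>s. 0 \<le> s \<and> \<bar>s - t0\<bar> < d0 \<longrightarrow> \<theta> s x \<in> N'"
    using icurve_near[OF flow_icurve[OF x] t0 N'] by blast
  define d where "d = min d0 \<rho> / 2"
  have d: "0 < d" "d < d0" "2 * d \<le> \<rho>" using d0(1) R(3) by (auto simp: d_def)
  \<comment> \<open>A flow box only covers later times, so it is entered slightly before
    \<open>t0\<close>, or at time 0.\<close>
  define s0 where "s0 = max 0 (t0 - d)"
  have s0: "0 \<le> s0" "\<bar>s0 - t0\<bar> < d0" using t0 d by (auto simp: s0_def)
  then have "\<theta> s0 x \<in> N'" using d0(2) by blast
  then obtain Q where Q: "openin X Q" "x \<in> Q" "\<forall>y\<in>Q. \<theta> s0 y \<in> N'"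
    by (rule flow_continuous[OF x s0(1) N'(1)])
  have "\<theta> s y \<in> N" if y: "y \<in> Q" and s: "0 \<le> s" "\<bar>s - t0\<bar> < d" for s y
  proof -
    have yX: "y \<in> topspace X" using y openin_subset[OF Q(1)] by blast
    have ss: "s0 \<le> s" "s - s0 \<le> \<rho>" using s d t0 by (auto simp: s0_def)
    have y1: "\<theta> s0 y \<in> U" "\<phi> (\<theta> s0 y) \<in> ball (\<phi> x1) (R / 4)" "\<theta> s0 y \<in> topspace X"
      using Q(3) y flow_topspace[OF yX s0(1)] by (auto simp: N'_def)
    have "icurve (\<lambda>t. \<theta> t (\<theta> s0 y)) \<and> \<theta> 0 (\<theta> s0 y) \<in> U \<and> \<phi> (\<theta> 0 (\<theta> s0 y)) \<in> ball (\<phi> x1) (R / 4) \<and>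
        0 \<le> s - s0 \<and> s - s0 \<le> \<rho>"
      using flow_icurve[OF y1(3)] flow_0[OF y1(3)] y1 ss by simp
    from R(5)[rule_format, OF this]
    have "\<theta> (s - s0) (\<theta> s0 y) \<in> U \<and> \<phi> (\<theta> (s - s0) (\<theta> s0 y)) \<in> ball (\<phi> x1) (R / 2)" by blast
    then have sU: "\<theta> s y \<in> U" "\<phi> (\<theta> s y) \<in> ball (\<phi> x1) (R / 2)"
      using flow_diff[OF yX s0(1) ss(1)] by simp_all
    have "ball (\<phi> x1) (R / 2) \<subseteq> ball (\<phi> x1) e" using R(1,2) by (intro subset_ball) simp
    then have "\<phi> (\<theta> s y) \<in> \<phi> ` (U \<inter> N)" using sU(2) e(2) by blast
    then show ?thesis using sU(1) chart_inj[OF U(1)] by (auto dest: inj_onD)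
  qed
  then show ?thesis using that[OF Q(1,2) d(1)] by blast
qed

text \<open>The radius \<open>\<rho>\<close> and the bound \<open>C\<close> are the same for all
  nearby points and times. This uniformity is what the lemma on Taylor families requires when
  approximability is moved backwards in time.\<close>

lemma flow_time_extension_local:
  assumes f: "\<forall>x\<in>topspace X. hol_at f x" and x: "x \<in> topspace X" and t0: "0 \<le> t0"
  shows "\<exists>Q d \<rho> C. openin X Q \<and> x \<in> Q \<and> 0 < d \<and> 0 < \<rho> \<and> (\<forall>y\<in>Q. \<forall>s. 0 \<le> s \<and> \<bar>s - t0\<bar> < d \<longrightarrow>
    (\<exists>h. h holomorphic_on cball 0 \<rho> \<and> (\<forall>\<tau>\<in>cball 0 \<rho>. norm (h \<tau>) \<le> C) \<and>
      (\<forall>t. 0 \<le> t \<and> t \<le> \<rho> \<longrightarrow> f (\<theta> (s + t) y) = h (of_real t))))"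
proof -
  define x1 where "x1 = \<theta> t0 x"
  have x1: "x1 \<in> topspace X" unfolding x1_def by (rule flow_topspace[OF x t0])
  obtain U \<phi> where U: "(U, \<phi>) \<in> A" "x1 \<in> U" using exists_chart[OF x1] by blast
  have "hol_at f x1" using f x1 by blast
  then obtain g e where g: "0 < e" "ball (\<phi> x1) e \<subseteq> \<phi> ` U" "holo_fun g (ball (\<phi> x1) e)"
    "\<forall>y\<in>U. \<phi> y \<in> ball (\<phi> x1) e \<longrightarrow> f y = g (\<phi> y)"
    by (rule hol_at_chart[OF _ U])
  have sub: "cball (\<phi> x1) (e / 2) \<subseteq> ball (\<phi> x1) e" using g(1) by auto
  obtain M where M: "0 < M" "\<And>z. z \<in> cball (\<phi> x1) (e / 2) \<Longrightarrow> norm (g z) \<le> M"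
    using compact_bound[OF holo_fun_continuous_on[OF g(3)] compact_cball sub] by blast
  have e2: "0 < e / 2" using g(1) by simp
  obtain R \<rho> where R: "0 < R" "R \<le> e / 2" "0 < \<rho>" "cball (\<phi> x1) R \<subseteq> \<phi> ` U"
    "\<forall>\<gamma> t. icurve \<gamma> \<and> \<gamma> 0 \<in> U \<and> \<phi> (\<gamma> 0) \<in> ball (\<phi> x1) (R / 4) \<and> 0 \<le> t \<and> t \<le> \<rho> \<longrightarrow>
      \<gamma> t \<in> U \<and> \<phi> (\<gamma> t) \<in> ball (\<phi> x1) (R / 2)"
    "\<forall>f C. holo_fun f (ball (\<phi> x1) R) \<and> (\<forall>z\<in>ball (\<phi> x1) R. norm (f z) \<le> C) \<longrightarrow>
      (\<exists>h. (\<forall>z\<in>ball (\<phi> x1) (R / 2). h z holomorphic_on cball 0 \<rho>) \<and>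
        (\<forall>z\<in>ball (\<phi> x1) (R / 2). \<forall>\<tau>\<in>cball 0 \<rho>. norm (h z \<tau>) \<le> 2 * C) \<and>
        (\<forall>\<tau>\<in>cball 0 \<rho>. holo_fun (\<lambda>z. h z \<tau>) (ball (\<phi> x1) (R / 2))) \<and>
        (\<forall>\<gamma> t. icurve \<gamma> \<and> \<gamma> 0 \<in> U \<and> \<phi> (\<gamma> 0) \<in> ball (\<phi> x1) (R / 4) \<and> 0 \<le> t \<and> t \<le> \<rho> \<longrightarrow>
          f (\<phi> (\<gamma> t)) = h (\<phi> (\<gamma> 0)) (of_real t)))"
    by (rule flow_box[OF U e2])
  have balls: "ball (\<phi> x1) R \<subseteq> cball (\<phi> x1) (e / 2)" "ball (\<phi> x1) R \<subseteq> ball (\<phi> x1) e"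
    "ball (\<phi> x1) (R / 2) \<subseteq> ball (\<phi> x1) e" "ball (\<phi> x1) (R / 4) \<subseteq> ball (\<phi> x1) (R / 2)"
    using R(1,2) by auto
  have "holo_fun g (ball (\<phi> x1) R) \<and> (\<forall>z\<in>ball (\<phi> x1) R. norm (g z) \<le> M)"
    using holo_fun_subset[OF g(3) balls(2)] M(2) balls(1) by blast
  from R(6)[rule_format, OF this] obtain h where h:
    "\<forall>z\<in>ball (\<phi> x1) (R / 2). h z holomorphic_on cball 0 \<rho>"
    "\<forall>z\<in>ball (\<phi> x1) (R / 2). \<forall>\<tau>\<in>cball 0 \<rho>. norm (h z \<tau>) \<le> 2 * M"
    "\<forall>\<gamma> t. icurve \<gamma> \<and> \<gamma> 0 \<in> U \<and> \<phi> (\<gamma> 0) \<in> ball (\<phi> x1) (R / 4) \<and> 0 \<le> t \<and> t \<le> \<rho> \<longrightarrow>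
          g (\<phi> (\<gamma> t)) = h (\<phi> (\<gamma> 0)) (of_real t)" by blast
  define N where "N = {y \<in> U. \<phi> y \<in> ball (\<phi> x1) (R / 4)}"
  have N: "openin X N" "\<theta> t0 x \<in> N"
    using chart_preimage_open[OF U(1) open_ball[of "\<phi> x1" "R / 4"]] U(2) R(1) by (simp_all add: N_def x1_def)
  obtain Q d where Q: "openin X Q" "x \<in> Q" "0 < d" "\<forall>y\<in>Q. \<forall>s. 0 \<le> s \<and> \<bar>s - t0\<bar> < d \<longrightarrow> \<theta> s y \<in> N"
    by (rule flow_joint_continuous[OF x t0 N])
  have "\<exists>h. h holomorphic_on cball 0 \<rho> \<and> (\<forall>\<tau>\<in>cball 0 \<rho>. norm (h \<tau>) \<le> 2 * M) \<and>
      (\<forall>t. 0 \<le> t \<and> t \<le> \<rho> \<longrightarrow> f (\<theta> (s + t) y) = h (of_real t))"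
    if y: "y \<in> Q" and s: "0 \<le> s" "\<bar>s - t0\<bar> < d" for y s
  proof -
    have yX: "y \<in> topspace X" using y openin_subset[OF Q(1)] by blast
    have "\<theta> s y \<in> N" using Q(4) y s by blast
    then have sN: "\<theta> s y \<in> U" "\<phi> (\<theta> s y) \<in> ball (\<phi> x1) (R / 4)" by (auto simp: N_def)
    then have sN2: "\<phi> (\<theta> s y) \<in> ball (\<phi> x1) (R / 2)" using balls(4) by blast
    have "f (\<theta> (s + t) y) = h (\<phi> (\<theta> s y)) (of_real t)" if t: "0 \<le> t" "t \<le> \<rho>" for t
    proof -
      have c: "icurve (\<lambda>t. \<theta> (s + t) y) \<and> \<theta> (s + 0) y \<in> U \<and> \<phi> (\<theta> (s + 0) y) \<in> ball (\<phi> x1) (R / 4) \<and> 0 \<le> t \<and> t \<le> \<rho>"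
        using icurve_shift[OF flow_icurve[OF yX] s(1)] sN t by simp
      have "\<theta> (s + t) y \<in> U \<and> \<phi> (\<theta> (s + t) y) \<in> ball (\<phi> x1) (R / 2)" by (rule R(5)[rule_format, OF c])
      then have "f (\<theta> (s + t) y) = g (\<phi> (\<theta> (s + t) y))" using g(4) balls(3) by blast
      also have "\<dots> = h (\<phi> (\<theta> (s + 0) y)) (of_real t)" by (rule h(3)[rule_format, OF c])
      finally show ?thesis by simp
    qed
    then show ?thesis using h(1,2) sN2 by blast
  qed
  then show ?thesis using Q(1-3) R(3) by blast
qed

text \<open>A finite cover of \<open>K\<close>: extensions survive a smaller radius and a larger
  bound, so the extreme values over the cover serve all points.\<close>

lemma flow_time_extension:
  assumes f: "\<forall>x\<in>topspace X. hol_at f x" and K: "compactin X K" and t0: "0 \<le> t0"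
  obtains d \<rho> C where "0 < d" "0 < \<rho>" "\<forall>y\<in>K. \<forall>s. 0 \<le> s \<and> \<bar>s - t0\<bar> < d \<longrightarrow>
    (\<exists>h. h holomorphic_on cball 0 \<rho> \<and> (\<forall>\<tau>\<in>cball 0 \<rho>. norm (h \<tau>) \<le> C) \<and>
      (\<forall>t. 0 \<le> t \<and> t \<le> \<rho> \<longrightarrow> f (\<theta> (s + t) y) = h (of_real t)))"
proof -
  have KX: "K \<subseteq> topspace X" using K by (simp add: compactin_def)
  define ext where "ext y s \<rho> C \<longleftrightarrow> (\<exists>h. h holomorphic_on cball 0 \<rho> \<and> (\<forall>\<tau>\<in>cball 0 \<rho>. norm (h \<tau>) \<le> C) \<and>
      (\<forall>t. 0 \<le> t \<and> t \<le> \<rho> \<longrightarrow> f (\<theta> (s + t) y) = h (of_real t)))" for y s \<rho> C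
  have mono: "ext y s \<rho>' C'" if e: "ext y s \<rho> C" and le: "\<rho>' \<le> \<rho>" "C \<le> C'" for y s \<rho> \<rho>' C C'
  proof -
    obtain h where h: "h holomorphic_on cball 0 \<rho>" "\<forall>\<tau>\<in>cball 0 \<rho>. norm (h \<tau>) \<le> C"
      "\<forall>t. 0 \<le> t \<and> t \<le> \<rho> \<longrightarrow> f (\<theta> (s + t) y) = h (of_real t)" using e unfolding ext_def by blast
    have sub: "cball (0::complex) \<rho>' \<subseteq> cball 0 \<rho>" using le by auto
    show ?thesis unfolding ext_def
    proof (intro exI[of _ h] conjI ballI allI impI)
      show "h holomorphic_on cball 0 \<rho>'" by (rule holomorphic_on_subset[OF h(1) sub])
      show "norm (h \<tau>) \<le> C'" if "\<tau> \<in> cball 0 \<rho>'" for \<tau> using h(2) sub that le(2) by (meson order_trans subsetD)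
      show "f (\<theta> (s + t) y) = h (of_real t)" if "0 \<le> t \<and> t \<le> \<rho>'" for t using h(3) that le(1) by simp
    qed
  qed
  have "\<forall>x\<in>K. \<exists>Q d \<rho> C. openin X Q \<and> x \<in> Q \<and> 0 < d \<and> 0 < \<rho> \<and> (\<forall>y\<in>Q. \<forall>s. 0 \<le> s \<and> \<bar>s - t0\<bar> < d \<longrightarrow> ext y s \<rho> C)"
    using flow_time_extension_local[OF f _ t0] KX unfolding ext_def by blast
  from bchoice[OF this] obtain Q where
    "\<forall>x\<in>K. \<exists>d \<rho> C. openin X (Q x) \<and> x \<in> Q x \<and> 0 < d \<and> 0 < \<rho> \<and> (\<forall>y\<in>Q x. \<forall>s. 0 \<le> s \<and> \<bar>s - t0\<bar> < d \<longrightarrow> ext y s \<rho> C)" ..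
  from bchoice[OF this] obtain d where
    "\<forall>x\<in>K. \<exists>\<rho> C. openin X (Q x) \<and> x \<in> Q x \<and> 0 < d x \<and> 0 < \<rho> \<and> (\<forall>y\<in>Q x. \<forall>s. 0 \<le> s \<and> \<bar>s - t0\<bar> < d x \<longrightarrow> ext y s \<rho> C)" ..
  from bchoice[OF this] obtain \<rho> where
    "\<forall>x\<in>K. \<exists>C. openin X (Q x) \<and> x \<in> Q x \<and> 0 < d x \<and> 0 < \<rho> x \<and> (\<forall>y\<in>Q x. \<forall>s. 0 \<le> s \<and> \<bar>s - t0\<bar> < d x \<longrightarrow> ext y s (\<rho> x) C)" ..
  from bchoice[OF this] obtain C where C:
    "\<forall>x\<in>K. openin X (Q x) \<and> x \<in> Q x \<and> 0 < d x \<and> 0 < \<rho> x \<and> (\<forall>y\<in>Q x. \<forall>s. 0 \<le> s \<and> \<bar>s - t0\<bar> < d x \<longrightarrow> ext y s (\<rho> x) (C x))" ..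
  have Q: "openin X (Q x) \<and> x \<in> Q x \<and> 0 < d x \<and> 0 < \<rho> x" if "x \<in> K" for x using C that by blast
  have Qext: "ext y s (\<rho> x) (C x)" if "x \<in> K" "y \<in> Q x" "0 \<le> s" "\<bar>s - t0\<bar> < d x" for x y s using C that by blast
  have "\<exists>\<F>. finite \<F> \<and> \<F> \<subseteq> Q ` K \<and> K \<subseteq> \<Union>\<F>"
    using K Q unfolding compactin_def by (metis (no_types, lifting) UN_I imageE subsetI)
  then obtain F where F: "finite F" "F \<subseteq> K" "K \<subseteq> \<Union>(Q ` F)"
    by (metis finite_subset_image)
  \<comment> \<open>The inserted values keep the minima and the maximum meaningful when
    \<open>K\<close>, and with it the cover, is empty.\<close>
  define d' where "d' = Min (insert 1 (d ` F))"
  define \<rho>' where "\<rho>' = Min (insert 1 (\<rho> ` F))"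
  define C' where "C' = Max (insert 0 (C ` F))"
  have pos: "0 < d'" "0 < \<rho>'" using F(1,2) Q by (auto simp: d'_def \<rho>'_def)
  have le: "d' \<le> d x" "\<rho>' \<le> \<rho> x" "C x \<le> C'" if "x \<in> F" for x using F(1) that by (auto simp: d'_def \<rho>'_def C'_def)
  have "ext y s \<rho>' C'" if y: "y \<in> K" and s: "0 \<le> s" "\<bar>s - t0\<bar> < d'" for y s
  proof -
    obtain x where x: "x \<in> F" "y \<in> Q x" using F(3) y by blast
    have "ext y s (\<rho> x) (C x)" by (rule Qext) (use x F(2) s le(1)[OF x(1)] in auto)
    then show ?thesis by (rule mono) (use le[OF x(1)] in auto)
  qed
  then show ?thesis using that[OF pos] unfolding ext_def by blast
qed

section \<open>The contraction at the equilibrium\<close>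

text \<open>The contraction comes from uniform attraction, without looking at eigenvalues: for large
  \<open>T\<close> a whole ball of radius \<open>r0\<close> is mapped into a much smaller one, and
  Cauchy's estimate converts this into a Lipschitz constant.\<close>

lemma attracting_chart:
  obtains U \<phi> r T F D where "(U, \<phi>) \<in> A" "p \<in> U" "0 < r" "0 < T" "ball (\<phi> p) r \<subseteq> \<phi> ` U"
    "\<forall>x\<in>U. \<phi> x \<in> ball (\<phi> p) r \<longrightarrow> \<theta> T x \<in> U \<and> \<phi> (\<theta> T x) - \<phi> p = F (\<phi> x - \<phi> p)"
    "holo_map F (ball 0 r)" "\<forall>z\<in>ball 0 r. norm (F z) \<le> 1 / 2 * norm z"
    "(F has_derivative D) (at 0)" "inj D"
proof -
  obtain U \<phi> where U: "(U, \<phi>) \<in> A" "p \<in> U" using exists_chart[OF p_topspace] by blast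
  have "\<phi> p \<in> \<phi> ` U" using U by blast
  then obtain r0 where r0: "0 < r0" "cball (\<phi> p) r0 \<subseteq> \<phi> ` U"
    using chart_hom(2)[OF U(1)] open_contains_cball by blast
  define n where "n = real CARD('n)"
  have n: "0 < n" by (simp add: n_def)
  \<comment> \<open>Chosen so that the Lipschitz constant \<open>n * (\<delta> / r)\<close> with
    \<open>r = r0 / 2\<close> is exactly 1/2.\<close>
  define \<delta> where "\<delta> = r0 / (4 * n)"
  have \<delta>: "0 < \<delta>" using r0 n by (simp add: \<delta>_def)
  define K where "K = {x \<in> U. \<phi> x \<in> cball (\<phi> p) r0}"
  define W where "W = {x \<in> U. \<phi> x \<in> ball (\<phi> p) \<delta>}"
  have K: "compactin X K" unfolding K_def by (rule chart_compact_preimage[OF U(1) compact_cball r0(2)])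
  have W: "openin X W" "p \<in> W" unfolding W_def using chart_preimage_open[OF U(1) open_ball] U \<delta> by auto
  obtain T0 where T0: "0 \<le> T0" "\<forall>t\<ge>T0. \<forall>x\<in>K. \<theta> t x \<in> W" by (rule flow_converges_uniformly[OF K W])
  define T where "T = T0 + 1"
  have T: "0 < T" "0 \<le> T" "T0 \<le> T" using T0 by (auto simp: T_def)
  define F where "F z = \<phi> (\<theta> T (inv_into U \<phi> (\<phi> p + z))) - \<phi> p" for z
  have F_eq: "F (\<phi> x - \<phi> p) = \<phi> (\<theta> T x) - \<phi> p" if "x \<in> U" for x
    by (simp add: F_def chart_inverse[OF U(1) that])
  have inU: "\<theta> T x \<in> W" "\<theta> T x \<in> U" if "x \<in> U" "\<phi> x \<in> ball (\<phi> p) r0" for x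
    using T0(2) T(3) that by (auto simp: K_def W_def)
  have pt: "\<exists>x. x \<in> U \<and> z = \<phi> x - \<phi> p \<and> \<phi> x \<in> ball (\<phi> p) r0" if "z \<in> ball 0 r0" for z
  proof -
    have "\<phi> p + z \<in> ball (\<phi> p) r0" using that by (simp add: dist_norm)
    moreover from this obtain x where "x \<in> U" "\<phi> p + z = \<phi> x" using r0(2) ball_subset_cball by blast
    ultimately show ?thesis by (intro exI[of _ x]) (simp add: algebra_simps)
  qed
  have holF: "holo_map F (ball 0 r0)"
    unfolding holo_map_def
  proof (intro allI holo_fun_locally)
    fix i z assume "z \<in> ball (0::complex^'n) r0"
    then obtain x where x: "x \<in> U" "z = \<phi> x - \<phi> p" "\<phi> x \<in> ball (\<phi> p) r0" using pt by blast
    have xX: "x \<in> topspace X" using chart_subset[OF U(1)] x(1) by blast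
    have "hol_at (\<lambda>y. \<phi> y $ i) (\<theta> T x)" by (rule hol_at_coord[OF U(1) inU(2)[OF x(1,3)]])
    then have "hol_at (\<lambda>y. \<phi> (\<theta> T y) $ i) x" using flow_regular(2)[OF xX T(2)] by blast
    then obtain g e where g: "0 < e" "ball (\<phi> x) e \<subseteq> \<phi> ` U" "holo_fun g (ball (\<phi> x) e)"
      "\<forall>y\<in>U. \<phi> y \<in> ball (\<phi> x) e \<longrightarrow> \<phi> (\<theta> T y) $ i = g (\<phi> y)"
      by (rule hol_at_chart[OF _ U(1) x(1)])
    have sh: "w + \<phi> p \<in> ball (\<phi> x) e" if "w \<in> ball z e" for w
      using that x(2) by (simp add: dist_norm algebra_simps)
    have "holo_fun (\<lambda>w. g (w + \<phi> p) - \<phi> p $ i) (ball z e)"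
      by (intro holo_fun_diff open_ball holo_fun_const holo_fun_compose[OF holo_map_translate g(3)] sh)
    moreover have "F w $ i = g (w + \<phi> p) - \<phi> p $ i" if w: "w \<in> ball z e" for w
    proof -
      obtain y where y: "y \<in> U" "w + \<phi> p = \<phi> y" using sh[OF w] g(2) by blast
      have "w = \<phi> y - \<phi> p" using y(2) by (simp add: algebra_simps)
      then have "F w = \<phi> (\<theta> T y) - \<phi> p" using F_eq[OF y(1)] by simp
      then show ?thesis using g(4) y sh[OF w] by simp
    qed
    ultimately have "holo_fun (\<lambda>w. F w $ i) (ball z e)"
      using holo_fun_cong[OF open_ball, of z e "\<lambda>w. F w $ i" "\<lambda>w. g (w + \<phi> p) - \<phi> p $ i"] by simp
    then show "\<exists>T. z \<in> T \<and> holo_fun (\<lambda>w. F w $ i) T" using g(1) by (intro exI[of _ "ball z e"]) simp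
  qed
  have Fb: "norm (F z) \<le> \<delta>" if z: "z \<in> ball 0 r0" for z
  proof -
    obtain x where x: "x \<in> U" "z = \<phi> x - \<phi> p" "\<phi> x \<in> ball (\<phi> p) r0" using pt[OF z] by blast
    have "\<phi> (\<theta> T x) \<in> ball (\<phi> p) \<delta>" using inU(1)[OF x(1,3)] by (simp add: W_def)
    then show ?thesis using F_eq[OF x(1)] x(2) by (simp add: dist_norm norm_minus_commute)
  qed
  have F0: "F 0 = 0" using F_eq[OF U(2)] flow_p[OF T(2)] by simp
  define r where "r = r0 / 2"
  have r: "0 < r" "r \<le> r0" using r0 by (auto simp: r_def)
  have Fhalf: "norm (F z) \<le> 1 / 2 * norm z" if z: "z \<in> ball 0 r" for z
  proof -
    have in_ball: "w \<in> ball 0 r0" if "z' \<in> ball 0 r" "w \<in> cball z' r" for z' w :: "complex^'n"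
      using that dist_triangle[of 0 w z'] by (simp add: r_def)
    have "norm (F z - F 0) \<le> real CARD('n) * (\<delta> / r) * norm (z - 0)"
    proof (rule lipschitz_holo_map[OF holF r(1) convex_ball _ _ z])
      show "cball z' r \<subseteq> ball 0 r0" if "z' \<in> ball 0 r" for z' :: "complex^'n" using in_ball[OF that] by blast
      show "norm (F w) \<le> \<delta>" if "z' \<in> ball 0 r" "w \<in> cball z' r" for z' w using Fb in_ball[OF that] by blast
    qed (use r in simp)
    also have "real CARD('n) * (\<delta> / r) = 1 / 2" using n r0 by (simp add: \<delta>_def r_def n_def)
    finally show ?thesis by (simp add: F0)
  qed
  obtain D where D: "(F has_derivative D) (at 0)"
    using holF r0(1) unfolding holo_map_iff by (metis centre_in_ball)
  \<comment> \<open>The coordinates are pullbacks under \<open>\<theta> T\<close> of germs at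
    \<open>\<theta> T p = p\<close>. These germs form a holomorphic left inverse of the time
    \<open>T\<close> map near \<open>p\<close>, whose derivative is a left inverse of
    \<open>D\<close>.\<close>
  have "inj D"
  proof -
    have "hol_at (\<lambda>y. \<phi> y $ j) p" for j by (rule hol_at_coord[OF U])
    then have "\<forall>j. \<exists>g Q. hol_at g (\<theta> T p) \<and> openin X Q \<and> p \<in> Q \<and> (\<forall>y\<in>Q. \<phi> y $ j = g (\<theta> T y))"
      using flow_regular(3)[OF p_topspace T(2)] by blast
    then obtain g Q where g: "\<And>j. hol_at (g j) p" "\<And>j. openin X (Q j)" "\<And>j. p \<in> Q j"
      "\<And>j y. y \<in> Q j \<Longrightarrow> \<phi> y $ j = g j (\<theta> T y)" using flow_p[OF T(2)] by metis
    define gv where "gv y = (\<chi> j. g j y)" for y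
    have "hol_at (\<lambda>y. gv y $ j) p" for j using g(1) by (simp add: gv_def)
    then obtain G e where G: "0 < e" "ball (\<phi> p) e \<subseteq> \<phi> ` U" "holo_map G (ball (\<phi> p) e)"
      "\<forall>y\<in>U. \<phi> y \<in> ball (\<phi> p) e \<longrightarrow> gv y = G (\<phi> y)"
      by (rule hol_at_vector_chart[OF _ U])
    define W' where "W' = {x \<in> U. \<phi> x \<in> ball (\<phi> p) e}"
    have W': "openin X W'" "\<theta> T p \<in> W'" unfolding W'_def
      using chart_preimage_open[OF U(1) open_ball] U G(1) flow_p[OF T(2)] by auto
    obtain Q' where Q': "openin X Q'" "p \<in> Q'" "\<forall>y\<in>Q'. \<theta> T y \<in> W'"
      by (rule flow_continuous[OF p_topspace T(2) W'])
    define S where "S = \<phi> ` (U \<inter> (Q' \<inter> (\<Inter>j\<in>UNIV. Q j)))"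
    have "openin X (\<Inter>j\<in>UNIV. Q j)" by (rule openin_INT2) (use g(2) in auto)
    then have "open S" unfolding S_def by (intro chart_image_open[OF U(1)] openin_Int Q')
    then have op: "open ((\<lambda>z. z + \<phi> p) -` S)" by (intro open_vimage) (auto intro!: continuous_intros)
    have z0: "0 \<in> (\<lambda>z. z + \<phi> p) -` S" using U(2) Q'(2) g(3) by (auto simp: S_def)
    have GF: "G (F z + \<phi> p) = z + \<phi> p" if zS: "z \<in> (\<lambda>z. z + \<phi> p) -` S" for z
    proof -
      obtain y where y: "y \<in> U" "y \<in> Q'" "\<And>j. y \<in> Q j" "z + \<phi> p = \<phi> y" using zS by (auto simp: S_def)
      have "z = \<phi> y - \<phi> p" using y(4) by (simp add: algebra_simps)
      then have "F z + \<phi> p = \<phi> (\<theta> T y)" using F_eq[OF y(1)] by simp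
      moreover have "\<theta> T y \<in> W'" using Q'(3) y(2) by blast
      then have "gv (\<theta> T y) = G (\<phi> (\<theta> T y))" using G(4) by (simp add: W'_def)
      moreover have "gv (\<theta> T y) = \<phi> y" using g(4) y(3) by (simp add: gv_def vec_eq_iff)
      ultimately show ?thesis using y(4) by simp
    qed
    obtain E where E: "(G has_derivative E) (at (F 0 + \<phi> p))"
      using G(1,3) F0 unfolding holo_map_iff by (metis centre_in_ball add_0)
    have "((\<lambda>z. F z + \<phi> p) has_derivative D) (at 0)" using D by (auto intro!: derivative_eq_intros)
    then have "((\<lambda>z. G (F z + \<phi> p)) has_derivative (\<lambda>v. E (D v))) (at 0)"
      by (rule has_derivative_compose[of "\<lambda>z. F z + \<phi> p"]) (rule E)
    then have "((\<lambda>z. z + \<phi> p) has_derivative (\<lambda>v. E (D v))) (at 0)"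
      by (rule has_derivative_transform_within_open[OF _ op z0]) (rule GF)
    moreover have "((\<lambda>z. z + \<phi> p) has_derivative (\<lambda>v. v)) (at 0)" by (auto intro!: derivative_eq_intros)
    ultimately have "(\<lambda>v. E (D v)) = (\<lambda>v. v)" by (rule has_derivative_unique)
    then have "E (D v) = v" for v by (rule fun_cong)
    then show ?thesis by (rule inj_on_inverseI)
  qed
  show ?thesis
  proof (rule that[OF U r(1) T(1) _ _ _ _ D \<open>inj D\<close>])
    have sub: "ball (\<phi> p) r \<subseteq> ball (\<phi> p) r0" using r by (intro subset_ball)
    then show "ball (\<phi> p) r \<subseteq> \<phi> ` U" using r0(2) ball_subset_cball by blast
    show "\<forall>x\<in>U. \<phi> x \<in> ball (\<phi> p) r \<longrightarrow> \<theta> T x \<in> U \<and> \<phi> (\<theta> T x) - \<phi> p = F (\<phi> x - \<phi> p)"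
      using inU(2) F_eq sub by auto
    show "holo_map F (ball 0 r)" by (rule holo_map_subset[OF holF]) (use r in auto)
    show "\<forall>z\<in>ball 0 r. norm (F z) \<le> 1 / 2 * norm z" using Fhalf by blast
  qed
qed

end


section \<open>The embedding\<close>

lemma funpow_holo_map:
  fixes G :: "complex^'n::finite \<Rightarrow> complex^'n"
  assumes "holo_map G UNIV"
  shows "holo_map (G ^^ k) UNIV"
proof (induction k)
  case 0
  then show ?case using holo_map_id by (simp add: id_def)
next
  case (Suc k)
  have "holo_map (\<lambda>z. G ((G ^^ k) z)) UNIV" by (rule holo_map_compose[OF Suc assms]) simp
  then show ?case by (simp add: comp_def)
qed

text \<open>\<open>\<xi>\<close> is a holomorphic coordinate near the equilibrium in which the flow for time \<open>T\<close> coincides with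
  the automorphism \<open>G\<close> of \<open>n\<close>-space.\<close>

locale conjugated_flow = gas_flow X A V \<theta> p
  for X :: "'a topology" and A :: "('a, 'n::finite) chart set" and V :: "('a, 'n) vfield" and \<theta> p +
  fixes B :: "'a set" and \<xi> :: "'a \<Rightarrow> complex^'n" and T :: real and G H :: "complex^'n \<Rightarrow> complex^'n"
  assumes B: "openin X B" "p \<in> B" and T: "0 < T" and aut: "aut_pair G H"
    and B_step: "\<And>x. x \<in> B \<Longrightarrow> \<theta> T x \<in> B \<and> \<xi> x = H (\<xi> (\<theta> T x))"
    and \<xi>_hol: "\<And>x i. x \<in> B \<Longrightarrow> hol_at (\<lambda>y. \<xi> y $ i) x"
    and \<xi>_inj: "inj_on \<xi> B" and \<xi>_p: "\<xi> p = 0"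
    and \<xi>_germ: "\<And>x f. x \<in> B \<Longrightarrow> hol_at f x \<Longrightarrow>
      \<exists>g S Q. open S \<and> holo_fun g S \<and> openin X Q \<and> x \<in> Q \<and> (\<forall>y\<in>Q. \<xi> y \<in> S \<and> f y = g (\<xi> y))"
begin

section \<open>Extension of the local coordinate along the flow\<close>

lemma GH: "H (G z) = z" "G (H z) = z" and holG: "holo_map G UNIV" and holH: "holo_map H UNIV"
  using aut by (auto simp: aut_pair_def)

lemma GHk: "(G ^^ k) ((H ^^ k) z) = z"
proof (induction k arbitrary: z)
  case (Suc k)
  have "(G ^^ Suc k) ((H ^^ Suc k) z) = G ((G ^^ k) ((H ^^ k) (H z)))" by (simp add: funpow_swap1)
  then show ?case using Suc GH by simp
qed simp

lemma kT_nonneg: "0 \<le> real k * T" using T by simp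

lemma flow_kT_Suc: "x \<in> topspace X \<Longrightarrow> \<theta> (real (Suc k) * T) x = \<theta> T (\<theta> (real k * T) x)"
  using flow_add[of x "real k * T" T] T by (simp add: distrib_right add.commute)

text \<open>Once the orbit is in \<open>B\<close>, each further step inserts one flow step and one
  \<open>H\<close>, which cancel. The value below is therefore independent of the number of
  steps.\<close>

lemma stays_in_B:
  assumes "x \<in> topspace X" "\<theta> (real k * T) x \<in> B" "k \<le> j"
  shows "\<theta> (real j * T) x \<in> B \<and> (H ^^ j) (\<xi> (\<theta> (real j * T) x)) = (H ^^ k) (\<xi> (\<theta> (real k * T) x))"
  using assms(3)
proof (induction j rule: dec_induct)
  case base
  then show ?case using assms by simp
next
  case (step j)
  then show ?case using B_step[of "\<theta> (real j * T) x"]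
    by (simp add: flow_kT_Suc[OF assms(1), unfolded of_nat_Suc] funpow_swap1)
qed

lemma enters_B:
  assumes "x \<in> topspace X"
  shows "\<exists>k. \<theta> (real k * T) x \<in> B"
proof -
  have "compactin X {x}" using assms by simp
  then obtain T0 where T0: "0 \<le> T0" "\<forall>t\<ge>T0. \<forall>y\<in>{x}. \<theta> t y \<in> B"
    by (rule flow_converges_uniformly[OF _ B])
  obtain k where "T0 / T \<le> real k" using real_arch_simple by blast
  then have "T0 \<le> real k * T" using T by (simp add: pos_divide_le_eq)
  then show ?thesis using T0 by blast
qed

text \<open>The number of steps chosen is immaterial by \<open>\<Phi>_eq\<close>. A common number
  for two points, or for a whole neighbourhood, can thus be used.\<close>

definition \<Phi> :: "'a \<Rightarrow> complex^'n" where
  "\<Phi> x = (let k = (SOME k. \<theta> (real k * T) x \<in> B) in (H ^^ k) (\<xi> (\<theta> (real k * T) x)))"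

lemma \<Phi>_eq:
  assumes x: "x \<in> topspace X" and k: "\<theta> (real k * T) x \<in> B"
  shows "\<Phi> x = (H ^^ k) (\<xi> (\<theta> (real k * T) x))"
proof -
  define j where "j = (SOME k. \<theta> (real k * T) x \<in> B)"
  have j: "\<theta> (real j * T) x \<in> B" unfolding j_def by (rule someI[of _ k]) (rule k)
  have "(H ^^ max j k) (\<xi> (\<theta> (real (max j k) * T) x)) = (H ^^ j) (\<xi> (\<theta> (real j * T) x))"
    using stays_in_B[OF x j, of "max j k"] by simp
  moreover have "(H ^^ max j k) (\<xi> (\<theta> (real (max j k) * T) x)) = (H ^^ k) (\<xi> (\<theta> (real k * T) x))"
    using stays_in_B[OF x k, of "max j k"] by simp
  ultimately show ?thesis by (simp add: \<Phi>_def Let_def flip: j_def)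
qed

lemma \<Phi>_local:
  assumes x: "x \<in> topspace X"
  obtains k Q where "openin X Q" "x \<in> Q" "\<forall>y\<in>Q. \<theta> (real k * T) y \<in> B \<and> \<Phi> y = (H ^^ k) (\<xi> (\<theta> (real k * T) y))"
proof -
  obtain k where k: "\<theta> (real k * T) x \<in> B" using enters_B[OF x] by blast
  obtain Q where Q: "openin X Q" "x \<in> Q" "\<forall>y\<in>Q. \<theta> (real k * T) y \<in> B"
    by (rule flow_continuous[OF x kT_nonneg B(1) k])
  have "\<Phi> y = (H ^^ k) (\<xi> (\<theta> (real k * T) y))" if "y \<in> Q" for y
    by (rule \<Phi>_eq) (use that Q openin_subset[OF Q(1)] in auto)
  then show ?thesis using that Q by blast
qed

lemma \<Phi>_hol:
  assumes x: "x \<in> topspace X"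
  shows "hol_at (\<lambda>y. \<Phi> y $ i) x"
proof -
  obtain k Q where Q: "openin X Q" "x \<in> Q"
    "\<forall>y\<in>Q. \<theta> (real k * T) y \<in> B \<and> \<Phi> y = (H ^^ k) (\<xi> (\<theta> (real k * T) y))"
    by (rule \<Phi>_local[OF x])
  have "hol_at (\<lambda>y. \<xi> y $ j) (\<theta> (real k * T) x)" for j using Q(2,3) by (intro \<xi>_hol) blast
  then have "hol_at (\<lambda>y. \<xi> (\<theta> (real k * T) y) $ j) x" for j
    using flow_regular(2)[OF x kT_nonneg[of k]] by blast
  then have "hol_at (\<lambda>y. (H ^^ k) (\<xi> (\<theta> (real k * T) y)) $ i) x"
    by (rule hol_at_compose[where g = "\<lambda>z. (H ^^ k) z $ i" and T = UNIV])
       (use funpow_holo_map[OF holH, of k] in \<open>auto simp: holo_map_def\<close>)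
  then show ?thesis by (rule hol_at_cong[OF _ Q(1,2)]) (use Q(3) in simp)
qed

lemma \<Phi>_inj: "inj_on \<Phi> (topspace X)"
proof (rule inj_onI)
  fix x y assume x: "x \<in> topspace X" and y: "y \<in> topspace X" and eq: "\<Phi> x = \<Phi> y"
  obtain k j where k: "\<theta> (real k * T) x \<in> B" and j: "\<theta> (real j * T) y \<in> B" using enters_B x y by blast
  define m where "m = max k j"
  have mx: "\<theta> (real m * T) x \<in> B" using stays_in_B[OF x k, of m] by (simp add: m_def)
  have my: "\<theta> (real m * T) y \<in> B" using stays_in_B[OF y j, of m] by (simp add: m_def)
  have "(H ^^ m) (\<xi> (\<theta> (real m * T) x)) = (H ^^ m) (\<xi> (\<theta> (real m * T) y))"
    using eq \<Phi>_eq[OF x mx] \<Phi>_eq[OF y my] by simp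
  then have "\<xi> (\<theta> (real m * T) x) = \<xi> (\<theta> (real m * T) y)" by (metis GHk)
  then have "\<theta> (real m * T) x = \<theta> (real m * T) y" using inj_onD[OF \<xi>_inj] mx my by blast
  then show "x = y" by (rule flow_injective[OF x y kT_nonneg])
qed

text \<open>Germs factor through each of the three maps that make up \<open>\<Phi>\<close>: the
  flow, the coordinate \<open>\<xi>\<close>, and \<open>H ^^ k\<close>, which \<open>G ^^ k\<close>
  undoes.\<close>

lemma \<Phi>_germ:
  assumes f: "hol_at f x"
  obtains g S Q where "open S" "holo_fun g S" "openin X Q" "x \<in> Q" "\<forall>y\<in>Q. \<Phi> y \<in> S \<and> f y = g (\<Phi> y)"
proof -
  have x: "x \<in> topspace X" by (rule hol_at_topspace[OF f])
  obtain k Q where Q: "openin X Q" "x \<in> Q"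
    "\<forall>y\<in>Q. \<theta> (real k * T) y \<in> B \<and> \<Phi> y = (H ^^ k) (\<xi> (\<theta> (real k * T) y))"
    by (rule \<Phi>_local[OF x])
  obtain g1 Q1 where g1: "hol_at g1 (\<theta> (real k * T) x)" "openin X Q1" "x \<in> Q1"
    "\<forall>y\<in>Q1. f y = g1 (\<theta> (real k * T) y)"
    using flow_regular(3)[OF x kT_nonneg[of k]] f by blast
  have "\<theta> (real k * T) x \<in> B" using Q by blast
  from \<xi>_germ[OF this g1(1)] obtain g S Q2 where g: "open S" "holo_fun g S" "openin X Q2"
    "\<theta> (real k * T) x \<in> Q2" "\<forall>y\<in>Q2. \<xi> y \<in> S \<and> g1 y = g (\<xi> y)" by blast
  obtain Q3 where Q3: "openin X Q3" "x \<in> Q3" "\<forall>y\<in>Q3. \<theta> (real k * T) y \<in> Q2"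
    by (rule flow_continuous[OF x kT_nonneg g(3,4)])
  have Gk: "holo_map (G ^^ k) UNIV" by (rule funpow_holo_map[OF holG])
  have op: "open ((G ^^ k) -` S)"
    using holo_map_continuous_on[OF Gk] g(1) by (intro open_vimage) (auto simp: continuous_on_eq_continuous_at)
  have hg: "holo_fun (\<lambda>z. g ((G ^^ k) z)) ((G ^^ k) -` S)"
    by (rule holo_fun_compose[OF holo_map_subset[OF Gk] g(2)]) auto
  show ?thesis
  proof (rule that[OF op hg])
    show "openin X (Q \<inter> (Q1 \<inter> Q3))" by (intro openin_Int Q g1 Q3)
    show "x \<in> Q \<inter> (Q1 \<inter> Q3)" using Q g1 Q3 by blast
    show "\<forall>y\<in>Q \<inter> (Q1 \<inter> Q3). \<Phi> y \<in> (G ^^ k) -` S \<and> f y = g ((G ^^ k) (\<Phi> y))"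
      using Q(3) g1(4) Q3(3) g(5) GHk by simp
  qed
qed

text \<open>The conjugacy, first known only on \<open>B\<close>, holds on all of \<open>X\<close>.
  It makes positions far along an orbit entire functions of \<open>\<Phi> x\<close>.\<close>

lemma \<Phi>_iterate:
  assumes x: "x \<in> topspace X"
  shows "\<Phi> (\<theta> (real k * T) x) = (G ^^ k) (\<Phi> x)"
proof (induction k)
  case 0
  then show ?case using flow_0[OF x] by simp
next
  case (Suc k)
  have conj: "\<Phi> (\<theta> T y) = G (\<Phi> y)" if y: "y \<in> topspace X" for y
  proof -
    obtain j where j: "\<theta> (real j * T) y \<in> B" using enters_B[OF y] by blast
    have yT: "\<theta> T y \<in> topspace X" using flow_topspace[OF y] T by simp
    have "\<theta> (real (Suc j) * T) y \<in> B" using stays_in_B[OF y j, of "Suc j"] by simp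
    moreover have "\<theta> (real (Suc j) * T) y = \<theta> (real j * T) (\<theta> T y)"
      using flow_add[OF y, of T "real j * T"] T by (simp add: distrib_right add.commute)
    ultimately have jB: "\<theta> (real j * T) (\<theta> T y) \<in> B" "\<theta> (real (Suc j) * T) y \<in> B"
      and e: "\<theta> (real (Suc j) * T) y = \<theta> (real j * T) (\<theta> T y)" by simp_all
    have "G (\<Phi> y) = G ((H ^^ Suc j) (\<xi> (\<theta> (real j * T) (\<theta> T y))))"
      using \<Phi>_eq[OF y jB(2)] unfolding e by simp
    also have "\<dots> = \<Phi> (\<theta> T y)" using \<Phi>_eq[OF yT jB(1)] by (simp add: GH)
    finally show ?thesis by simp
  qed
  show ?case unfolding flow_kT_Suc[OF x]
    using conj[OF flow_topspace[OF x kT_nonneg]] Suc by simp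
qed

lemma \<Phi>_p: "\<Phi> p = 0"
proof -
  have H0: "H 0 = 0" by (rule aut_pair_inverse_0[OF aut])
  have "(H ^^ k) 0 = 0" for k by (induction k) (simp_all add: H0)
  then show ?thesis using \<Phi>_eq[OF p_topspace, of 0] B(2) flow_0[OF p_topspace] by (simp add: \<xi>_p)
qed

section \<open>The image as a domain in \<open>n\<close>-space\<close>

text \<open>In a chart \<open>\<Phi>\<close> is continuous and injective between spaces of equal
  dimension, so invariance of domain applies.\<close>

lemma \<Phi>_open_map:
  assumes N: "openin X N"
  shows "open (\<Phi> ` N)"
proof -
  have "\<exists>S. open S \<and> \<Phi> x \<in> S \<and> S \<subseteq> \<Phi> ` N" if x: "x \<in> N" for x
  proof -
    have xX: "x \<in> topspace X" using x openin_subset[OF N] by blast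
    obtain U \<phi> where U: "(U, \<phi>) \<in> A" "x \<in> U" using exists_chart[OF xX] by blast
    obtain F e where F: "0 < e" "ball (\<phi> x) e \<subseteq> \<phi> ` U" "holo_map F (ball (\<phi> x) e)"
      "\<forall>y\<in>U. \<phi> y \<in> ball (\<phi> x) e \<longrightarrow> \<Phi> y = F (\<phi> y)"
      by (rule hol_at_vector_chart[OF \<Phi>_hol[OF xX] U])
    define S where "S = ball (\<phi> x) e \<inter> \<phi> ` (U \<inter> N)"
    have S: "open S" unfolding S_def by (intro open_Int open_ball chart_image_open[OF U(1) N])
    have pt: "\<exists>y. y \<in> U \<and> y \<in> N \<and> z = \<phi> y \<and> F z = \<Phi> y" if "z \<in> S" for z using that F(4) by (auto simp: S_def)
    have "inj_on F S"
    proof (rule inj_onI)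
      fix z w assume "z \<in> S" "w \<in> S" and eq: "F z = F w"
      then obtain y y' where "y \<in> N" "z = \<phi> y" "F z = \<Phi> y" "y' \<in> N" "w = \<phi> y'" "F w = \<Phi> y'" using pt by meson
      then show "z = w" using eq inj_onD[OF \<Phi>_inj, of y y'] openin_subset[OF N] by auto
    qed
    moreover have "continuous_on S F"
      by (rule continuous_on_subset[OF holo_map_continuous_on[OF F(3)]]) (auto simp: S_def)
    ultimately have "open (F ` S)" using S by (intro invariance_of_domain)
    moreover have "\<phi> x \<in> S" using U x F(1) by (auto simp: S_def)
    then have "\<Phi> x \<in> F ` S" using F(4) U F(1) by (intro image_eqI[of _ _ "\<phi> x"]) auto
    moreover have "F ` S \<subseteq> \<Phi> ` N" using pt by blast
    ultimately show ?thesis by blast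
  qed
  then show ?thesis by (subst open_subopen) blast
qed

abbreviation D :: "(complex^'n) set" where "D \<equiv> \<Phi> ` topspace X"

abbreviation \<Phi>inv :: "complex^'n \<Rightarrow> 'a" where "\<Phi>inv \<equiv> inv_into (topspace X) \<Phi>"

lemma open_D: "open D" by (rule \<Phi>_open_map) simp

lemma \<Phi>inv: "x \<in> topspace X \<Longrightarrow> \<Phi>inv (\<Phi> x) = x" by (rule inv_into_f_f[OF \<Phi>_inj])

lemma continuous_\<Phi>: "continuous_map X (top_of_set D) \<Phi>"
proof -
  have "continuous_map X euclidean \<Phi>"
    unfolding continuous_map_def
  proof (intro conjI allI impI)
    show "\<Phi> \<in> topspace X \<rightarrow> topspace euclidean" by simp
    fix S :: "(complex^'n) set" assume S: "openin euclidean S"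
    show "openin X {x \<in> topspace X. \<Phi> x \<in> S}"
    proof (subst openin_subopen, intro ballI)
      fix x assume "x \<in> {x \<in> topspace X. \<Phi> x \<in> S}"
      then have x: "x \<in> topspace X" "\<Phi> x \<in> S" by auto
      obtain e where e: "0 < e" "ball (\<Phi> x) e \<subseteq> S" using S x(2) open_contains_ball by (metis open_openin)
      define r where "r = e / (2 * real CARD('n))"
      have r: "0 < r" using e by (simp add: r_def)
      have "\<exists>N. openin X N \<and> x \<in> N \<and> (\<forall>y\<in>N. \<Phi> y $ i \<in> ball (\<Phi> x $ i) r)" for i
        by (rule hol_at_continuous[OF \<Phi>_hol[OF x(1)]]) (use r in auto)
      then obtain N where N: "\<And>i. openin X (N i)" "\<And>i. x \<in> N i" "\<And>i y. y \<in> N i \<Longrightarrow> \<Phi> y $ i \<in> ball (\<Phi> x $ i) r"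
        by metis
      have op: "openin X (\<Inter>i\<in>UNIV. N i)" by (rule openin_INT2) (use N(1) in auto)
      have "\<Phi> y \<in> S" if y: "y \<in> (\<Inter>i\<in>UNIV. N i)" for y
      proof -
        have "norm (\<Phi> x - \<Phi> y) \<le> (\<Sum>i\<in>UNIV. norm ((\<Phi> x - \<Phi> y) $ i))" by (rule norm_vec_le_sum)
        also have "\<dots> \<le> (\<Sum>i\<in>(UNIV::'n set). r)"
          using N(3)[of y] y by (intro sum_mono) (auto simp: dist_norm intro: less_imp_le)
        also have "\<dots> < e" using e by (simp add: r_def)
        finally show ?thesis using e(2) by (auto simp: dist_norm)
      qed
      then show "\<exists>T. openin X T \<and> x \<in> T \<and> T \<subseteq> {x \<in> topspace X. \<Phi> x \<in> S}"
        using op N(2) openin_subset[OF op] by (intro exI[of _ "\<Inter>i\<in>UNIV. N i"]) auto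
    qed
  qed
  then show ?thesis by (auto simp: continuous_map_in_subtopology)
qed

lemma continuous_\<Phi>inv: "continuous_map (top_of_set D) X \<Phi>inv"
  unfolding continuous_map_def
proof (intro conjI allI impI)
  show "\<Phi>inv \<in> topspace (top_of_set D) \<rightarrow> topspace X" by (auto simp: \<Phi>inv)
  fix N assume N: "openin X N"
  then have "{z \<in> topspace (top_of_set D). \<Phi>inv z \<in> N} = \<Phi> ` N"
    using openin_subset[OF N] by (force simp: \<Phi>inv)
  then show "openin (top_of_set D) {z \<in> topspace (top_of_set D). \<Phi>inv z \<in> N}"
    using \<Phi>_open_map[OF N] open_D openin_subset[OF N] by (auto intro!: openin_open_eq[THEN iffD2])
qed

text \<open>Holomorphy descends to the image because the germs of \<open>f\<close> factor through
  \<open>\<Phi>\<close>.\<close>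

lemma holo_push:
  assumes f: "\<forall>x\<in>topspace X. hol_at f x"
  shows "holo_fun (\<lambda>z. f (\<Phi>inv z)) D"
proof (rule holo_fun_locally)
  fix z assume "z \<in> D"
  then obtain x where x: "x \<in> topspace X" "z = \<Phi> x" by blast
  obtain g S Q where g: "open S" "holo_fun g S" "openin X Q" "x \<in> Q" "\<forall>y\<in>Q. \<Phi> y \<in> S \<and> f y = g (\<Phi> y)"
    by (rule \<Phi>_germ[OF f[rule_format, OF x(1)]])
  have "holo_fun g (\<Phi> ` Q)" by (rule holo_fun_subset[OF g(2)]) (use g(5) in blast)
  moreover have "f (\<Phi>inv w) = g w" if "w \<in> \<Phi> ` Q" for w
    using that g(5) openin_subset[OF g(3)] by (auto simp: \<Phi>inv)
  ultimately have "holo_fun (\<lambda>z. f (\<Phi>inv z)) (\<Phi> ` Q)"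
    using holo_fun_cong[OF \<Phi>_open_map[OF g(3)], of "\<lambda>z. f (\<Phi>inv z)" g] by simp
  then show "\<exists>T. z \<in> T \<and> holo_fun (\<lambda>z. f (\<Phi>inv z)) T" using g(4) x by (intro exI[of _ "\<Phi> ` Q"]) simp
qed

lemma holo_pull:
  assumes f: "holo_fun f D" and x: "x \<in> topspace X"
  shows "hol_at (\<lambda>y. f (\<Phi> y)) x"
  by (rule hol_at_compose[OF \<Phi>_hol[OF x] open_D _ f]) (use x in simp)

end

section \<open>Stein and Runge property of the image\<close>

lemma inv_into_id: "z \<in> S \<Longrightarrow> inv_into S id z = z"
  using inv_into_f_f[of id S z] by simp

lemma manifold_holo_fun_domain:
  fixes S :: "(complex^'n::finite) set"
  assumes "open S"
  shows "manifold_holo_fun {(S, id)} f \<longleftrightarrow> holo_fun f S"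
  using holo_fun_cong[OF assms, of "f \<circ> inv_into S id" f]
  by (simp add: manifold_holo_fun_def inv_into_id)

lemma complex_manifold_domain:
  fixes S :: "(complex^'n::finite) set"
  assumes S: "open S"
  shows "complex_manifold (top_of_set S) {(S, id)}"
proof -
  have "holo_map (transition (S, id) (S, id)) S"
    using holo_map_cong[OF S, of "transition (S, id) (S, id)" "\<lambda>z. z"] holo_map_id
    by (simp add: transition_def inv_into_id)
  moreover have "second_countable (top_of_set S)"
  proof (rule second_countable_subtopology)
    obtain \<B> :: "(complex^'n) set set" where B: "countable \<B>" "topological_basis \<B>"
      using ex_countable_basis by blast
    show "second_countable (euclidean :: (complex^'n) topology)"
      unfolding second_countable_def
    proof (intro exI[of _ \<B>] conjI ballI allI impI)
      show "openin euclidean V" if "V \<in> \<B>" for V using topological_basis_open[OF B(2) that] by simp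
      fix U and x :: "complex^'n" assume "openin euclidean U \<and> x \<in> U"
      then show "\<exists>V\<in>\<B>. x \<in> V \<and> V \<subseteq> U" using topological_basisE[OF B(2), of U x] by auto
    qed (fact B(1))
  qed
  moreover have "Hausdorff_space (top_of_set S)"
    by (intro Hausdorff_space_subtopology) (rule Hausdorff_space_euclidean)
  moreover have "chart_on (top_of_set S) (S, id)"
    using S by (simp add: chart_on_def subtopology_subtopology)
  ultimately show ?thesis by (simp add: complex_manifold_def)
qed

context conjugated_flow
begin

text \<open>On an open subset of \<open>n\<close>-space the coordinate functions separate points and
  give global coordinates. Holomorphic convexity is transported from \<open>X\<close>:
  \<open>\<Phi>\<close> is a homeomorphism onto \<open>D\<close> that matches holomorphic functions,
  hence also the hulls.\<close>

lemma stein_domain_D: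
  assumes convex: "holomorphically_convex X A"
  shows "stein_domain D"
  unfolding stein_domain_def stein_manifold_def
proof (intro conjI)
  show cm: "complex_manifold (top_of_set D) {(D, id)}" by (rule complex_manifold_domain[OF open_D])
  show "holomorphically_separable (top_of_set D) {(D, id)}"
    unfolding holomorphically_separable_def
  proof (intro ballI impI)
    fix z w assume "z \<noteq> (w :: complex^'n)"
    then obtain i where "z $ i \<noteq> w $ i" by (auto simp: vec_eq_iff)
    then show "\<exists>f. manifold_holo_fun {(D, id)} f \<and> f z \<noteq> f w"
      by (intro exI[of _ "\<lambda>z. z $ i"]) (simp add: manifold_holo_fun_domain[OF open_D] holo_fun_nth)
  qed
  show "has_global_coordinates (top_of_set D) {(D, id)}"
    unfolding has_global_coordinates_def
  proof
    fix z assume "z \<in> topspace (top_of_set D)"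
    then show "\<exists>W F. z \<in> W \<and> manifold_holo_map {(D, id)} F \<and> complex_manifold (top_of_set D) (insert (W, F) {(D, id)})"
      using cm by (intro exI[of _ D] exI[of _ id])
        (simp add: manifold_holo_map_def manifold_holo_fun_domain[OF open_D] holo_fun_nth)
  qed
  show "holomorphically_convex (top_of_set D) {(D, id)}"
    unfolding holomorphically_convex_def
  proof (intro allI impI)
    fix K assume K: "compactin (top_of_set D) K \<and> K \<noteq> {}"
    then have KD: "K \<subseteq> D" by (auto simp: compactin_def)
    define K' where "K' = \<Phi>inv ` K"
    have K': "compactin X K'" "K' \<noteq> {}"
      using image_compactin[OF _ continuous_\<Phi>inv] K by (auto simp: K'_def)
    have sup: "(SUP y\<in>K'. norm (f y)) = (SUP z\<in>K. norm (f (\<Phi>inv z)))" for f :: "'a \<Rightarrow> complex"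
      by (simp add: K'_def image_image)
    have "holo_hull (top_of_set D) {(D, id)} K = \<Phi> ` holo_hull X A K'"
    proof (intro equalityI subsetI)
      fix z assume z: "z \<in> holo_hull (top_of_set D) {(D, id)} K"
      then have "z \<in> D" by (simp add: holo_hull_def)
      then obtain x where x: "x \<in> topspace X" "z = \<Phi> x" by blast
      have "norm (f x) \<le> (SUP y\<in>K'. norm (f y))" if "manifold_holo_fun A f" for f
      proof -
        have hf: "manifold_holo_fun {(D, id)} (\<lambda>z. f (\<Phi>inv z))"
          using that holo_push by (simp add: manifold_holo_fun_domain[OF open_D] manifold_holo_fun_iff)
        have hull: "norm (g z) \<le> (SUP y\<in>K. norm (g y))" if "manifold_holo_fun {(D, id)} g" for g
          using z that by (simp add: holo_hull_def)
        from hull[OF hf] have "norm (f (\<Phi>inv z)) \<le> (SUP z\<in>K. norm (f (\<Phi>inv z)))" .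
        then show ?thesis using x by (simp add: sup \<Phi>inv)
      qed
      then have "x \<in> holo_hull X A K'" using x by (simp add: holo_hull_def)
      then show "z \<in> \<Phi> ` holo_hull X A K'" using x by blast
    next
      fix z assume "z \<in> \<Phi> ` holo_hull X A K'"
      then obtain x where x: "x \<in> holo_hull X A K'" "z = \<Phi> x" by blast
      then have xX: "x \<in> topspace X" by (simp add: holo_hull_def)
      have "norm (f z) \<le> (SUP z\<in>K. norm (f z))" if "manifold_holo_fun {(D, id)} f" for f
      proof -
        have hf: "manifold_holo_fun A (\<lambda>y. f (\<Phi> y))"
          using that holo_pull by (simp add: manifold_holo_fun_domain[OF open_D] manifold_holo_fun_iff)
        have hull: "norm (g x) \<le> (SUP y\<in>K'. norm (g y))" if "manifold_holo_fun A g" for g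
          using x(1) that by (simp add: holo_hull_def)
        from hull[OF hf] have "norm (f z) \<le> (SUP y\<in>K'. norm (f (\<Phi> y)))" unfolding x(2) .
        also have "\<dots> = (SUP z\<in>K. norm (f z))"
          unfolding sup using KD by (intro SUP_cong refl) (auto simp: \<Phi>inv)
        finally show ?thesis .
      qed
      then show "z \<in> holo_hull (top_of_set D) {(D, id)} K" using x xX by (simp add: holo_hull_def)
    qed
    moreover have "compactin X (holo_hull X A K')"
      using convex K' by (simp add: holomorphically_convex_def)
    ultimately show "compactin (top_of_set D) (holo_hull (top_of_set D) {(D, id)} K)"
      using image_compactin[OF _ continuous_\<Phi>] by simp
  qed
qed

text \<open>For large \<open>t\<close>, \<open>f \<circ> \<theta> t\<close> only involves the values of \<open>f\<close> near the equilibrium, where Taylor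
  polynomials approximate, and pulling them back by iterates of \<open>G\<close> keeps them entire. Analyticity in
  \<open>t\<close> carries the approximability back to \<open>t = 0\<close>.\<close>

lemma runge_D: "runge D"
  unfolding runge_def
proof (intro allI impI)
  fix f K and \<epsilon> :: real assume f: "holo_fun f D" and K: "compact K \<and> K \<subseteq> D \<and> 0 < \<epsilon>"
  define F where "F y = f (\<Phi> y)" for y
  have F: "\<forall>x\<in>topspace X. hol_at F x" unfolding F_def using holo_pull[OF f] by blast
  define K' where "K' = \<Phi>inv ` K"
  have "compactin (top_of_set D) K" using K by (simp add: compactin_subtopology)
  then have K': "compactin X K'" unfolding K'_def by (rule image_compactin[OF _ continuous_\<Phi>inv])
  then have K'X: "K' \<subseteq> topspace X" by (simp add: compactin_def)
  \<comment> \<open>Uniform approximability on \<open>K'\<close> by entire functions of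
    \<open>\<Phi>\<close>. It is stable under linear combinations and uniform limits, which are the
    conditions that the lemma on Taylor families imposes on a class of functions.\<close>
  define P where "P g \<longleftrightarrow> (\<forall>e>0. \<exists>q. holo_fun q UNIV \<and> (\<forall>y\<in>K'. norm (g y - q (\<Phi> y)) \<le> e))" for g :: "'a \<Rightarrow> complex"
  have P_add: "P (\<lambda>y. g y + h y)" if "P g" "P h" for g h
    unfolding P_def
  proof (intro allI impI)
    fix e :: real assume "0 < e"
    then obtain q r where q: "holo_fun q UNIV" "\<forall>y\<in>K'. norm (g y - q (\<Phi> y)) \<le> e / 2"
      and r: "holo_fun r UNIV" "\<forall>y\<in>K'. norm (h y - r (\<Phi> y)) \<le> e / 2"
      using \<open>P g\<close> \<open>P h\<close> unfolding P_def by (meson half_gt_zero)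
    show "\<exists>s. holo_fun s UNIV \<and> (\<forall>y\<in>K'. norm (g y + h y - s (\<Phi> y)) \<le> e)"
    proof (intro exI[of _ "\<lambda>z. q z + r z"] conjI ballI)
      show "holo_fun (\<lambda>z. q z + r z) UNIV" by (rule holo_fun_add[OF open_UNIV q(1) r(1)])
      fix y assume y: "y \<in> K'"
      have "norm ((g y - q (\<Phi> y)) + (h y - r (\<Phi> y))) \<le> e / 2 + e / 2"
        using q(2) r(2) y by (intro norm_triangle_mono) auto
      then show "norm (g y + h y - (q (\<Phi> y) + r (\<Phi> y))) \<le> e" by (simp add: algebra_simps)
    qed
  qed
  have P_cmult: "P (\<lambda>y. c * g y)" if g: "P g" for c g
    unfolding P_def
  proof (intro allI impI)
    fix e :: real assume e: "0 < e"
    have c: "0 < norm c + 1" by (simp add: add_nonneg_pos)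
    then have "0 < e / (norm c + 1)" using e by simp
    then obtain q where q: "holo_fun q UNIV" "\<forall>y\<in>K'. norm (g y - q (\<Phi> y)) \<le> e / (norm c + 1)"
      using g unfolding P_def by blast
    show "\<exists>s. holo_fun s UNIV \<and> (\<forall>y\<in>K'. norm (c * g y - s (\<Phi> y)) \<le> e)"
    proof (intro exI[of _ "\<lambda>z. c * q z"] conjI ballI)
      show "holo_fun (\<lambda>z. c * q z) UNIV" by (rule holo_fun_cmult[OF open_UNIV q(1)])
      fix y assume y: "y \<in> K'"
      have "norm (c * g y - c * q (\<Phi> y)) = norm c * norm (g y - q (\<Phi> y))"
        by (simp add: norm_mult flip: right_diff_distrib)
      also have "\<dots> \<le> (norm c + 1) * (e / (norm c + 1))" using q(2) y c by (intro mult_mono) auto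
      finally show "norm (c * g y - c * q (\<Phi> y)) \<le> e" using c by simp
    qed
  qed
  have P_lim: "P g" if g: "\<And>e. 0 < e \<Longrightarrow> \<exists>h. P h \<and> (\<forall>y\<in>K'. norm (h y - g y) \<le> e)" for g
    unfolding P_def
  proof (intro allI impI)
    fix e :: real assume "0 < e"
    then have e2: "0 < e / 2" by simp
    obtain h where h: "P h" "\<forall>y\<in>K'. norm (h y - g y) \<le> e / 2" using g[OF e2] by blast
    obtain q where q: "holo_fun q UNIV" "\<forall>y\<in>K'. norm (h y - q (\<Phi> y)) \<le> e / 2"
      using h(1) e2 unfolding P_def by blast
    have "norm (g y - q (\<Phi> y)) \<le> e" if "y \<in> K'" for y
      using norm_triangle_ineq4[of "h y - q (\<Phi> y)" "h y - g y"] h(2) q(2) that by fastforce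
    then show "\<exists>s. holo_fun s UNIV \<and> (\<forall>y\<in>K'. norm (g y - s (\<Phi> y)) \<le> e)" using q(1) by blast
  qed
  have P_cong: "P h" if "P g" "\<And>y. y \<in> K' \<Longrightarrow> g y = h y" for g h
    using that unfolding P_def by simp
  obtain \<delta> where \<delta>: "0 < \<delta>" "ball 0 \<delta> \<subseteq> D"
  proof -
    have "0 \<in> D" using \<Phi>_p p_topspace by force
    then show ?thesis using that open_D open_contains_ball by blast
  qed
  obtain T1 where T1: "0 \<le> T1" "\<And>t. T1 \<le> t \<Longrightarrow> P (\<lambda>y. F (\<theta> t y))"
  proof -
    define W where "W = {x \<in> topspace X. \<Phi> x \<in> ball 0 (\<delta> / 2)}"
    have "continuous_map X euclidean \<Phi>" using continuous_\<Phi> by (rule continuous_map_into_fulltopology)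
    then have "openin X W" unfolding W_def by (rule openin_continuous_map_preimage) simp
    moreover have "p \<in> W" using \<Phi>_p p_topspace \<delta> by (simp add: W_def)
    ultimately obtain T0 where T0: "0 \<le> T0" "\<forall>t\<ge>T0. \<forall>x\<in>K'. \<theta> t x \<in> W"
      by (rule flow_converges_uniformly[OF K'])
    obtain k where "T0 / T \<le> real k" using real_arch_simple by blast
    then have k: "T0 \<le> real k * T" using T by (simp add: pos_divide_le_eq)
    have "P (\<lambda>y. F (\<theta> t y))" if t: "real k * T \<le> t" for t
      unfolding P_def
    proof (intro allI impI)
      fix e :: real assume e: "0 < e"
      \<comment> \<open>The time is split as \<open>t = k * T + s\<close>. The first
        \<open>k\<close> steps of length \<open>T\<close> become \<open>G ^^ k\<close> in the
        coordinates, and the rest is absorbed into the function \<open>F \<circ> \<theta> s\<close>,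
        which is expanded into homogeneous parts around the image of \<open>p\<close>.\<close>
      define s where "s = t - real k * T"
      have s: "0 \<le> s" using t by (simp add: s_def)
      have "\<forall>x\<in>topspace X. hol_at (\<lambda>y. F (\<theta> s y)) x"
        using F flow_regular(2)[OF _ s] flow_topspace[OF _ s] by blast
      then have "holo_fun (\<lambda>z. F (\<theta> s (\<Phi>inv z))) D" by (rule holo_push)
      then have q0: "holo_fun (\<lambda>z. F (\<theta> s (\<Phi>inv z))) (ball 0 \<delta>)" using \<delta>(2) by (rule holo_fun_subset)
      have d2: "0 < \<delta> / 2" "\<delta> / 2 < \<delta>" using \<delta>(1) by auto
      obtain N where N: "\<And>z. z \<in> ball 0 (\<delta> / 2) \<Longrightarrow>
          norm (F (\<theta> s (\<Phi>inv z)) - (\<Sum>j<N. hpart (\<lambda>z. F (\<theta> s (\<Phi>inv z))) j z)) < e"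
        using hpart_approx[OF q0 \<delta>(1) d2 e] by metis
      define Q where "Q z = (\<Sum>j<N. hpart (\<lambda>z. F (\<theta> s (\<Phi>inv z))) j z)" for z
      have Q: "holo_fun Q UNIV" unfolding Q_def
        by (intro holo_fun_sum open_UNIV holo_fun_hpart[OF q0 \<delta>(1)])
      show "\<exists>q. holo_fun q UNIV \<and> (\<forall>y\<in>K'. norm (F (\<theta> t y) - q (\<Phi> y)) \<le> e)"
      proof (intro exI[of _ "\<lambda>z. Q ((G ^^ k) z)"] conjI ballI)
        show "holo_fun (\<lambda>z. Q ((G ^^ k) z)) UNIV"
          by (rule holo_fun_compose[OF funpow_holo_map[OF holG] Q]) simp
        fix y assume y: "y \<in> K'"
        then have yX: "y \<in> topspace X" using K'X by blast
        have "\<Phi> (\<theta> (real k * T) y) \<in> ball 0 (\<delta> / 2)" using T0(2) k y by (auto simp: W_def)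
        from N[OF this] have "norm (F (\<theta> s (\<theta> (real k * T) y)) - Q ((G ^^ k) (\<Phi> y))) < e"
          using \<Phi>_iterate[OF yX] \<Phi>inv[OF flow_topspace[OF yX kT_nonneg]] by (simp add: Q_def)
        moreover have "\<theta> s (\<theta> (real k * T) y) = \<theta> t y" using flow_diff[OF yX kT_nonneg t] by (simp add: s_def)
        ultimately show "norm (F (\<theta> t y) - Q ((G ^^ k) (\<Phi> y))) \<le> e" by simp
      qed
    qed
    then show ?thesis using that[of "real k * T"] kT_nonneg by blast
  qed
  \<comment> \<open>The induction runs backwards in time: \<open>u\<close> measures how far below
    \<open>T1\<close> approximability has been established.\<close>
  define R where "R u \<longleftrightarrow> (\<forall>t. 0 \<le> t \<and> T1 - u \<le> t \<longrightarrow> P (\<lambda>y. F (\<theta> t y)))" for u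
  have "R T1"
  proof (rule real_induction_local[where P = R, OF _ _ T1(1)])
    show "R 0" using T1(2) by (simp add: R_def)
  next
    fix u0 :: real assume u0: "0 \<le> u0"
    define t0 where "t0 = T1 - u0"
    show "\<exists>d>0. \<forall>s u. 0 \<le> s \<and> s \<le> u \<and> \<bar>s - u0\<bar> < d \<and> \<bar>u - u0\<bar> < d \<and> R s \<longrightarrow> R u"
    \<comment> \<open>If \<open>t0 < 0\<close>, every \<open>s\<close> sufficiently close to
      \<open>u0\<close> already covers all nonnegative times.\<close>
    proof (cases "t0 < 0")
      case True
      have "R u" if "\<bar>s - u0\<bar> < - t0" "R s" for s u
      proof -
        have "T1 - s \<le> 0" using that(1) by (simp add: t0_def)
        then have "P (\<lambda>y. F (\<theta> t y))" if "0 \<le> t" for t using \<open>R s\<close> that unfolding R_def by force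
        then show ?thesis by (simp add: R_def)
      qed
      then show ?thesis using True by (intro exI[of _ "- t0"]) auto
    next
      case False
      then have t0: "0 \<le> t0" by simp
      obtain d \<rho> C where d: "0 < d" "0 < \<rho>" "\<forall>y\<in>K'. \<forall>s. 0 \<le> s \<and> \<bar>s - t0\<bar> < d \<longrightarrow>
        (\<exists>h. h holomorphic_on cball 0 \<rho> \<and> (\<forall>\<tau>\<in>cball 0 \<rho>. norm (h \<tau>) \<le> C) \<and>
          (\<forall>t. 0 \<le> t \<and> t \<le> \<rho> \<longrightarrow> F (\<theta> (s + t) y) = h (of_real t)))"
        by (rule flow_time_extension[OF F K' t0])
      have "R u" if u: "s \<le> u" "\<bar>s - u0\<bar> < min d (\<rho> / 8)" "\<bar>u - u0\<bar> < min d (\<rho> / 8)" and Rs: "R s" for s u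
        unfolding R_def
      proof (intro allI impI)
        fix t assume t: "0 \<le> t \<and> T1 - u \<le> t"
        show "P (\<lambda>y. F (\<theta> t y))"
        proof (cases "T1 - s \<le> t")
          case True
          then show ?thesis using Rs t by (simp add: R_def)
        next
          case False
          have near: "\<bar>t - t0\<bar> < d" "\<bar>t - t0\<bar> < \<rho> / 8" using False t u(2,3) unfolding t0_def by linarith+
          have s_le: "T1 - s \<le> t0 + \<rho> / 8" using u(2) unfolding t0_def by linarith
          have "\<forall>y\<in>K'. \<exists>h. h holomorphic_on cball 0 \<rho> \<and> (\<forall>\<tau>\<in>cball 0 \<rho>. norm (h \<tau>) \<le> C) \<and>
              (\<forall>r. 0 \<le> r \<and> r \<le> \<rho> \<longrightarrow> F (\<theta> (t + r) y) = h (of_real r))"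
            using d(3) t near(1) by blast
          from bchoice[OF this] obtain h where h: "\<forall>y\<in>K'. h y holomorphic_on cball 0 \<rho> \<and>
              (\<forall>\<tau>\<in>cball 0 \<rho>. norm (h y \<tau>) \<le> C) \<and> (\<forall>r. 0 \<le> r \<and> r \<le> \<rho> \<longrightarrow> F (\<theta> (t + r) y) = h y (of_real r))" ..
          \<comment> \<open>The extension \<open>h y\<close>, which starts at time \<open>t\<close>,
            is recentred at \<open>\<rho> / 4\<close>. Small positive \<open>\<zeta>\<close> then
            correspond to times of at least \<open>T1 - s\<close>, where approximability is known,
            while time \<open>t\<close> itself is the value at \<open>- c\<close>, still inside the
            disc of radius \<open>\<rho> / 2\<close>.\<close>
          define c :: complex where "c = of_real (\<rho> / 4)"
          have nc: "norm c = \<rho> / 4" using d(2) by (simp add: c_def)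
          have sh: "\<zeta> + c \<in> cball 0 \<rho>" if "norm \<zeta> \<le> \<rho> / 2" for \<zeta>
            using norm_triangle_ineq[of \<zeta> c] that nc d(2) by simp
          have "P (\<lambda>y. h y (- c + c))"
          proof (rule taylor_family_value[where P = P and K = K' and R = "\<rho> / 2" and M = C and ?e0.0 = "\<rho> / 2"
                and h = "\<lambda>y \<zeta>. h y (\<zeta> + c)" and \<tau> = "- c", OF P_add P_cmult P_lim])
            show "0 < \<rho> / 2" "0 < \<rho> / 2" using d(2) by auto
            show "norm (- c) < \<rho> / 2" using nc d(2) by simp
            show "norm (h y (\<zeta> + c)) \<le> C" if "y \<in> K'" "norm \<zeta> \<le> \<rho> / 2" for y \<zeta>
              using h that(1) sh[OF that(2)] by blast
            show "(\<lambda>\<zeta>. h y (\<zeta> + c)) holomorphic_on cball 0 (\<rho> / 2)" if y: "y \<in> K'" for y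
            proof -
              have hy: "h y holomorphic_on cball 0 \<rho>" using h y by blast
              have im: "(\<lambda>\<zeta>. \<zeta> + c) ` cball 0 (\<rho> / 2) \<subseteq> cball 0 \<rho>" using sh by auto
              have "h y \<circ> (\<lambda>\<zeta>. \<zeta> + c) holomorphic_on cball 0 (\<rho> / 2)"
                by (rule holomorphic_on_compose_gen[OF _ hy im]) (intro holomorphic_intros)
              then show ?thesis by (simp add: comp_def)
            qed
            fix e :: real assume e: "0 < e" "e < \<rho> / 2"
            have "0 \<le> t + (\<rho> / 4 + e) \<and> T1 - s \<le> t + (\<rho> / 4 + e)"
              using t near(2) s_le e d(2) by linarith
            then have "P (\<lambda>y. F (\<theta> (t + (\<rho> / 4 + e)) y))" using Rs unfolding R_def by blast
            then show "P (\<lambda>y. h y (of_real e + c))"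
            proof (rule P_cong)
              fix y assume "y \<in> K'"
              moreover have "0 \<le> \<rho> / 4 + e \<and> \<rho> / 4 + e \<le> \<rho>" using e d(2) by linarith
              ultimately have "F (\<theta> (t + (\<rho> / 4 + e)) y) = h y (of_real (\<rho> / 4 + e))" using h by blast
              then show "F (\<theta> (t + (\<rho> / 4 + e)) y) = h y (of_real e + c)" by (simp add: c_def add.commute)
            qed
          qed
          then have "P (\<lambda>y. h y 0)" by simp
          then show ?thesis
          proof (rule P_cong)
            fix y assume "y \<in> K'"
            then have "\<forall>r. 0 \<le> r \<and> r \<le> \<rho> \<longrightarrow> F (\<theta> (t + r) y) = h y (of_real r)" using h by blast
            from this[rule_format, of 0] show "h y 0 = F (\<theta> t y)" using d(2) by simp
          qed
        qed
      qed
      then show ?thesis using d(1,2) by (intro exI[of _ "min d (\<rho> / 8)"]) (simp, blast)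
    qed
  qed
  then have "P (\<lambda>y. F (\<theta> 0 y))" by (simp add: R_def)
  then have "P F" by (rule P_cong) (use flow_0 K'X in auto)
  moreover have "0 < \<epsilon> / 2" using K by simp
  ultimately obtain q where q: "holo_fun q UNIV" "\<forall>y\<in>K'. norm (F y - q (\<Phi> y)) \<le> \<epsilon> / 2"
    unfolding P_def by blast
  have "norm (f z - q z) < \<epsilon>" if z: "z \<in> K" for z
  proof -
    have "z \<in> D" using K z by blast
    then have "\<Phi> (\<Phi>inv z) = z" by (rule f_inv_into_f)
    moreover have "norm (F (\<Phi>inv z) - q (\<Phi> (\<Phi>inv z))) \<le> \<epsilon> / 2" using q(2) z by (simp add: K'_def)
    ultimately show ?thesis using K by (simp add: F_def)
  qed
  then show "\<exists>g. holo_fun g UNIV \<and> (\<forall>z\<in>K. norm (f z - g z) < \<epsilon>)" using q(1) by blast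
qed

lemma stein_runge_embedding_\<Phi>:
  assumes "holomorphically_convex X A"
  shows "stein_runge_embedding X A \<Phi>"
  unfolding stein_runge_embedding_def manifold_holo_map_def
  using \<Phi>_hol \<Phi>_inj stein_domain_D[OF assms] runge_D by (simp add: manifold_holo_fun_iff)

end


section \<open>Assembly of the local and the global construction\<close>

text \<open>\<open>\<xi>\<close> is the chart centred at \<open>p\<close> followed by the conjugacy
  \<open>\<Psi>\<close>. The contraction keeps the chart ball \<open>B\<close> invariant under
  \<open>\<theta> T\<close>, and germs factor through \<open>\<xi>\<close> because the inverse of
  \<open>\<Psi>\<close> is holomorphic on an open set.\<close>

lemma (in gas_flow) conjugated_flow_exists:
  assumes n: "2 \<le> CARD('n)"
  shows "\<exists>B \<xi> T G H. conjugated_flow X A V \<theta> p B \<xi> T G H"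
proof -
  obtain U \<phi> r T F and D :: "complex^'n \<Rightarrow> complex^'n" where U: "(U, \<phi>) \<in> A" "p \<in> U" and r: "0 < r" and T: "0 < T"
    and sub: "ball (\<phi> p) r \<subseteq> \<phi> ` U"
    and step: "\<forall>x\<in>U. \<phi> x \<in> ball (\<phi> p) r \<longrightarrow> \<theta> T x \<in> U \<and> \<phi> (\<theta> T x) - \<phi> p = F (\<phi> x - \<phi> p)"
    and F: "holo_map F (ball 0 r)" "\<forall>z\<in>ball 0 r. norm (F z) \<le> 1 / 2 * norm z"
    and D: "(F has_derivative D) (at 0)" "inj D"
    by (rule attracting_chart)
  have half: "(0::real) < 1 / 2" "(1::real) / 2 < 1" by auto
  obtain G H \<Psi> :: "complex^'n \<Rightarrow> complex^'n" and \<rho> where aut: "aut_pair G H" and \<rho>: "0 < \<rho>" "\<rho> \<le> r"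
    and \<Psi>: "holo_map \<Psi> (ball 0 \<rho>)" "\<forall>z\<in>ball 0 \<rho>. \<Psi> z = H (\<Psi> (F z))" "inj_on \<Psi> (ball 0 \<rho>)"
      "open (\<Psi> ` ball 0 \<rho>)" "holo_map (inv_into (ball 0 \<rho>) \<Psi>) (\<Psi> ` ball 0 \<rho>)" "\<Psi> 0 = 0"
    by (rule contraction_conjugacy[OF n F(1) r bspec[OF F(2)] half D])
  define B where "B = {x \<in> U. \<phi> x \<in> ball (\<phi> p) \<rho>}"
  define \<xi> where "\<xi> x = \<Psi> (\<phi> x - \<phi> p)" for x
  have ball: "\<phi> x - \<phi> p \<in> ball 0 \<rho>" if "x \<in> B" for x using that by (simp add: B_def dist_norm norm_minus_commute)
  have sub\<rho>: "ball (\<phi> p) \<rho> \<subseteq> ball (\<phi> p) r" "ball 0 \<rho> \<subseteq> ball (0::complex^'n) r" using \<rho>(2) by (auto intro!: subset_ball)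
  have "conjugated_flow X A V \<theta> p B \<xi> T G H"
  proof unfold_locales
    show "openin X B" unfolding B_def by (rule chart_preimage_open[OF U(1) open_ball])
    show "p \<in> B" using U(2) \<rho>(1) by (simp add: B_def)
    show "0 < T" "aut_pair G H" by fact+
    show "\<xi> p = 0" by (simp add: \<xi>_def \<Psi>(6))
    show "\<theta> T x \<in> B \<and> \<xi> x = H (\<xi> (\<theta> T x))" if x: "x \<in> B" for x
    proof -
      define z where "z = \<phi> x - \<phi> p"
      have z: "z \<in> ball 0 \<rho>" using ball[OF x] by (simp add: z_def)
      have st: "\<theta> T x \<in> U" "\<phi> (\<theta> T x) - \<phi> p = F z" using step x sub\<rho>(1) by (auto simp: B_def z_def)
      have "norm (F z) \<le> 1 / 2 * norm z" using F(2) z sub\<rho>(2) by blast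
      moreover have "norm z < \<rho>" using z by simp
      ultimately have "norm (F z) < \<rho>" using norm_ge_zero[of z] by linarith
      then have "norm (\<phi> (\<theta> T x) - \<phi> p) < \<rho>" by (simp only: st(2))
      then have "\<theta> T x \<in> B" using st(1) by (simp add: B_def dist_norm norm_minus_commute)
      moreover have "\<xi> x = H (\<xi> (\<theta> T x))" using \<Psi>(2) z st(2) by (simp add: \<xi>_def z_def)
      ultimately show ?thesis ..
    qed
    show "hol_at (\<lambda>y. \<xi> y $ i) x" if x: "x \<in> B" for x i
    proof (rule hol_atI[OF U(1) _ open_ball[of "\<phi> p" \<rho>]])
      show "x \<in> U" "\<phi> x \<in> ball (\<phi> p) \<rho>" using x by (auto simp: B_def)
      show "holo_fun (\<lambda>z. \<Psi> (z + - \<phi> p) $ i) (ball (\<phi> p) \<rho>)"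
        by (rule holo_fun_compose[where g = "\<lambda>w. \<Psi> w $ i" and T = "ball 0 \<rho>", OF holo_map_translate])
           (use \<Psi>(1) in \<open>auto simp: holo_map_def dist_norm norm_minus_commute\<close>)
    qed (simp add: \<xi>_def)
    show "inj_on \<xi> B"
    proof (rule inj_onI)
      fix x y assume x: "x \<in> B" and y: "y \<in> B" and "\<xi> x = \<xi> y"
      then have "\<phi> x - \<phi> p = \<phi> y - \<phi> p" using inj_onD[OF \<Psi>(3) _ ball[OF x] ball[OF y]] by (simp add: \<xi>_def)
      then show "x = y" using x y inj_onD[OF chart_inj[OF U(1)], of x y] by (simp add: B_def)
    qed
    fix x f assume x: "x \<in> B" and f: "hol_at f x"
    let ?\<Psi>i = "inv_into (ball 0 \<rho>) \<Psi>"
    have xU: "x \<in> U" using x by (simp add: B_def)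
    obtain g e where g: "0 < e" "ball (\<phi> x) e \<subseteq> \<phi> ` U" "holo_fun g (ball (\<phi> x) e)"
      "\<forall>y\<in>U. \<phi> y \<in> ball (\<phi> x) e \<longrightarrow> f y = g (\<phi> y)"
      by (rule hol_at_chart[OF f U(1) xU])
    have tr: "holo_map (\<lambda>w. ?\<Psi>i w + \<phi> p) (\<Psi> ` ball 0 \<rho>)"
      by (rule holo_map_compose[OF \<Psi>(5) holo_map_translate[of _ UNIV]]) simp
    define S where "S = {w \<in> \<Psi> ` ball 0 \<rho>. ?\<Psi>i w + \<phi> p \<in> ball (\<phi> x) e}"
    define Q where "Q = {y \<in> U. \<phi> y \<in> ball (\<phi> p) \<rho> \<inter> ball (\<phi> x) e}"
    have "open S" unfolding S_def
      using continuous_open_preimage[OF holo_map_continuous_on[OF tr] \<Psi>(4) open_ball[of "\<phi> x" e]]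
      by (simp add: vimage_def Int_def)
    moreover have "holo_fun (\<lambda>w. g (?\<Psi>i w + \<phi> p)) S"
      by (rule holo_fun_compose[OF holo_map_subset[OF tr] g(3)]) (auto simp: S_def)
    moreover have "openin X Q" unfolding Q_def by (intro chart_preimage_open[OF U(1)] open_Int open_ball)
    moreover have "x \<in> Q" using x g(1) by (simp add: Q_def B_def)
    moreover have "\<xi> y \<in> S \<and> f y = g (?\<Psi>i (\<xi> y) + \<phi> p)" if y: "y \<in> Q" for y
    proof -
      have yB: "y \<in> B" "\<phi> y \<in> ball (\<phi> x) e" "y \<in> U" using y by (auto simp: Q_def B_def)
      have "?\<Psi>i (\<xi> y) = \<phi> y - \<phi> p" unfolding \<xi>_def by (rule inv_into_f_f[OF \<Psi>(3) ball[OF yB(1)]])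
      then show ?thesis using yB g(4) ball[OF yB(1)] by (auto simp: S_def \<xi>_def)
    qed
    ultimately show "\<exists>g S Q. open S \<and> holo_fun g S \<and> openin X Q \<and> x \<in> Q \<and> (\<forall>y\<in>Q. \<xi> y \<in> S \<and> f y = g (\<xi> y))"
      by (intro exI[of _ "\<lambda>w. g (?\<Psi>i w + \<phi> p)"] exI[of _ S] exI[of _ Q]) blast
  qed
  then show ?thesis by blast
qed

theorem theorem1p6:
  fixes X :: "'a topology"
    and A :: "('a, 'n::finite) chart set"
    and V :: "('a, 'n) vfield"
  assumes "CARD('n) \<ge> 2"
    and "stein_manifold X A"
    and "complete_gas_vector_field X A V"
  shows "\<exists>\<Phi> :: 'a \<Rightarrow> complex^'n. stein_runge_embedding X A \<Phi>"
proof -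
  obtain p \<theta> where p: "\<forall>q. equilibrium_point X A V q \<longleftrightarrow> q = p" and "forward_flow X A V \<theta>"
    "globally_asymptotically_stable X \<theta> p" and "holomorphic_vector_field A V"
    using assms(3) by (auto simp: complete_gas_vector_field_def)
  then interpret gas_flow X A V \<theta> p
    using assms(2) by unfold_locales (auto simp: stein_manifold_def)
  obtain B \<xi> T G H where "conjugated_flow X A V \<theta> p B \<xi> T G H"
    using conjugated_flow_exists assms(1) by blast
  then interpret conjugated_flow X A V \<theta> p B \<xi> T G H .
  have "stein_runge_embedding X A \<Phi>"
    using assms(2) by (intro stein_runge_embedding_\<Phi>) (simp add: stein_manifold_def)
  then show ?thesis by blast
qed

end
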